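(* Let $(R,\mathfrak m)$ be a Gorenstein local ring of dimension one and let $I$ be an $\mathfrak m$-primary ideal of $R$. Then the following assertions hold true. (1) $r(R/I)\le r_R(I)\le 1+r(R/I)$. (2) $r(R\ltimes I)=1+r_R(I)$, if $\mu_R(I)>1$.
   Context: All rings are commutative. For a ring $R$ and an $R$-module $M$, the idealization $R\ltimes M$ is the ring with additive group $R\oplus M$ and multiplication $(a,x)(b,y)=(ab,ay+bx)$. If $(R,\mathfrak m)$ is a Cohen-Macaulay (Noetherian) local ring of dimension $d$ and $M$ is a finitely generated $R$-module with $\operatorname{depth}_RM=d$, then $R\ltimes M$ is a Cohen-Macaulay local ring of dimension $d$ with maximal ideal $\mathfrak m\times M$. The Cohen-Macaulay type of such an $M$ is $r_R(M)=\ell_R(\operatorname{Ext}^d_R(R/\mathfrak m,M))$, where $\ell_R$ denotes length, and $r(R)=r_R(R)$; for the Artinian ring $R/I$, $r(R/I)$ is the length of its socle. $\mu_R(I)$ is the minimal number of generators of $I$. *)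

theory Defs
  imports "HOL-Library.Extended_Nat" "HOL-Algebra.Module" "HOL-Algebra.Ring_Divisibility"
begin

section \<open>Local rings, Krull dimension, primary ideals\<close>

definition noetherian_local_ring :: "('a, 'c) ring_scheme \<Rightarrow> 'a set \<Rightarrow> bool" where
  "noetherian_local_ring R m \<longleftrightarrow>
     cring R \<and> noetherian_ring R \<and> maximalideal m R \<and> (\<forall>J. maximalideal J R \<longrightarrow> J = m)"

text \<open>Only meaningful for local rings.\<close>

definition max_ideal :: "('a, 'c) ring_scheme \<Rightarrow> 'a set" where
  "max_ideal R = (THE m. maximalideal m R)"

definition krull_dim :: "('a, 'c) ring_scheme \<Rightarrow> enat" where
  "krull_dim R = Sup {enat n | n. \<exists>P :: nat \<Rightarrow> 'a set.
     (\<forall>i\<le>n. primeideal (P i) R) \<and> (\<forall>i<n. P i \<subset> P (Suc i))}"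

definition radical :: "('a, 'c) ring_scheme \<Rightarrow> 'a set \<Rightarrow> 'a set" where
  "radical R I = {a \<in> carrier R. \<exists>n::nat. a [^]\<^bsub>R\<^esub> n \<in> I}"

definition primary_ideal :: "'a set \<Rightarrow> ('a, 'c) ring_scheme \<Rightarrow> bool" where
  "primary_ideal I R \<longleftrightarrow> ideal I R \<and> I \<noteq> carrier R \<and>
     (\<forall>a\<in>carrier R. \<forall>b\<in>carrier R. a \<otimes>\<^bsub>R\<^esub> b \<in> I \<longrightarrow> a \<in> I \<or> b \<in> radical R I)"

text \<open>The minimal number of generators of a finitely generated ideal.\<close>

definition min_gens :: "('a, 'c) ring_scheme \<Rightarrow> 'a set \<Rightarrow> nat" where
  "min_gens R I = (LEAST n. \<exists>A. A \<subseteq> carrier R \<and> finite A \<and> card A = n \<and> Idl\<^bsub>R\<^esub> A = I)"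


section \<open>Constructions with modules\<close>

text \<open>
  The record type of modules extends that of rings, so it has fields for a multiplication and a
  unit; the locale \<^locale>\<open>module\<close> does not constrain them, and they are left undefined below.
\<close>

text \<open>A ring as a module over itself, and an ideal as a module over the ring.\<close>

definition regular_module :: "('a, 'c) ring_scheme \<Rightarrow> ('a, 'a) module" where
  "regular_module R =
     \<lparr>carrier = carrier R, monoid.mult = undefined, one = undefined,
      ring.zero = \<zero>\<^bsub>R\<^esub>, add = add R, smult = monoid.mult R\<rparr>"

definition ideal_module :: "('a, 'c) ring_scheme \<Rightarrow> 'a set \<Rightarrow> ('a, 'a) module" where
  "ideal_module R I = (regular_module R)\<lparr>carrier := I\<rparr>"

definition quotient_module :: "('a, 'b) module \<Rightarrow> 'b set \<Rightarrow> ('a, 'b set) module" where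
  "quotient_module M H =
     \<lparr>carrier = a_rcosets\<^bsub>M\<^esub> H, monoid.mult = undefined, one = undefined,
      ring.zero = H, add = set_add M,
      smult = (\<lambda>a C. \<Union>x\<in>C. H +>\<^bsub>M\<^esub> (a \<odot>\<^bsub>M\<^esub> x))\<rparr>"

definition residue_module :: "('a, 'c) ring_scheme \<Rightarrow> ('a, 'a set) module" where
  "residue_module R = quotient_module (regular_module R) (max_ideal R)"

definition free_module :: "('a, 'c) ring_scheme \<Rightarrow> nat \<Rightarrow> ('a, nat \<Rightarrow> 'a) module" where
  "free_module R n =
     \<lparr>carrier = {..<n} \<rightarrow>\<^sub>E carrier R, monoid.mult = undefined, one = undefined,
      ring.zero = (\<lambda>i\<in>{..<n}. \<zero>\<^bsub>R\<^esub>),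
      add = (\<lambda>u v. \<lambda>i\<in>{..<n}. u i \<oplus>\<^bsub>R\<^esub> v i),
      smult = (\<lambda>a u. \<lambda>i\<in>{..<n}. a \<otimes>\<^bsub>R\<^esub> u i)\<rparr>"

text \<open>Linear maps are made extensional, so that they form a module.\<close>

definition lin_maps ::
    "('a, 'c) ring_scheme \<Rightarrow> ('a, 'b) module \<Rightarrow> ('a, 'd) module \<Rightarrow> ('b \<Rightarrow> 'd) set" where
  "lin_maps R M N = {f \<in> carrier M \<rightarrow>\<^sub>E carrier N.
     (\<forall>x\<in>carrier M. \<forall>y\<in>carrier M. f (x \<oplus>\<^bsub>M\<^esub> y) = f x \<oplus>\<^bsub>N\<^esub> f y) \<and>
     (\<forall>a\<in>carrier R. \<forall>x\<in>carrier M. f (a \<odot>\<^bsub>M\<^esub> x) = a \<odot>\<^bsub>N\<^esub> f x)}"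

definition Hom_module ::
    "('a, 'c) ring_scheme \<Rightarrow> ('a, 'b) module \<Rightarrow> ('a, 'd) module \<Rightarrow> ('a, 'b \<Rightarrow> 'd) module" where
  "Hom_module R M N =
     \<lparr>carrier = lin_maps R M N, monoid.mult = undefined, one = undefined,
      ring.zero = (\<lambda>x\<in>carrier M. \<zero>\<^bsub>N\<^esub>),
      add = (\<lambda>f g. \<lambda>x\<in>carrier M. f x \<oplus>\<^bsub>N\<^esub> g x),
      smult = (\<lambda>a f. \<lambda>x\<in>carrier M. a \<odot>\<^bsub>N\<^esub> f x)\<rparr>"

definition module_length :: "('a, 'c) ring_scheme \<Rightarrow> ('a, 'b) module \<Rightarrow> enat" where
  "module_length R M = Sup {enat n | n. \<exists>H :: nat \<Rightarrow> 'b set.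
     (\<forall>i\<le>n. submodule (H i) R M) \<and> (\<forall>i<n. H i \<subset> H (Suc i))}"

definition idealization ::
    "('a, 'c) ring_scheme \<Rightarrow> ('a, 'b) module \<Rightarrow> ('a \<times> 'b) ring" where
  "idealization R M =
     \<lparr>carrier = carrier R \<times> carrier M,
      monoid.mult = (\<lambda>(a, x) (b, y). (a \<otimes>\<^bsub>R\<^esub> b, a \<odot>\<^bsub>M\<^esub> y \<oplus>\<^bsub>M\<^esub> b \<odot>\<^bsub>M\<^esub> x)),
      one = (\<one>\<^bsub>R\<^esub>, \<zero>\<^bsub>M\<^esub>),
      ring.zero = (\<zero>\<^bsub>R\<^esub>, \<zero>\<^bsub>M\<^esub>),
      add = (\<lambda>(a, x) (b, y). (a \<oplus>\<^bsub>R\<^esub> b, x \<oplus>\<^bsub>M\<^esub> y))\<rparr>"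


section \<open>Ext and the Cohen-Macaulay type\<close>

text \<open>
  \<open>\<dots> \<rightarrow> R^(n 1) \<rightarrow> R^(n 0) \<rightarrow> N \<rightarrow> 0\<close> is exact, with augmentation \<open>\<epsilon>\<close> and
  \<open>d i\<close> the map from degree \<open>i + 1\<close> to degree \<open>i\<close>.
\<close>

definition free_resolution ::
    "('a, 'c) ring_scheme \<Rightarrow> ('a, 'b) module \<Rightarrow>
     (nat \<Rightarrow> nat) \<Rightarrow> (nat \<Rightarrow> (nat \<Rightarrow> 'a) \<Rightarrow> (nat \<Rightarrow> 'a)) \<Rightarrow> ((nat \<Rightarrow> 'a) \<Rightarrow> 'b) \<Rightarrow> bool" where
  "free_resolution R N n d \<epsilon> \<longleftrightarrow>
     \<epsilon> \<in> lin_maps R (free_module R (n 0)) N \<and>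
     \<epsilon> ` carrier (free_module R (n 0)) = carrier N \<and>
     (\<forall>i. d i \<in> lin_maps R (free_module R (n (Suc i))) (free_module R (n i))) \<and>
     d 0 ` carrier (free_module R (n 1)) = a_kernel (free_module R (n 0)) N \<epsilon> \<and>
     (\<forall>i. d (Suc i) ` carrier (free_module R (n (Suc (Suc i)))) =
          a_kernel (free_module R (n (Suc i))) (free_module R (n i)) (d i))"

definition cocycles ::
    "('a, 'c) ring_scheme \<Rightarrow> (nat \<Rightarrow> nat) \<Rightarrow> (nat \<Rightarrow> (nat \<Rightarrow> 'a) \<Rightarrow> (nat \<Rightarrow> 'a)) \<Rightarrow>
     ('a, 'd) module \<Rightarrow> nat \<Rightarrow> ((nat \<Rightarrow> 'a) \<Rightarrow> 'd) set" where
  "cocycles R n d M i = {f \<in> lin_maps R (free_module R (n i)) M.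
     compose (carrier (free_module R (n (Suc i)))) f (d i) =
       \<zero>\<^bsub>Hom_module R (free_module R (n (Suc i))) M\<^esub>}"

fun coboundaries ::
    "('a, 'c) ring_scheme \<Rightarrow> (nat \<Rightarrow> nat) \<Rightarrow> (nat \<Rightarrow> (nat \<Rightarrow> 'a) \<Rightarrow> (nat \<Rightarrow> 'a)) \<Rightarrow>
     ('a, 'd) module \<Rightarrow> nat \<Rightarrow> ((nat \<Rightarrow> 'a) \<Rightarrow> 'd) set" where
  "coboundaries R n d M 0 = {\<zero>\<^bsub>Hom_module R (free_module R (n 0)) M\<^esub>}"
| "coboundaries R n d M (Suc i) =
     (\<lambda>f. compose (carrier (free_module R (n (Suc i)))) f (d i)) `
       lin_maps R (free_module R (n i)) M"

text \<open>
  \<open>Ext\<^sup>i\<close> of \<open>N\<close> and \<open>M\<close> is the cohomology of the complex obtained by applying \<open>Hom(-, M)\<close> to a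
  free resolution of \<open>N\<close>.  Resolutions by free modules of finite rank suffice, and exist, for
  finitely generated \<open>N\<close> over a Noetherian ring; as usual, the choice of the resolution affects
  the result only up to isomorphism.
\<close>

definition Ext_module ::
    "('a, 'c) ring_scheme \<Rightarrow> nat \<Rightarrow> ('a, 'b) module \<Rightarrow> ('a, 'd) module \<Rightarrow>
     ('a, ((nat \<Rightarrow> 'a) \<Rightarrow> 'd) set) module" where
  "Ext_module R i N M =
     (let (n, d, _) = (SOME (n, d, \<epsilon>). free_resolution R N n d \<epsilon>)
      in quotient_module
           ((Hom_module R (free_module R (n i)) M)\<lparr>carrier := cocycles R n d M i\<rparr>)
           (coboundaries R n d M i))"

text \<open>
  For a Cohen-Macaulay local ring \<open>R\<close> of dimension \<open>d\<close> and a finitely generated module \<open>M\<close> of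
  depth \<open>d\<close>.
\<close>

definition cm_type :: "('a, 'c) ring_scheme \<Rightarrow> ('a, 'b) module \<Rightarrow> enat" where
  "cm_type R M =
     module_length R (Ext_module R (the_enat (krull_dim R)) (residue_module R) M)"

definition ring_type :: "('a, 'c) ring_scheme \<Rightarrow> enat" where
  "ring_type R = cm_type R (regular_module R)"


section \<open>Gorenstein local rings\<close>

text \<open>
  A definition in HOL cannot quantify over all modules of arbitrary type.  The test modules \<open>N\<close>
  here have elements in the type of the ring; this includes the ring itself with its ideals as
  submodules, so by Baer's criterion the condition is injectivity in the unrestricted sense.
\<close>

definition injective_module :: "('a, 'c) ring_scheme \<Rightarrow> ('a, 'e) module \<Rightarrow> bool" where
  "injective_module R E \<longleftrightarrow> module R E \<and>
     (\<forall>(N :: ('a, 'a) module) H f.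
        module R N \<and> submodule H R N \<and> f \<in> lin_maps R (N\<lparr>carrier := H\<rparr>) E \<longrightarrow>
        (\<exists>g \<in> lin_maps R N E. \<forall>x\<in>H. g x = f x))"

text \<open>\<open>0 \<rightarrow> M \<rightarrow> E 0 \<rightarrow> E 1 \<rightarrow> \<dots>\<close> is exact, with all \<open>E i\<close> injective.\<close>

definition injective_resolution ::
    "('a, 'c) ring_scheme \<Rightarrow> ('a, 'b) module \<Rightarrow>
     (nat \<Rightarrow> ('a, 'e) module) \<Rightarrow> (nat \<Rightarrow> 'e \<Rightarrow> 'e) \<Rightarrow> ('b \<Rightarrow> 'e) \<Rightarrow> bool" where
  "injective_resolution R M E \<delta> \<eta> \<longleftrightarrow>
     (\<forall>i. injective_module R (E i)) \<and>
     \<eta> \<in> lin_maps R M (E 0) \<and> inj_on \<eta> (carrier M) \<and>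
     (\<forall>i. \<delta> i \<in> lin_maps R (E i) (E (Suc i))) \<and>
     \<eta> ` carrier M = a_kernel (E 0) (E 1) (\<delta> 0) \<and>
     (\<forall>i. \<delta> i ` carrier (E i) = a_kernel (E (Suc i)) (E (Suc (Suc i))) (\<delta> (Suc i)))"

text \<open>
  The type argument is the type in which the terms of the resolution live.  A statement with a
  hypothesis \<open>gorenstein_local_ring TYPE('e) R m\<close> for a type variable \<open>'e\<close> covers all Gorenstein
  local rings, since \<open>'e\<close> can be instantiated with any sufficiently large type.
\<close>

definition finite_injective_dimension ::
    "'e itself \<Rightarrow> ('a, 'c) ring_scheme \<Rightarrow> ('a, 'b) module \<Rightarrow> bool" where
  "finite_injective_dimension _ R M \<longleftrightarrow>
     (\<exists>(E :: nat \<Rightarrow> ('a, 'e) module) \<delta> \<eta> n.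
        injective_resolution R M E \<delta> \<eta> \<and> (\<forall>i>n. carrier (E i) = {\<zero>\<^bsub>E i\<^esub>}))"

definition gorenstein_local_ring ::
    "'e itself \<Rightarrow> ('a, 'c) ring_scheme \<Rightarrow> 'a set \<Rightarrow> bool" where
  "gorenstein_local_ring T R m \<longleftrightarrow>
     noetherian_local_ring R m \<and> finite_injective_dimension T R (regular_module R)"

end

theory Submission
  imports Defs
begin

text \<open>
  Let \<open>k = R/\<mm>\<close>, and let \<open>a \<in> \<mm>\<close> be regular on a module \<open>M\<close>.  Then
  \<open>Ext\<^sup>1(k, M)\<close> is isomorphic to \<open>(aM : \<mm>)/aM\<close>.  On a free resolution \<open>F\<^sub>\<bullet>\<close> of \<open>k\<close>, choose \<open>e \<in> F\<^sub>0\<close> over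
  \<open>1 \<in> k\<close> and \<open>w \<in> F\<^sub>1\<close> with \<open>d w = a e\<close>; the isomorphism is \<open>f \<mapsto> f(w)\<close> (\<open>length_Ext_1\<close>).  In dimension zero,
  \<open>Hom(k, M)\<close> is the socle of \<open>M\<close> by \<open>f \<mapsto> f(e)\<close> (\<open>length_Ext_0\<close>).  All three types in the theorem
  thereby become lengths of intervals of ideals, over \<open>R\<close>, \<open>R/I\<close> and \<open>A = R \<ltimes> I\<close>.

  The Gorenstein hypothesis enters as follows.  Let \<open>C\<^sup>i\<close> be the cosyzygies of a finite injective resolution
  of \<open>R\<close>.  They vanish for large \<open>i\<close>, and injectivity descends from \<open>C\<^sup>i\<^sup>+\<^sup>1\<close> to \<open>C\<^sup>i\<close> if
  \<open>Ext\<^sup>1(R/P, C\<^sup>i) = 0\<close> for all primes \<open>P\<close>.  This holds when \<open>R/P\<close> embeds into a module \<open>X\<close> with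
  \<open>Ext\<^sup>1(X, C\<^sup>i) = 0\<close>, because \<open>Ext\<^sup>2(-, C\<^sup>i) = 0\<close>.  The primes \<open>P \<noteq> \<mm>\<close> are minimal, hence associated, so \<open>X = R\<close> works
  for them.  If \<open>\<mm>\<close> were associated too, then \<open>R\<close> itself would be injective, which is impossible in
  dimension one (\<open>depth_positive\<close>).  Hence there is a regular \<open>a \<in> \<mm>\<close> by prime avoidance.  Now \<open>k\<close> embeds into \<open>R/aR\<close>, and
  \<open>Ext\<^sup>1(R/aR, C\<^sup>i) = 0\<close> for \<open>i \<ge> 1\<close> since \<open>C\<^sup>i\<close> is divisible, being a quotient of an injective module.
  So \<open>C\<^sup>1\<close> is injective, and as \<open>R/aR\<close> is a direct summand of the submodule of \<open>C\<^sup>1\<close> killed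
  by \<open>a\<close>, the ring \<open>R/aR\<close> is self-injective (\<open>quotient_self_injective\<close>).  Two consequences are used:
  \<open>(aR : \<mm>)/aR\<close> has length one, and \<open>(aR : (aR : I)) = I\<close> if \<open>a \<in> I\<close> (\<open>double_annihilator\<close>).

  Some power of a regular element of \<open>\<mm>\<close> lies in \<open>I\<close>, so let \<open>a \<in> I\<close>.  For the inequalities, multiplication by
  \<open>a\<close> identifies \<open>(I : \<mm>)/I\<close> with \<open>((aI : \<mm>) \<inter> aR)/aI\<close>, and the rest of \<open>(aI : \<mm>)/aI\<close> embeds into
  \<open>(aR : \<mm>)/aR\<close>.  For the idealization, a pair \<open>(r, x)\<close> lies in the socle of \<open>A/aA\<close> iff \<open>x \<in> (aI : \<mm>)\<close>,
  \<open>r \<in> (aR : \<mm>)\<close> and \<open>rI \<subseteq> aI\<close>.  When \<open>I\<close> is not principal, the last condition follows from the second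
  by duality (\<open>socle_times_ideal\<close>), so the socle has length \<open>1 + r\<^sub>R(I)\<close>.
\<close>

section \<open>Lengths of chains of sets\<close>

text \<open>
  The bound \<open>X\<close> on the last member is what allows chains of two different families to be grown
  side by side in the proof of subadditivity.
\<close>

definition has_chain :: "('a set \<Rightarrow> bool) \<Rightarrow> nat \<Rightarrow> 'a set \<Rightarrow> bool" where
  "has_chain P n X \<longleftrightarrow>
     (\<exists>H :: nat \<Rightarrow> 'a set. (\<forall>i\<le>n. P (H i)) \<and> (\<forall>i<n. H i \<subset> H (Suc i)) \<and> H n \<subseteq> X)"

definition chain_length :: "('a set \<Rightarrow> bool) \<Rightarrow> enat" where
  "chain_length P = Sup {enat n | n. \<exists>H :: nat \<Rightarrow> 'a set.
     (\<forall>i\<le>n. P (H i)) \<and> (\<forall>i<n. H i \<subset> H (Suc i))}"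

lemma module_length_eq_chain_length:
  "module_length R M = chain_length (\<lambda>H. submodule H R M)"
  by (simp add: module_length_def chain_length_def)

lemma chain_lengthI:
  assumes "\<And>i. i \<le> n \<Longrightarrow> P (H i)" "\<And>i. i < n \<Longrightarrow> H i \<subset> H (Suc i)"
  shows "enat n \<le> chain_length P"
  unfolding chain_length_def using assms by (intro Sup_upper) blast

lemma chain_length_leI:
  assumes "\<And>n H. \<lbrakk>\<And>i. i \<le> n \<Longrightarrow> P (H i); \<And>i. i < n \<Longrightarrow> H i \<subset> H (Suc i)\<rbrakk> \<Longrightarrow> enat n \<le> l"
  shows "chain_length P \<le> l"
  unfolding chain_length_def using assms by (intro Sup_least) blast

lemma has_chain_imp_le: "has_chain P n X \<Longrightarrow> enat n \<le> chain_length P"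
  unfolding has_chain_def using chain_lengthI by metis

lemma has_chain_extend:
  assumes "has_chain P n X" "X \<subset> Y" "P Y"
  shows "has_chain P (Suc n) Y"
proof -
  obtain H where H: "\<And>i. i \<le> n \<Longrightarrow> P (H i)" "\<And>i. i < n \<Longrightarrow> H i \<subset> H (Suc i)" "H n \<subseteq> X"
    using assms(1) unfolding has_chain_def by blast
  have "\<forall>i\<le>Suc n. P ((H(Suc n := Y)) i)"
    using H(1) assms(3) by (simp add: le_Suc_eq)
  moreover have "\<forall>i<Suc n. (H(Suc n := Y)) i \<subset> (H(Suc n := Y)) (Suc i)"
    using H(2,3) assms(2) by (auto simp: less_Suc_eq)
  ultimately show ?thesis
    unfolding has_chain_def by (intro exI[of _ "H(Suc n := Y)"]) simp
qed

lemma has_chain_mono: "has_chain P n X \<Longrightarrow> X \<subseteq> Y \<Longrightarrow> has_chain P n Y"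
  unfolding has_chain_def by blast

lemma chain_length_strict_mono_map:
  assumes "\<And>H. P H \<Longrightarrow> Q (g H)"
    and "\<And>H K. P H \<Longrightarrow> P K \<Longrightarrow> H \<subset> K \<Longrightarrow> g H \<subset> g K"
  shows "chain_length P \<le> chain_length Q"
proof (rule chain_length_leI)
  fix n H
  assume "\<And>i. i \<le> n \<Longrightarrow> P (H i)" "\<And>i. i < n \<Longrightarrow> H i \<subset> H (Suc i)"
  then show "enat n \<le> chain_length Q"
    using assms by (intro chain_lengthI[of n Q "\<lambda>i. g (H i)"]) auto
qed

text \<open>
  Each strict step of a chain of \<open>P\<close> is strict for \<open>f\<close> or for \<open>g\<close>.  For submodules between \<open>K\<close> and \<open>L\<close>
  and an intermediate \<open>U\<close>, this applies to \<open>f H = H \<inter> U\<close> and \<open>g H = H + U\<close>, by the modular law.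
\<close>

lemma chain_length_subadditive:
  assumes P: "\<And>H. P H \<Longrightarrow> P1 (f H)" "\<And>H. P H \<Longrightarrow> P2 (g H)"
    and mono: "\<And>H K. P H \<Longrightarrow> P K \<Longrightarrow> H \<subseteq> K \<Longrightarrow> f H \<subseteq> f K"
              "\<And>H K. P H \<Longrightarrow> P K \<Longrightarrow> H \<subseteq> K \<Longrightarrow> g H \<subseteq> g K"
    and inj: "\<And>H K. P H \<Longrightarrow> P K \<Longrightarrow> H \<subseteq> K \<Longrightarrow> f H = f K \<Longrightarrow> g H = g K \<Longrightarrow> H = K"
  shows "chain_length P \<le> chain_length P1 + chain_length P2"
proof (rule chain_length_leI)
  fix n H
  assume H: "\<And>i. i \<le> n \<Longrightarrow> P (H i)" "\<And>i. i < n \<Longrightarrow> H i \<subset> H (Suc i)"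
  have "i \<le> n \<Longrightarrow> \<exists>p q. p + q = i \<and> has_chain P1 p (f (H i)) \<and> has_chain P2 q (g (H i))" for i
  proof (induction i)
    case 0
    have "has_chain P1 0 (f (H 0))" "has_chain P2 0 (g (H 0))"
      unfolding has_chain_def using H(1)[of 0] P
      by (auto intro: exI[of _ "\<lambda>_. f (H 0)"] exI[of _ "\<lambda>_. g (H 0)"])
    then show ?case by auto
  next
    case (Suc i)
    then obtain p q where pq: "p + q = i" "has_chain P1 p (f (H i))" "has_chain P2 q (g (H i))"
      by auto
    have PH: "P (H i)" "P (H (Suc i))" "H i \<subset> H (Suc i)"
      using H Suc.prems by auto
    have sub: "f (H i) \<subseteq> f (H (Suc i))" "g (H i) \<subseteq> g (H (Suc i))"
      using mono PH by blast+
    have "f (H i) \<noteq> f (H (Suc i)) \<or> g (H i) \<noteq> g (H (Suc i))"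
      using inj[OF PH(1,2)] PH(3) by blast
    then show ?case
    proof
      assume "f (H i) \<noteq> f (H (Suc i))"
      then have "has_chain P1 (Suc p) (f (H (Suc i)))"
        using has_chain_extend pq(2) sub(1) P(1)[OF PH(2)] by blast
      then show ?thesis
        using has_chain_mono[OF pq(3) sub(2)] pq(1) by (intro exI[of _ "Suc p"] exI[of _ q]) simp
    next
      assume "g (H i) \<noteq> g (H (Suc i))"
      then have "has_chain P2 (Suc q) (g (H (Suc i)))"
        using has_chain_extend pq(3) sub(2) P(2)[OF PH(2)] by blast
      then show ?thesis
        using has_chain_mono[OF pq(2) sub(1)] pq(1) by (intro exI[of _ p] exI[of _ "Suc q"]) simp
    qed
  qed
  from this[OF order_refl] obtain p q
    where pq: "p + q = n" "has_chain P1 p (f (H n))" "has_chain P2 q (g (H n))"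
    by blast
  then have "enat p \<le> chain_length P1" "enat q \<le> chain_length P2"
    using has_chain_imp_le by metis+
  then show "enat n \<le> chain_length P1 + chain_length P2"
    using pq(1) by (metis add_mono plus_enat_simps(1))
qed

lemma chain_length_le_one:
  assumes "\<And>H. P H \<Longrightarrow> H = B \<or> H = C"
  shows "chain_length P \<le> 1"
proof (rule chain_length_leI)
  fix n H
  assume H: "\<And>i. i \<le> n \<Longrightarrow> P (H i)" "\<And>i. i < n \<Longrightarrow> H i \<subset> H (Suc i)"
  have "n \<le> 1"
  proof (rule ccontr)
    assume "\<not> n \<le> 1"
    then have "P (H 0)" "P (H 1)" "P (H 2)" "H 0 \<subset> H 1" "H 1 \<subset> H 2"
      using H(1)[of 0] H(1)[of 1] H(1)[of 2] H(2)[of 0] H(2)[of 1] by (auto simp: numeral_2_eq_2)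
    then show False
      using assms by blast
  qed
  then show "enat n \<le> 1"
    by (simp add: one_enat_def)
qed

lemma chain_length_Suc_le:
  assumes PQ: "\<And>H. P H \<Longrightarrow> Q H \<and> H \<subset> C" and C: "Q C" and B: "P B"
  shows "1 + chain_length P \<le> chain_length Q"
proof -
  let ?S = "{enat n | n. \<exists>H :: nat \<Rightarrow> 'a set. (\<forall>i\<le>n. P (H i)) \<and> (\<forall>i<n. H i \<subset> H (Suc i))}"
  have "enat 0 \<in> ?S"
    using B by (auto intro!: exI[of _ "\<lambda>_. B"])
  then have "1 + chain_length P = Sup (eSuc ` ?S)"
    using eSuc_Sup[of ?S] by (auto simp: chain_length_def eSuc_plus_1 add.commute)
  also have "\<dots> \<le> chain_length Q"
  proof (rule Sup_least, clarify)
    fix n and H :: "nat \<Rightarrow> 'a set"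
    assume H: "\<forall>i\<le>n. P (H i)" "\<forall>i<n. H i \<subset> H (Suc i)"
    then have "has_chain Q n (H n)"
      unfolding has_chain_def using PQ by blast
    moreover have "H n \<subset> C" using PQ H(1) by blast
    ultimately have "has_chain Q (Suc n) C"
      using has_chain_extend C by blast
    then show "eSuc (enat n) \<le> chain_length Q"
      using has_chain_imp_le eSuc_enat by metis
  qed
  finally show ?thesis .
qed

lemma chain_length_eqI:
  assumes PQ: "\<And>H. P H \<Longrightarrow> Q (g H)" "\<And>K. Q K \<Longrightarrow> P (h K)"
    and mono: "\<And>H H'. P H \<Longrightarrow> P H' \<Longrightarrow> H \<subseteq> H' \<Longrightarrow> g H \<subseteq> g H'" "\<And>K K'. Q K \<Longrightarrow> Q K' \<Longrightarrow> K \<subseteq> K' \<Longrightarrow> h K \<subseteq> h K'"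
    and inv: "\<And>H. P H \<Longrightarrow> h (g H) = H" "\<And>K. Q K \<Longrightarrow> g (h K) = K"
  shows "chain_length P = chain_length Q"
proof (rule antisym)
  show "chain_length P \<le> chain_length Q"
  proof (rule chain_length_strict_mono_map[where g = g])
    fix H K assume "P H" "P K" "H \<subset> K"
    then show "g H \<subset> g K" using mono(1) inv(1) by (metis psubset_eq)
  qed (rule PQ)
  show "chain_length Q \<le> chain_length P"
  proof (rule chain_length_strict_mono_map[where g = h])
    fix H K assume "Q H" "Q K" "H \<subset> K"
    then show "h H \<subset> h K" using mono(2) inv(2) by (metis psubset_eq)
  qed (rule PQ)
qed

lemma chain_length_le_zero:
  assumes "\<And>H. P H \<Longrightarrow> H = C"
  shows "chain_length P = 0"
proof -
  have "chain_length P \<le> 0"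
  proof (rule chain_length_leI)
    fix n H assume H: "\<And>i. i \<le> n \<Longrightarrow> P (H i)" "\<And>i. i < n \<Longrightarrow> H i \<subset> H (Suc i)"
    have "n = 0"
    proof (rule ccontr)
      assume "n \<noteq> 0"
      then have "H 0 \<subset> H 1" "H 0 = C" "H 1 = C" using H(2)[of 0] assms[OF H(1), of 0] assms[OF H(1), of 1] by auto
      then show False by blast
    qed
    then show "enat n \<le> 0" by (simp add: zero_enat_def)
  qed
  then show ?thesis by simp
qed

section \<open>Modules, linear maps and quotients\<close>

text \<open>
  Negation is multiplication by \<open>- 1\<close>, so closure under inverses comes for free.
\<close>

lemma (in module) submoduleI':
  assumes "H \<subseteq> carrier M" "\<zero>\<^bsub>M\<^esub> \<in> H"
    and "\<And>x y. x \<in> H \<Longrightarrow> y \<in> H \<Longrightarrow> x \<oplus>\<^bsub>M\<^esub> y \<in> H"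
    and "\<And>a x. a \<in> carrier R \<Longrightarrow> x \<in> H \<Longrightarrow> a \<odot>\<^bsub>M\<^esub> x \<in> H"
  shows "submodule H R M"
proof (rule submoduleI)
  fix x assume x: "x \<in> H"
  then have "\<ominus>\<^bsub>M\<^esub> x = (\<ominus> \<one>) \<odot>\<^bsub>M\<^esub> x"
    using assms(1) smult_l_minus[of \<one> x] by auto
  then show "\<ominus>\<^bsub>M\<^esub> x \<in> H"
    using assms(4)[OF _ x] by simp
qed (use assms in auto)

lemma (in module) submodule_zero:
  assumes "submodule H R M" shows "\<zero>\<^bsub>M\<^esub> \<in> H"
  using subgroup.one_closed[OF submodule.axioms(1)[OF assms]] by simp

lemma (in module) submodule_Int:
  assumes "submodule H R M" "submodule K R M"
  shows "submodule (H \<inter> K) R M"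
  using submoduleE[OF assms(1)] submoduleE[OF assms(2)] submodule_zero assms
  by (intro submoduleI') auto

lemma (in module) submodule_minus:
  assumes "submodule H R M" "x \<in> H" "y \<in> H"
  shows "x \<ominus>\<^bsub>M\<^esub> y \<in> H"
  using submoduleE[OF assms(1)] assms(2,3) by (simp add: M.minus_eq)

lemma (in module) minus_add_cancel:
  assumes "x \<in> carrier M" "y \<in> carrier M"
  shows "x \<ominus>\<^bsub>M\<^esub> y \<oplus>\<^bsub>M\<^esub> y = x"
  using assms by (simp add: M.minus_eq M.a_assoc M.l_neg)

lemma lin_mapsI:
  assumes "\<And>x. x \<in> carrier M \<Longrightarrow> f x \<in> carrier N"
    and "\<And>x y. x \<in> carrier M \<Longrightarrow> y \<in> carrier M \<Longrightarrow> f (x \<oplus>\<^bsub>M\<^esub> y) = f x \<oplus>\<^bsub>N\<^esub> f y"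
    and "\<And>a x. a \<in> carrier R \<Longrightarrow> x \<in> carrier M \<Longrightarrow> f (a \<odot>\<^bsub>M\<^esub> x) = a \<odot>\<^bsub>N\<^esub> f x"
    and "\<And>x y. x \<in> carrier M \<Longrightarrow> y \<in> carrier M \<Longrightarrow> x \<oplus>\<^bsub>M\<^esub> y \<in> carrier M"
    and "\<And>a x. a \<in> carrier R \<Longrightarrow> x \<in> carrier M \<Longrightarrow> a \<odot>\<^bsub>M\<^esub> x \<in> carrier M"
  shows "restrict f (carrier M) \<in> lin_maps R M N"
  using assms unfolding lin_maps_def by auto

lemma lin_maps_closed: "f \<in> lin_maps R M N \<Longrightarrow> x \<in> carrier M \<Longrightarrow> f x \<in> carrier N"
  unfolding lin_maps_def by auto

lemma lin_maps_add:
  "f \<in> lin_maps R M N \<Longrightarrow> x \<in> carrier M \<Longrightarrow> y \<in> carrier M \<Longrightarrow> f (x \<oplus>\<^bsub>M\<^esub> y) = f x \<oplus>\<^bsub>N\<^esub> f y"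
  unfolding lin_maps_def by auto

lemma lin_maps_smult:
  "f \<in> lin_maps R M N \<Longrightarrow> a \<in> carrier R \<Longrightarrow> x \<in> carrier M \<Longrightarrow> f (a \<odot>\<^bsub>M\<^esub> x) = a \<odot>\<^bsub>N\<^esub> f x"
  unfolding lin_maps_def by auto

lemma lin_maps_ext:
  assumes "f \<in> lin_maps R M N" "g \<in> lin_maps R M N" "\<And>x. x \<in> carrier M \<Longrightarrow> f x = g x"
  shows "f = g"
  using assms unfolding lin_maps_def by (auto intro: PiE_ext)

lemma lin_maps_zero:
  assumes "module R M" "module R N" "f \<in> lin_maps R M N"
  shows "f \<zero>\<^bsub>M\<^esub> = \<zero>\<^bsub>N\<^esub>"
proof -
  interpret M: module R M by fact
  interpret N: module R N by fact
  have "f (\<zero>\<^bsub>R\<^esub> \<odot>\<^bsub>M\<^esub> \<zero>\<^bsub>M\<^esub>) = \<zero>\<^bsub>R\<^esub> \<odot>\<^bsub>N\<^esub> f \<zero>\<^bsub>M\<^esub>"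
    using assms(3) by (intro lin_maps_smult) auto
  then show ?thesis
    using lin_maps_closed[OF assms(3), of "\<zero>\<^bsub>M\<^esub>"] by simp
qed

lemma lin_maps_minus:
  assumes "module R M" "module R N" "f \<in> lin_maps R M N" "x \<in> carrier M" "y \<in> carrier M"
  shows "f (x \<ominus>\<^bsub>M\<^esub> y) = f x \<ominus>\<^bsub>N\<^esub> f y"
proof -
  interpret M: module R M by fact
  interpret N: module R N by fact
  have "f (\<ominus>\<^bsub>M\<^esub> y) = f ((\<ominus>\<^bsub>R\<^esub> \<one>\<^bsub>R\<^esub>) \<odot>\<^bsub>M\<^esub> y)"
    using M.smult_l_minus[of "\<one>\<^bsub>R\<^esub>" y] assms by simp
  also have "\<dots> = (\<ominus>\<^bsub>R\<^esub> \<one>\<^bsub>R\<^esub>) \<odot>\<^bsub>N\<^esub> f y"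
    using assms by (intro lin_maps_smult) auto
  also have "\<dots> = \<ominus>\<^bsub>N\<^esub> f y"
    using N.smult_l_minus[of "\<one>\<^bsub>R\<^esub>" "f y"] lin_maps_closed[OF assms(3,5)] by simp
  finally show ?thesis
    using lin_maps_add[OF assms(3,4), of "\<ominus>\<^bsub>M\<^esub> y"] assms
    by (simp add: M.M.minus_eq N.M.minus_eq)
qed

lemma submodule_kernel:
  assumes "module R M" "module R N" "f \<in> lin_maps R M N"
  shows "submodule (a_kernel M N f) R M"
proof -
  interpret M: module R M by fact
  interpret N: module R N by fact
  show ?thesis
    using assms lin_maps_zero[OF assms]
    by (intro M.submoduleI') (auto simp: a_kernel_def' lin_maps_add lin_maps_smult)
qed

lemma submodule_image:
  assumes "module R M" "module R N" "f \<in> lin_maps R M N"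
  shows "submodule (f ` carrier M) R N"
proof -
  interpret M: module R M by fact
  interpret N: module R N by fact
  show ?thesis
  proof (rule N.submoduleI')
    show "f ` carrier M \<subseteq> carrier N"
      using lin_maps_closed[OF assms(3)] by auto
    show "\<zero>\<^bsub>N\<^esub> \<in> f ` carrier M"
      using lin_maps_zero[OF assms] by (metis M.M.zero_closed imageI)
  next
    fix x y assume "x \<in> f ` carrier M" "y \<in> f ` carrier M"
    then show "x \<oplus>\<^bsub>N\<^esub> y \<in> f ` carrier M"
      using lin_maps_add[OF assms(3)] by (metis (no_types, opaque_lifting) M.M.add.m_closed imageE imageI)
  next
    fix a x assume "a \<in> carrier R" "x \<in> f ` carrier M"
    then show "a \<odot>\<^bsub>N\<^esub> x \<in> f ` carrier M"
      using lin_maps_smult[OF assms(3)] by (metis (no_types, opaque_lifting) M.smult_closed imageE imageI)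
  qed
qed

lemma regular_module_simps [simp]:
  "carrier (regular_module R) = carrier R" "zero (regular_module R) = \<zero>\<^bsub>R\<^esub>"
  "add (regular_module R) = add R" "smult (regular_module R) = monoid.mult R"
  by (simp_all add: regular_module_def)

lemma (in cring) module_regular: "module R (regular_module R)"
proof (rule moduleI)
  show "abelian_group (regular_module R)"
  proof (rule abelian_groupI)
    fix x assume "x \<in> carrier (regular_module R)"
    then show "\<exists>y\<in>carrier (regular_module R). y \<oplus>\<^bsub>regular_module R\<^esub> x = \<zero>\<^bsub>regular_module R\<^esub>"
      by (auto intro!: bexI[of _ "\<ominus> x"] simp: l_neg)
  qed (auto simp: a_ac)
qed (auto simp: l_distr r_distr m_assoc is_cring)

lemma (in cring) submodule_regular_iff: "submodule J R (regular_module R) \<longleftrightarrow> ideal J R"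
proof -
  interpret M: module R "regular_module R" by (rule module_regular)
  show ?thesis
  proof
    assume J: "submodule J R (regular_module R)"
    note E = M.submoduleE[OF J]
    have "subgroup J (add_monoid R)"
    proof (rule add.subgroupI)
      fix x assume x: "x \<in> J"
      then have "\<ominus> x = (\<ominus> \<one>) \<otimes> x"
        using E(1) by (auto simp: l_minus)
      then show "\<ominus> x \<in> J"
        using E(4)[of "\<ominus> \<one>" x] x by simp
    qed (use E in auto)
    then show "ideal J R"
    proof (intro idealI ring_axioms)
      fix a x assume ax: "a \<in> J" "x \<in> carrier R"
      then show "x \<otimes> a \<in> J" using E(4)[of x a] by simp
      then show "a \<otimes> x \<in> J" using ax E(1) by (metis m_comm regular_module_simps(1) subsetD)
    qed
  next
    assume "ideal J R"
    then interpret J: ideal J R .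
    show "submodule J R (regular_module R)"
      using J.a_subset J.I_l_closed by (intro M.submoduleI') auto
  qed
qed

locale module_with_submodule = module R M
  for R (structure) and M :: "('a, 'b) module" (structure) +
  fixes H
  assumes H: "submodule H R M"
begin

lemma abelian_subgroup_submodule: "abelian_subgroup H M"
  using submodule.axioms(1)[OF H]
  by (intro abelian_subgroupI3 additive_subgroupI) (auto simp: M.abelian_group_axioms)

sublocale H: abelian_subgroup H M by (rule abelian_subgroup_submodule)

lemma coset_eq_iff:
  assumes "x \<in> carrier M" "y \<in> carrier M"
  shows "H +>\<^bsub>M\<^esub> x = H +>\<^bsub>M\<^esub> y \<longleftrightarrow> (\<exists>h\<in>H. x = h \<oplus>\<^bsub>M\<^esub> y)"
proof
  assume "H +>\<^bsub>M\<^esub> x = H +>\<^bsub>M\<^esub> y"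
  then have "x \<in> H +>\<^bsub>M\<^esub> y"
    using H.a_rcos_self[OF assms(1)] by simp
  then show "\<exists>h\<in>H. x = h \<oplus>\<^bsub>M\<^esub> y"
    by (auto simp: a_r_coset_def')
next
  assume "\<exists>h\<in>H. x = h \<oplus>\<^bsub>M\<^esub> y"
  then have "x \<in> H +>\<^bsub>M\<^esub> y"
    by (auto simp: a_r_coset_def')
  then show "H +>\<^bsub>M\<^esub> x = H +>\<^bsub>M\<^esub> y"
    using H.a_repr_independence'[OF _ assms(2)] by simp
qed

lemma coset_eq_self_iff:
  assumes "x \<in> carrier M"
  shows "H +>\<^bsub>M\<^esub> x = H \<longleftrightarrow> x \<in> H"
proof -
  have "H +>\<^bsub>M\<^esub> \<zero>\<^bsub>M\<^esub> = H"
    using submoduleE(1)[OF H] by simp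
  then show ?thesis
    using coset_eq_iff[OF assms M.zero_closed] submoduleE(1)[OF H] by (auto simp: subsetD)
qed

lemma carrier_quotient_module: "carrier (quotient_module M H) = (\<lambda>x. H +>\<^bsub>M\<^esub> x) ` carrier M"
  by (auto simp: quotient_module_def A_RCOSETS_def' )

lemma zero_quotient_module: "\<zero>\<^bsub>quotient_module M H\<^esub> = H"
  by (simp add: quotient_module_def)

lemma add_quotient_module:
  assumes "x \<in> carrier M" "y \<in> carrier M"
  shows "(H +>\<^bsub>M\<^esub> x) \<oplus>\<^bsub>quotient_module M H\<^esub> (H +>\<^bsub>M\<^esub> y) = H +>\<^bsub>M\<^esub> (x \<oplus>\<^bsub>M\<^esub> y)"
  using assms by (simp add: quotient_module_def H.a_rcos_sum)

lemma smult_quotient_module: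
  assumes a: "a \<in> carrier R" and x: "x \<in> carrier M"
  shows "a \<odot>\<^bsub>quotient_module M H\<^esub> (H +>\<^bsub>M\<^esub> x) = H +>\<^bsub>M\<^esub> (a \<odot>\<^bsub>M\<^esub> x)"
proof -
  have "H +>\<^bsub>M\<^esub> (a \<odot>\<^bsub>M\<^esub> y) = H +>\<^bsub>M\<^esub> (a \<odot>\<^bsub>M\<^esub> x)" if y: "y \<in> H +>\<^bsub>M\<^esub> x" for y
  proof -
    obtain h where h: "h \<in> H" "y = h \<oplus>\<^bsub>M\<^esub> x"
      using y by (auto simp: a_r_coset_def')
    then have "h \<in> carrier M" using submoduleE(1)[OF H] by auto
    then have "a \<odot>\<^bsub>M\<^esub> y = a \<odot>\<^bsub>M\<^esub> h \<oplus>\<^bsub>M\<^esub> a \<odot>\<^bsub>M\<^esub> x" "a \<odot>\<^bsub>M\<^esub> y \<in> carrier M"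
      using h a x by (auto simp: smult_r_distr)
    then show ?thesis
      using coset_eq_iff a x submoduleE(4)[OF H a h(1)] by auto
  qed
  then have "(\<Union>y\<in>H +>\<^bsub>M\<^esub> x. H +>\<^bsub>M\<^esub> (a \<odot>\<^bsub>M\<^esub> y)) = (\<Union>y\<in>H +>\<^bsub>M\<^esub> x. H +>\<^bsub>M\<^esub> (a \<odot>\<^bsub>M\<^esub> x))"
    by (intro SUP_cong refl)
  also have "\<dots> = H +>\<^bsub>M\<^esub> (a \<odot>\<^bsub>M\<^esub> x)"
    using H.a_rcos_self[OF x] by blast
  finally show ?thesis
    by (simp add: quotient_module_def)
qed

lemma zero_quotient_module_coset: "\<zero>\<^bsub>quotient_module M H\<^esub> = H +>\<^bsub>M\<^esub> \<zero>\<^bsub>M\<^esub>"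
  using submoduleE(1)[OF H] by (simp add: zero_quotient_module)

lemma module_quotient: "module R (quotient_module M H)"
proof (rule moduleI)
  let ?Q = "quotient_module M H"
  show "abelian_group ?Q"
  proof (rule abelian_groupI)
    fix x assume "x \<in> carrier ?Q"
    then obtain u where u: "u \<in> carrier M" "x = H +>\<^bsub>M\<^esub> u"
      by (auto simp: carrier_quotient_module)
    then show "\<exists>y\<in>carrier ?Q. y \<oplus>\<^bsub>?Q\<^esub> x = \<zero>\<^bsub>?Q\<^esub>"
      by (intro bexI[of _ "H +>\<^bsub>M\<^esub> (\<ominus>\<^bsub>M\<^esub> u)"])
         (auto simp: carrier_quotient_module add_quotient_module zero_quotient_module_coset M.l_neg)
  qed (auto simp: carrier_quotient_module add_quotient_module zero_quotient_module_coset M.a_ac)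
qed (auto simp: carrier_quotient_module add_quotient_module smult_quotient_module R.is_cring
       smult_l_distr smult_r_distr smult_assoc1)

lemma submodule_quotientI:
  assumes "submodule K R M"
  shows "submodule ((\<lambda>x. H +>\<^bsub>M\<^esub> x) ` K) R (quotient_module M H)"
proof -
  interpret Q: module R "quotient_module M H" by (rule module_quotient)
  note E = submoduleE[OF assms]
  show ?thesis
  proof (rule Q.submoduleI')
    have "H = H +>\<^bsub>M\<^esub> \<zero>\<^bsub>M\<^esub>"
      using submoduleE(1)[OF H] by simp
    then show "\<zero>\<^bsub>quotient_module M H\<^esub> \<in> (+>\<^bsub>M\<^esub>) H ` K"
      using submodule_zero[OF assms] by (auto simp: zero_quotient_module)
    show "(+>\<^bsub>M\<^esub>) H ` K \<subseteq> carrier (quotient_module M H)"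
      using E(1) by (auto simp: carrier_quotient_module)
  next
    fix x y assume "x \<in> (+>\<^bsub>M\<^esub>) H ` K" "y \<in> (+>\<^bsub>M\<^esub>) H ` K"
    then obtain u v where "u \<in> K" "v \<in> K" "x = H +>\<^bsub>M\<^esub> u" "y = H +>\<^bsub>M\<^esub> v" by blast
    then show "x \<oplus>\<^bsub>quotient_module M H\<^esub> y \<in> (+>\<^bsub>M\<^esub>) H ` K"
      using add_quotient_module[of u v] E(1) E(5)[of u v] by blast
  next
    fix a x assume "a \<in> carrier R" "x \<in> (+>\<^bsub>M\<^esub>) H ` K"
    then obtain u where "a \<in> carrier R" "u \<in> K" "x = H +>\<^bsub>M\<^esub> u" by blast
    then show "a \<odot>\<^bsub>quotient_module M H\<^esub> x \<in> (+>\<^bsub>M\<^esub>) H ` K"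
      using smult_quotient_module[of a u] E(1) E(4)[of a u] by blast
  qed
qed

lemma submodule_quotientD:
  assumes "submodule T R (quotient_module M H)"
  shows "submodule {x \<in> carrier M. H +>\<^bsub>M\<^esub> x \<in> T} R M"
proof -
  interpret Q: module R "quotient_module M H" by (rule module_quotient)
  note E = Q.submoduleE[OF assms]
  show ?thesis
  proof (rule submoduleI')
    show "\<zero>\<^bsub>M\<^esub> \<in> {x \<in> carrier M. H +>\<^bsub>M\<^esub> x \<in> T}"
      using Q.submodule_zero[OF assms] submoduleE(1)[OF H] by (simp add: zero_quotient_module)
  qed (use E in \<open>auto simp: add_quotient_module[symmetric] smult_quotient_module[symmetric]\<close>)
qed

end

text \<open>
  The submodules of \<open>X/Y\<close> correspond to the submodules between \<open>K\<close> and \<open>L\<close> as soon as a linear map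
  \<open>X \<rightarrow> L\<close> induces an isomorphism \<open>X/Y \<cong> L/K\<close>.
\<close>

lemma module_length_quotient_eq:
  assumes X: "module R X" and N: "module R N" "submodule K R N" "submodule L R N"
    and KL: "K \<subseteq> L"
    and closed: "\<And>x. x \<in> carrier X \<Longrightarrow> \<Phi> x \<in> L"
    and add: "\<And>x y. x \<in> carrier X \<Longrightarrow> y \<in> carrier X \<Longrightarrow> \<Phi> (x \<oplus>\<^bsub>X\<^esub> y) = \<Phi> x \<oplus>\<^bsub>N\<^esub> \<Phi> y"
    and smult: "\<And>a x. a \<in> carrier R \<Longrightarrow> x \<in> carrier X \<Longrightarrow> \<Phi> (a \<odot>\<^bsub>X\<^esub> x) = a \<odot>\<^bsub>N\<^esub> \<Phi> x"
    and Y_eq: "Y = {x \<in> carrier X. \<Phi> x \<in> K}"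
    and onto: "\<And>l. l \<in> L \<Longrightarrow> \<exists>x\<in>carrier X. \<exists>k\<in>K. l = \<Phi> x \<oplus>\<^bsub>N\<^esub> k"
  shows "module_length R (quotient_module X Y) =
         chain_length (\<lambda>H. submodule H R N \<and> K \<subseteq> H \<and> H \<subseteq> L)"
proof -
  interpret X: module R X by fact
  interpret N: module R N by fact
  have L: "L \<subseteq> carrier N" and K: "K \<subseteq> carrier N"
    using N.submoduleE(1) N by blast+
  have \<Phi>N: "\<Phi> x \<in> carrier N" if "x \<in> carrier X" for x
    using closed[OF that] L by auto
  have \<Phi>0: "\<Phi> \<zero>\<^bsub>X\<^esub> = \<zero>\<^bsub>N\<^esub>"
    using smult[of "\<zero>\<^bsub>R\<^esub>" "\<zero>\<^bsub>X\<^esub>"] \<Phi>N[of "\<zero>\<^bsub>X\<^esub>"] by simp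
  have sub: "submodule {x \<in> carrier X. \<Phi> x \<in> H} R X" if H: "submodule H R N" for H
    using N.submoduleE(4,5)[OF H] N.submodule_zero[OF H]
    by (intro X.submoduleI') (auto simp: add smult \<Phi>0)
  have Y: "Y \<subseteq> carrier X" and ker: "\<And>x. x \<in> carrier X \<Longrightarrow> \<Phi> x \<in> K \<longleftrightarrow> x \<in> Y"
    using Y_eq by auto
  interpret XY: module_with_submodule R X Y
    unfolding Y_eq by (intro module_with_submodule.intro module_with_submodule_axioms.intro X sub N)
  interpret Q: module R "quotient_module X Y" by (rule XY.module_quotient)
  let ?Q = "quotient_module X Y"
  \<comment> \<open>One direction: the image in \<open>X/Y\<close> of the preimage under \<open>\<Phi>\<close>.\<close>
  let ?\<Psi> = "\<lambda>H. (\<lambda>x. Y +>\<^bsub>X\<^esub> x) ` {x \<in> carrier X. \<Phi> x \<in> H}"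
  have "chain_length (\<lambda>H. submodule H R N \<and> K \<subseteq> H \<and> H \<subseteq> L) \<le> chain_length (\<lambda>T. submodule T R ?Q)"
  proof (rule chain_length_strict_mono_map[where g = ?\<Psi>])
    fix H assume "submodule H R N \<and> K \<subseteq> H \<and> H \<subseteq> L"
    then show "submodule (?\<Psi> H) R ?Q"
      using sub by (intro XY.submodule_quotientI) auto
  next
    fix H1 H2
    assume 1: "submodule H1 R N \<and> K \<subseteq> H1 \<and> H1 \<subseteq> L" and 2: "submodule H2 R N \<and> K \<subseteq> H2 \<and> H2 \<subseteq> L"
      and lt: "H1 \<subset> H2"
    then obtain h where h: "h \<in> H2" "h \<notin> H1" by auto
    then obtain x k where x: "x \<in> carrier X" "k \<in> K" "h = \<Phi> x \<oplus>\<^bsub>N\<^esub> k"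
      using onto[of h] 2 by auto
    have "k \<in> carrier N" "h \<in> carrier N" using x K 2 L h by auto
    then have "\<Phi> x = h \<ominus>\<^bsub>N\<^esub> k"
      using x \<Phi>N[OF x(1)] by (simp add: N.M.minus_eq N.M.a_assoc N.M.r_neg)
    moreover have "k \<in> H2" using x(2) 2 by blast
    ultimately have "\<Phi> x \<in> H2"
      using N.submodule_minus[of H2 h k] 2 h(1) by simp
    moreover have "Y +>\<^bsub>X\<^esub> x \<notin> ?\<Psi> H1"
    proof
      assume "Y +>\<^bsub>X\<^esub> x \<in> ?\<Psi> H1"
      then obtain x' where x': "x' \<in> carrier X" "\<Phi> x' \<in> H1" "Y +>\<^bsub>X\<^esub> x = Y +>\<^bsub>X\<^esub> x'" by auto
      then obtain y where y: "y \<in> Y" "x = y \<oplus>\<^bsub>X\<^esub> x'"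
        using XY.coset_eq_iff[OF x(1)] by auto
      then have "\<Phi> x = \<Phi> y \<oplus>\<^bsub>N\<^esub> \<Phi> x'" "\<Phi> y \<in> K"
        using add[of y x'] ker[of y] x' Y by auto
      then have "\<Phi> x \<in> H1"
        using N.submoduleE(5)[of H1] x'(2) 1 by auto
      then have "h \<in> H1"
        using N.submoduleE(5)[of H1 "\<Phi> x" k] x 1 by auto
      then show False using h by simp
    qed
    ultimately show "?\<Psi> H1 \<subset> ?\<Psi> H2"
      using x(1) lt by blast
  qed
  moreover
  \<comment> \<open>The other direction: \<open>K\<close> plus the image under \<open>\<Phi>\<close> of a union of cosets.\<close>
  let ?\<Theta> = "\<lambda>T. {l \<in> L. \<exists>x\<in>carrier X. \<exists>k\<in>K. Y +>\<^bsub>X\<^esub> x \<in> T \<and> l = \<Phi> x \<oplus>\<^bsub>N\<^esub> k}"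
  have "chain_length (\<lambda>T. submodule T R ?Q) \<le> chain_length (\<lambda>H. submodule H R N \<and> K \<subseteq> H \<and> H \<subseteq> L)"
  proof (rule chain_length_strict_mono_map[where g = ?\<Theta>])
    fix T assume T: "submodule T R ?Q"
    note E = X.submoduleE[OF XY.submodule_quotientD[OF T]]
    have zero: "Y +>\<^bsub>X\<^esub> \<zero>\<^bsub>X\<^esub> \<in> T"
      using X.submodule_zero[OF XY.submodule_quotientD[OF T]] by simp
    have KT: "K \<subseteq> ?\<Theta> T"
      using zero KL K by (auto intro!: bexI[of _ "\<zero>\<^bsub>X\<^esub>"] simp: \<Phi>0 subset_iff)
    have "submodule (?\<Theta> T) R N"
    proof (rule N.submoduleI')
      show "?\<Theta> T \<subseteq> carrier N" using L by auto
      show "\<zero>\<^bsub>N\<^esub> \<in> ?\<Theta> T" using KT N.submodule_zero[OF N(2)] by blast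
    next
      fix l l' assume l: "l \<in> ?\<Theta> T" "l' \<in> ?\<Theta> T"
      then obtain x k x' k' where *: "x \<in> carrier X" "k \<in> K" "Y +>\<^bsub>X\<^esub> x \<in> T" "l = \<Phi> x \<oplus>\<^bsub>N\<^esub> k"
        "x' \<in> carrier X" "k' \<in> K" "Y +>\<^bsub>X\<^esub> x' \<in> T" "l' = \<Phi> x' \<oplus>\<^bsub>N\<^esub> k'" by auto
      then have "l \<oplus>\<^bsub>N\<^esub> l' = \<Phi> (x \<oplus>\<^bsub>X\<^esub> x') \<oplus>\<^bsub>N\<^esub> (k \<oplus>\<^bsub>N\<^esub> k')"
        using K \<Phi>N by (simp add: add N.M.a_ac subset_iff)
      moreover have "l \<oplus>\<^bsub>N\<^esub> l' \<in> L" using l N.submoduleE(5)[OF N(3)] by auto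
      moreover have "Y +>\<^bsub>X\<^esub> (x \<oplus>\<^bsub>X\<^esub> x') \<in> T" using E(5)[of x x'] * by auto
      moreover have "k \<oplus>\<^bsub>N\<^esub> k' \<in> K" using * N.submoduleE(5)[OF N(2)] by auto
      ultimately show "l \<oplus>\<^bsub>N\<^esub> l' \<in> ?\<Theta> T"
        using * by blast
    next
      fix a l assume a: "a \<in> carrier R" and l: "l \<in> ?\<Theta> T"
      then obtain x k where *: "x \<in> carrier X" "k \<in> K" "Y +>\<^bsub>X\<^esub> x \<in> T" "l = \<Phi> x \<oplus>\<^bsub>N\<^esub> k" by auto
      then have "a \<odot>\<^bsub>N\<^esub> l = \<Phi> (a \<odot>\<^bsub>X\<^esub> x) \<oplus>\<^bsub>N\<^esub> (a \<odot>\<^bsub>N\<^esub> k)"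
        using K \<Phi>N a by (simp add: smult N.smult_r_distr subset_iff)
      moreover have "a \<odot>\<^bsub>N\<^esub> l \<in> L" using l a N.submoduleE(4)[OF N(3)] by auto
      moreover have "Y +>\<^bsub>X\<^esub> (a \<odot>\<^bsub>X\<^esub> x) \<in> T" using E(4)[of a x] * a by auto
      moreover have "a \<odot>\<^bsub>N\<^esub> k \<in> K" using * a N.submoduleE(4)[OF N(2)] by auto
      ultimately show "a \<odot>\<^bsub>N\<^esub> l \<in> ?\<Theta> T"
        using * a by blast
    qed
    then show "submodule (?\<Theta> T) R N \<and> K \<subseteq> ?\<Theta> T \<and> ?\<Theta> T \<subseteq> L"
      using KT by blast
  next
    fix T1 T2 assume T: "submodule T1 R ?Q" "submodule T2 R ?Q" "T1 \<subset> T2"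
    then obtain t where t: "t \<in> T2" "t \<notin> T1" by auto
    then obtain x where x: "x \<in> carrier X" "t = Y +>\<^bsub>X\<^esub> x"
      using Q.submoduleE(1)[OF T(2)] XY.carrier_quotient_module by auto
    have "\<Phi> x \<in> ?\<Theta> T2"
      using x t closed N.submodule_zero[OF N(2)] \<Phi>N[OF x(1)]
      by (auto intro!: bexI[of _ x] bexI[of _ "\<zero>\<^bsub>N\<^esub>"])
    moreover have "\<Phi> x \<notin> ?\<Theta> T1"
    proof
      assume "\<Phi> x \<in> ?\<Theta> T1"
      then obtain x' k where x': "x' \<in> carrier X" "k \<in> K" "Y +>\<^bsub>X\<^esub> x' \<in> T1" "\<Phi> x = \<Phi> x' \<oplus>\<^bsub>N\<^esub> k"
        by auto
      let ?y = "x \<ominus>\<^bsub>X\<^esub> x'"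
      have y: "?y \<in> carrier X" "x = ?y \<oplus>\<^bsub>X\<^esub> x'"
        using x x' by (auto simp: X.M.minus_eq X.M.a_assoc X.M.l_neg)
      then have "\<Phi> ?y \<oplus>\<^bsub>N\<^esub> \<Phi> x' = k \<oplus>\<^bsub>N\<^esub> \<Phi> x'"
        using add[of ?y x'] x' K \<Phi>N N.M.a_comm[of k] by auto
      then have "\<Phi> ?y = k"
        using N.M.add.right_cancel \<Phi>N y(1) x' K by blast
      then have "?y \<in> Y"
        using ker[OF y(1)] x' by simp
      then have "Y +>\<^bsub>X\<^esub> x = Y +>\<^bsub>X\<^esub> x'"
        using XY.coset_eq_iff[OF x(1) x'(1)] y(2) by blast
      then show False using x x' t by simp
    qed
    moreover have "?\<Theta> T1 \<subseteq> ?\<Theta> T2" using T(3) by blast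
    ultimately show "?\<Theta> T1 \<subset> ?\<Theta> T2" by blast
  qed
  ultimately show ?thesis
    by (simp add: module_length_eq_chain_length)
qed

section \<open>Free modules and free resolutions\<close>

lemma free_module_carrier [simp]: "carrier (free_module R n) = {..<n} \<rightarrow>\<^sub>E carrier R"
  and free_module_add: "u \<oplus>\<^bsub>free_module R n\<^esub> v = (\<lambda>i\<in>{..<n}. u i \<oplus>\<^bsub>R\<^esub> v i)"
  and free_module_smult: "a \<odot>\<^bsub>free_module R n\<^esub> u = (\<lambda>i\<in>{..<n}. a \<otimes>\<^bsub>R\<^esub> u i)"
  and free_module_zero: "\<zero>\<^bsub>free_module R n\<^esub> = (\<lambda>i\<in>{..<n}. \<zero>\<^bsub>R\<^esub>)"
  by (simp_all add: free_module_def)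

lemmas free_module_ops = free_module_add free_module_smult free_module_zero

lemma free_module_eqI:
  assumes "u \<in> carrier (free_module R n)" "v \<in> carrier (free_module R n)" "\<And>i. i < n \<Longrightarrow> u i = v i"
  shows "u = v"
  using assms by (intro PiE_ext[of u "{..<n}" "\<lambda>_. carrier R" v]) auto

context cring
begin

lemma free_module_closed:
  assumes "u \<in> carrier (free_module R n)" "i < n"
  shows "u i \<in> carrier R"
  using assms by auto

lemma module_free: "module R (free_module R n)"
proof (rule moduleI)
  show "abelian_group (free_module R n)"
  proof (rule abelian_groupI)
    fix u assume u: "u \<in> carrier (free_module R n)"
    have u': "u i \<in> carrier R" if "i < n" for i
      using u that by auto
    have "(\<lambda>i\<in>{..<n}. \<ominus> u i) \<oplus>\<^bsub>free_module R n\<^esub> u = \<zero>\<^bsub>free_module R n\<^esub>"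
      unfolding free_module_ops by (rule restrict_ext) (simp add: l_neg u')
    moreover have "(\<lambda>i\<in>{..<n}. \<ominus> u i) \<in> carrier (free_module R n)"
      using u' by auto
    ultimately show "\<exists>v\<in>carrier (free_module R n). v \<oplus>\<^bsub>free_module R n\<^esub> u = \<zero>\<^bsub>free_module R n\<^esub>"
      by blast
    show "\<zero>\<^bsub>free_module R n\<^esub> \<oplus>\<^bsub>free_module R n\<^esub> u = u"
      by (rule free_module_eqI[OF _ u]) (auto simp: free_module_ops u')
  next
    fix u v w assume "u \<in> carrier (free_module R n)" "v \<in> carrier (free_module R n)" "w \<in> carrier (free_module R n)"
    then have "u i \<in> carrier R" "v i \<in> carrier R" "w i \<in> carrier R" if "i < n" for i
      using that by auto
    then show "u \<oplus>\<^bsub>free_module R n\<^esub> v \<oplus>\<^bsub>free_module R n\<^esub> w = u \<oplus>\<^bsub>free_module R n\<^esub> (v \<oplus>\<^bsub>free_module R n\<^esub> w)"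
      unfolding free_module_ops by (intro restrict_ext) (simp add: a_assoc)
  next
    fix u v assume "u \<in> carrier (free_module R n)" "v \<in> carrier (free_module R n)"
    then have "u i \<in> carrier R" "v i \<in> carrier R" if "i < n" for i
      using that by auto
    then show "u \<oplus>\<^bsub>free_module R n\<^esub> v = v \<oplus>\<^bsub>free_module R n\<^esub> u"
      unfolding free_module_ops by (intro restrict_ext) (simp add: a_comm)
  qed (auto simp: free_module_ops)
next
  fix a b u assume "a \<in> carrier R" "b \<in> carrier R" "u \<in> carrier (free_module R n)"
  then have *: "a \<in> carrier R" "b \<in> carrier R" "\<And>i. i < n \<Longrightarrow> u i \<in> carrier R" by auto
  then show "(a \<oplus> b) \<odot>\<^bsub>free_module R n\<^esub> u = a \<odot>\<^bsub>free_module R n\<^esub> u \<oplus>\<^bsub>free_module R n\<^esub> b \<odot>\<^bsub>free_module R n\<^esub> u"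
    "(a \<otimes> b) \<odot>\<^bsub>free_module R n\<^esub> u = a \<odot>\<^bsub>free_module R n\<^esub> (b \<odot>\<^bsub>free_module R n\<^esub> u)"
    unfolding free_module_ops by (auto intro!: restrict_ext simp: l_distr m_assoc)
next
  fix a u v assume "a \<in> carrier R" "u \<in> carrier (free_module R n)" "v \<in> carrier (free_module R n)"
  then have *: "a \<in> carrier R" "\<And>i. i < n \<Longrightarrow> u i \<in> carrier R \<and> v i \<in> carrier R" by auto
  then show "a \<odot>\<^bsub>free_module R n\<^esub> (u \<oplus>\<^bsub>free_module R n\<^esub> v) = a \<odot>\<^bsub>free_module R n\<^esub> u \<oplus>\<^bsub>free_module R n\<^esub> a \<odot>\<^bsub>free_module R n\<^esub> v"
    unfolding free_module_ops by (auto intro!: restrict_ext simp: r_distr)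
next
  fix u assume u: "u \<in> carrier (free_module R n)"
  have u': "u i \<in> carrier R" if "i < n" for i
    using u that by auto
  show "\<one> \<odot>\<^bsub>free_module R n\<^esub> u = u"
    by (rule free_module_eqI[OF _ u]) (auto simp: free_module_ops u')
qed (auto simp: is_cring free_module_ops)

end

text \<open>
  A recursion over the coordinates instead of a finite sum: every fact below is proved by
  induction on the number of coordinates already summed.
\<close>

primrec lincomb :: "('a, 'b) module \<Rightarrow> (nat \<Rightarrow> 'b) \<Rightarrow> (nat \<Rightarrow> 'a) \<Rightarrow> nat \<Rightarrow> 'b" where
  "lincomb M s v 0 = \<zero>\<^bsub>M\<^esub>"
| "lincomb M s v (Suc j) = lincomb M s v j \<oplus>\<^bsub>M\<^esub> v j \<odot>\<^bsub>M\<^esub> s j"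

definition unit_vector :: "('a, 'c) ring_scheme \<Rightarrow> nat \<Rightarrow> nat \<Rightarrow> nat \<Rightarrow> 'a" where
  "unit_vector R n i = (\<lambda>j\<in>{..<n}. if j = i then \<one>\<^bsub>R\<^esub> else \<zero>\<^bsub>R\<^esub>)"

lemma (in cring) unit_vector_closed: "unit_vector R n i \<in> carrier (free_module R n)"
  by (auto simp: unit_vector_def)

locale module_family = module R M for R (structure) and M :: "('a, 'b) module" (structure) +
  fixes s :: "nat \<Rightarrow> 'b" and n :: nat
  assumes s: "\<And>i. i < n \<Longrightarrow> s i \<in> carrier M"
begin

lemma lincomb_closed:
  assumes "v \<in> carrier (free_module R n)" "j \<le> n"
  shows "lincomb M s v j \<in> carrier M"
  using assms(2)
proof (induction j)
  case (Suc j)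
  then have "v j \<in> carrier R" "s j \<in> carrier M"
    using s R.free_module_closed[OF assms(1)] by simp_all
  then show ?case
    using Suc by simp
qed simp

lemma lincomb_add:
  assumes u: "u \<in> carrier (free_module R n)" and v: "v \<in> carrier (free_module R n)" and "j \<le> n"
  shows "lincomb M s (u \<oplus>\<^bsub>free_module R n\<^esub> v) j = lincomb M s u j \<oplus>\<^bsub>M\<^esub> lincomb M s v j"
  using assms(3)
proof (induction j)
  case (Suc j)
  have "u j \<in> carrier R" "v j \<in> carrier R" "s j \<in> carrier M"
    using Suc.prems s R.free_module_closed[OF u] R.free_module_closed[OF v] by simp_all
  then show ?case
    using Suc lincomb_closed[OF u, of j] lincomb_closed[OF v, of j]
    by (simp add: free_module_ops smult_l_distr M.a_ac)
qed simp

lemma lincomb_smult: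
  assumes v: "v \<in> carrier (free_module R n)" and a: "a \<in> carrier R" and "j \<le> n"
  shows "lincomb M s (a \<odot>\<^bsub>free_module R n\<^esub> v) j = a \<odot>\<^bsub>M\<^esub> lincomb M s v j"
  using assms(3)
proof (induction j)
  case (Suc j)
  have "v j \<in> carrier R" "s j \<in> carrier M"
    using Suc.prems s R.free_module_closed[OF v] by simp_all
  then show ?case
    using Suc a lincomb_closed[OF v, of j]
    by (simp add: free_module_ops smult_r_distr smult_assoc1)
qed (simp add: a)

definition lincomb_map :: "(nat \<Rightarrow> 'a) \<Rightarrow> 'b" where
  "lincomb_map = (\<lambda>v\<in>carrier (free_module R n). lincomb M s v n)"

lemma lincomb_map_linear: "lincomb_map \<in> lin_maps R (free_module R n) M"
  unfolding lincomb_map_def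
proof -
  interpret F: module R "free_module R n" by (rule R.module_free)
  show "(\<lambda>v\<in>carrier (free_module R n). lincomb M s v n) \<in> lin_maps R (free_module R n) M"
    by (intro lin_mapsI lincomb_closed lincomb_add lincomb_smult F.smult_closed F.M.a_closed order_refl)
qed

lemma lincomb_map_unit_vector:
  assumes i: "i < n"
  shows "lincomb_map (unit_vector R n i) = s i"
proof -
  have "j \<le> n \<Longrightarrow> lincomb M s (unit_vector R n i) j = (if i < j then s i else \<zero>\<^bsub>M\<^esub>)" for j
  proof (induction j)
    case (Suc j)
    then show ?case
      using s[of j] s[OF i] by (auto simp: unit_vector_def less_Suc_eq)
  qed simp
  then show ?thesis
    using i R.unit_vector_closed[of n i] by (simp add: lincomb_map_def)
qed

end

text \<open>
  By induction on \<open>j\<close>, the claim holds for the truncation of \<open>v\<close> to its first \<open>j\<close> coordinates.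
\<close>

lemma lin_maps_free_eq_lincomb:
  assumes "cring R" and N: "module R N" and f: "f \<in> lin_maps R (free_module R n) N"
    and v: "v \<in> carrier (free_module R n)"
  shows "f v = lincomb N (\<lambda>i. f (unit_vector R n i)) v n"
proof -
  interpret cring R by fact
  interpret N: module R N by fact
  let ?F = "free_module R n"
  interpret F: module R ?F by (rule module_free)
  let ?t = "\<lambda>j. \<lambda>i\<in>{..<n}. if i < j then v i else \<zero>\<^bsub>R\<^esub>"
  have "j \<le> n \<Longrightarrow> f (?t j) = lincomb N (\<lambda>i. f (unit_vector R n i)) v j" for j
  proof (induction j)
    case 0
    have "?t 0 = \<zero>\<^bsub>?F\<^esub>" by (simp add: free_module_ops)
    then show ?case using lin_maps_zero[OF module_free N f] by simp
  next
    case (Suc j)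
    have v': "v i \<in> carrier R" if "i < n" for i using free_module_closed[OF v that] .
    have c: "?t j \<in> carrier ?F" using v' by simp
    have e: "unit_vector R n j \<in> carrier ?F" by (rule unit_vector_closed)
    have vj: "v j \<in> carrier R" using v' Suc.prems by simp
    have "?t (Suc j) = ?t j \<oplus>\<^bsub>?F\<^esub> v j \<odot>\<^bsub>?F\<^esub> unit_vector R n j"
      unfolding free_module_ops unit_vector_def using v' vj
      by (intro restrict_ext) (auto simp: less_Suc_eq)
    then have "f (?t (Suc j)) = f (?t j) \<oplus>\<^bsub>N\<^esub> v j \<odot>\<^bsub>N\<^esub> f (unit_vector R n j)"
      using lin_maps_add[OF f c F.smult_closed[OF vj e]] lin_maps_smult[OF f vj e] by simp
    then show ?case
      unfolding lincomb.simps Suc.IH[OF Suc_leD[OF Suc.prems]] .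
  qed
  moreover have "?t n = v"
    using free_module_closed[OF v] by (intro free_module_eqI[OF _ v]) simp_all
  ultimately show ?thesis by (metis order_refl)
qed

text \<open>
  That \<open>S\<close> generates \<open>N\<close> is expressed by the universal property of the span.  By induction on the rank, a
  submodule of \<open>R\<^sup>n\<^sup>+\<^sup>1\<close> is generated by lifts of generators of the ideal of its last coordinates,
  together with generators of its part in \<open>R\<^sup>n\<close>.
\<close>

lemma (in noetherian_ring) submodule_free_finitely_generated:
  assumes "cring R" "submodule N R (free_module R n)"
  shows "\<exists>S. finite S \<and> S \<subseteq> N \<and> (\<forall>N'. submodule N' R (free_module R n) \<longrightarrow> S \<subseteq> N' \<longrightarrow> N \<subseteq> N')"
  using assms(2)
proof (induction n arbitrary: N)
  case 0
  interpret cring R by fact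
  interpret F: module R "free_module R 0" by (rule module_free)
  have "N \<subseteq> {\<zero>\<^bsub>free_module R 0\<^esub>}"
    using F.submoduleE(1)[OF 0] by (auto simp: free_module_ops restrict_def)
  then show ?case
    using F.submodule_zero by (intro exI[of _ "{}"]) auto
next
  case (Suc n)
  interpret cring R by fact
  let ?F = "free_module R (Suc n)" and ?G = "free_module R n"
  interpret F: module R ?F by (rule module_free)
  interpret G: module R ?G by (rule module_free)
  \<comment> \<open>The last coordinates, and the vectors with last coordinate zero, seen in \<open>R\<^sup>n\<close>.\<close>
  let ?last = "\<lambda>N. (\<lambda>v. v n) ` N"
  let ?res = "\<lambda>v. restrict v {..<n}"
  let ?init = "\<lambda>N. ?res ` {v \<in> N. v n = \<zero>}"
  have last: "ideal (?last N) R" if N: "submodule N R ?F" for N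
  proof -
    note E = F.submoduleE[OF N]
    have "submodule (?last N) R (regular_module R)"
    proof (rule module.submoduleI'[OF module_regular])
      show "?last N \<subseteq> carrier (regular_module R)" using E(1) by auto
      show "\<zero>\<^bsub>regular_module R\<^esub> \<in> ?last N"
        using F.submodule_zero[OF N] by (auto intro!: image_eqI[of _ _ "\<zero>\<^bsub>?F\<^esub>"] simp: free_module_ops)
    next
      fix x y assume "x \<in> ?last N" "y \<in> ?last N"
      then obtain u v where "u \<in> N" "v \<in> N" "x = u n" "y = v n" by auto
      then show "x \<oplus>\<^bsub>regular_module R\<^esub> y \<in> ?last N"
        using E(5)[of u v] by (intro image_eqI[of _ _ "u \<oplus>\<^bsub>?F\<^esub> v"]) (auto simp: free_module_ops)
    next
      fix a x assume "a \<in> carrier R" "x \<in> ?last N"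
      then obtain u where "a \<in> carrier R" "u \<in> N" "x = u n" by auto
      then show "a \<odot>\<^bsub>regular_module R\<^esub> x \<in> ?last N"
        using E(4)[of a u] by (intro image_eqI[of _ _ "a \<odot>\<^bsub>?F\<^esub> u"]) (auto simp: free_module_ops)
    qed
    then show ?thesis by (simp add: submodule_regular_iff)
  qed
  have init: "submodule (?init N) R ?G" if N: "submodule N R ?F" for N
  proof -
    note E = F.submoduleE[OF N]
    show ?thesis
    proof (rule G.submoduleI')
      show "?init N \<subseteq> carrier ?G"
      proof clarify
        fix v assume "v \<in> N"
        then have "v \<in> carrier ?F" using E(1) by blast
        then have "v i \<in> carrier R" if "i < n" for i
          using free_module_closed[of v "Suc n" i] that by simp
        then show "?res v \<in> carrier ?G" by simp
      qed
      show "\<zero>\<^bsub>?G\<^esub> \<in> ?init N"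
        using F.submodule_zero[OF N]
        by (intro image_eqI[of _ _ "\<zero>\<^bsub>?F\<^esub>"]) (auto simp: free_module_ops intro!: restrict_ext)
    next
      fix x y assume "x \<in> ?init N" "y \<in> ?init N"
      then obtain u v where *: "u \<in> N" "v \<in> N" "u n = \<zero>" "v n = \<zero>" "x = ?res u" "y = ?res v" by auto
      have "x \<oplus>\<^bsub>?G\<^esub> y = ?res (u \<oplus>\<^bsub>?F\<^esub> v)"
        unfolding free_module_ops * by (auto simp: fun_eq_iff)
      then show "x \<oplus>\<^bsub>?G\<^esub> y \<in> ?init N"
        using E(5)[of u v] * by (intro image_eqI[of _ _ "u \<oplus>\<^bsub>?F\<^esub> v"]) (auto simp: free_module_ops)
    next
      fix a x assume "a \<in> carrier R" "x \<in> ?init N"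
      then obtain u where *: "a \<in> carrier R" "u \<in> N" "u n = \<zero>" "x = ?res u" by auto
      have "a \<odot>\<^bsub>?G\<^esub> x = ?res (a \<odot>\<^bsub>?F\<^esub> u)"
        unfolding free_module_ops * by (auto simp: fun_eq_iff)
      then show "a \<odot>\<^bsub>?G\<^esub> x \<in> ?init N"
        using E(4)[of a u] * by (intro image_eqI[of _ _ "a \<odot>\<^bsub>?F\<^esub> u"]) (auto simp: free_module_ops)
    qed
  qed
  obtain A where A: "A \<subseteq> carrier R" "finite A" "?last N = Idl A"
    using finetely_gen[OF last[OF Suc.prems]] by auto
  have "A \<subseteq> ?last N" using A genideal_self by metis
  then obtain S1 where S1: "S1 \<subseteq> N" "finite S1" "A = (\<lambda>v. v n) ` S1"
    using finite_subset_image[OF A(2), of "\<lambda>v. v n" N] by blast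
  obtain T where T: "finite T" "T \<subseteq> ?init N" "\<forall>N'. submodule N' R ?G \<longrightarrow> T \<subseteq> N' \<longrightarrow> ?init N \<subseteq> N'"
    using Suc.IH[OF init[OF Suc.prems]] by auto
  obtain S0 where S0: "S0 \<subseteq> {v \<in> N. v n = \<zero>}" "finite S0" "T = ?res ` S0"
    using finite_subset_image[OF T(1,2)] by blast
  have "N \<subseteq> N'" if N': "submodule N' R ?F" "S1 \<union> S0 \<subseteq> N'" for N'
  proof
    fix v assume v: "v \<in> N"
    \<comment> \<open>Inside \<open>N \<inter> N'\<close> the lifts below stay in \<open>N\<close>.\<close>
    let ?N = "N \<inter> N'"
    have N: "submodule ?N R ?F" using F.submodule_Int Suc.prems N' by blast
    have vF: "v \<in> carrier ?F" using v F.submoduleE(1)[OF Suc.prems] by blast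
    have "A \<subseteq> ?last ?N" using S1 N'(2) by auto
    then have "?last N \<subseteq> ?last ?N" using genideal_minimal[OF last[OF N]] A(3) by simp
    then obtain w where w: "w \<in> ?N" "w n = v n" using v by force
    have wF: "w \<in> carrier ?F" using w F.submoduleE(1)[OF N] by blast
    let ?u = "v \<ominus>\<^bsub>?F\<^esub> w"
    have u: "?u \<in> N" "?u \<in> carrier ?F" "v = ?u \<oplus>\<^bsub>?F\<^esub> w"
      using F.submodule_minus[OF Suc.prems v, of w] w vF wF
      by (auto simp: F.M.minus_eq F.M.a_assoc F.M.l_neg simp del: free_module_carrier)
    have "v n = ?u n \<oplus> w n"
      by (subst u(3)) (simp add: free_module_ops)
    moreover have "?u n \<in> carrier R" "w n \<in> carrier R"
      using u(2) wF by auto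
    ultimately have un: "?u n = \<zero>" using w(2) add.r_cancel_one by metis
    have "T \<subseteq> ?init ?N" using S0 N'(2) by auto
    then have "?init N \<subseteq> ?init ?N" using T(3) init[OF N] by blast
    then obtain u' where u': "u' \<in> ?N" "u' n = \<zero>" "?res ?u = ?res u'" using u(1) un by blast
    have "?u = u'"
    proof (rule free_module_eqI[OF u(2)])
      show "u' \<in> carrier ?F" using u'(1) F.submoduleE(1)[OF N] by blast
      fix i assume "i < Suc n"
      then consider "i < n" | "i = n" by linarith
      then show "?u i = u' i"
      proof cases
        case 1
        then show ?thesis using fun_cong[OF u'(3), of i] by simp
      qed (use un u'(2) in simp)
    qed
    then show "v \<in> N'"
      using u(3) u'(1) w(1) F.submoduleE(5)[OF N'(1)] by auto
  qed
  then show ?case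
    using S1 S0 by (intro exI[of _ "S1 \<union> S0"]) auto
qed

lemma (in noetherian_ring) submodule_free_is_image:
  assumes "cring R" "submodule N R (free_module R n)"
  shows "\<exists>k. \<exists>f \<in> lin_maps R (free_module R k) (free_module R n). f ` carrier (free_module R k) = N"
proof -
  interpret cring R by fact
  let ?F = "free_module R n"
  interpret F: module R ?F by (rule module_free)
  obtain S where S: "finite S" "S \<subseteq> N" "\<And>N'. submodule N' R ?F \<Longrightarrow> S \<subseteq> N' \<Longrightarrow> N \<subseteq> N'"
    using submodule_free_finitely_generated[OF assms] by auto
  obtain k s where ks: "S = s ` {i::nat. i < k}"
    using finite_imp_nat_seg_image_inj_on[OF S(1)] by auto
  interpret FS: module_family R ?F s k
    using ks S(2) F.submoduleE(1)[OF assms(2)] by unfold_locales auto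
  let ?G = "free_module R k"
  have "submodule (FS.lincomb_map ` carrier ?G) R ?F"
    by (rule submodule_image[OF module_free F.module_axioms FS.lincomb_map_linear])
  moreover have "S \<subseteq> FS.lincomb_map ` carrier ?G"
  proof
    fix x assume "x \<in> S"
    then obtain i where "i < k" "x = s i" using ks by blast
    then show "x \<in> FS.lincomb_map ` carrier ?G"
      using FS.lincomb_map_unit_vector unit_vector_closed by (metis imageI)
  qed
  ultimately have "N \<subseteq> FS.lincomb_map ` carrier ?G" by (rule S(3))
  moreover have "FS.lincomb_map v \<in> N" if v: "v \<in> carrier ?G" for v
  proof -
    have "j \<le> k \<Longrightarrow> lincomb ?F s v j \<in> N" for j
    proof (induction j)
      case 0
      then show ?case using F.submodule_zero[OF assms(2)] by simp
    next
      case (Suc j)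
      then have "s j \<in> N" "v j \<in> carrier R" using ks S(2) v by auto
      then show ?case
        using Suc F.submoduleE(4,5)[OF assms(2)] by simp
    qed
    then show ?thesis using v by (simp add: FS.lincomb_map_def)
  qed
  ultimately show ?thesis
    using FS.lincomb_map_linear by blast
qed

text \<open>
  Dependent choice: each kernel is again the image of a free module of finite rank.
\<close>

lemma (in noetherian_ring) exists_free_resolution:
  assumes "cring R" and N: "module R N" and \<epsilon>: "\<epsilon> \<in> lin_maps R (free_module R n0) N"
    "\<epsilon> ` carrier (free_module R n0) = carrier N"
  shows "\<exists>n d. free_resolution R N n d \<epsilon>"
proof -
  interpret cring R by fact
  define good where "good = (\<lambda>(k, l, f). f \<in> lin_maps R (free_module R k) (free_module R l))"
  define follows where "follows = (\<lambda>(k, l, f) (k', l', f').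
    l' = k \<and> f' ` carrier (free_module R k') = a_kernel (free_module R k) (free_module R l) f)"
  obtain k0 f0 where 0: "f0 \<in> lin_maps R (free_module R k0) (free_module R n0)"
    "f0 ` carrier (free_module R k0) = a_kernel (free_module R n0) N \<epsilon>"
    using submodule_free_is_image[OF assms(1) submodule_kernel[OF module_free N \<epsilon>(1)]] by auto
  have "\<exists>g :: nat \<Rightarrow> nat \<times> nat \<times> ((nat \<Rightarrow> 'a) \<Rightarrow> nat \<Rightarrow> 'a).
      \<forall>i. (good (g i) \<and> (i = 0 \<longrightarrow> g i = (k0, n0, f0))) \<and> follows (g i) (g (Suc i))"
  proof (rule dependent_nat_choice)
    show "\<exists>x. good x \<and> (0 = 0 \<longrightarrow> x = (k0, n0, f0))"
      using 0 by (auto simp: good_def)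
  next
    fix x :: "nat \<times> nat \<times> ((nat \<Rightarrow> 'a) \<Rightarrow> nat \<Rightarrow> 'a)" and i :: nat
    assume "good x \<and> (i = 0 \<longrightarrow> x = (k0, n0, f0))"
    then obtain k l f where x: "x = (k, l, f)" "f \<in> lin_maps R (free_module R k) (free_module R l)"
      by (cases x) (auto simp: good_def)
    obtain k' f' where "f' \<in> lin_maps R (free_module R k') (free_module R k)"
      "f' ` carrier (free_module R k') = a_kernel (free_module R k) (free_module R l) f"
      using submodule_free_is_image[OF assms(1) submodule_kernel[OF module_free module_free x(2)]] by auto
    then show "\<exists>y. (good y \<and> (Suc i = 0 \<longrightarrow> y = (k0, n0, f0))) \<and> follows x y"
      by (intro exI[of _ "(k', k, f')"]) (auto simp: good_def follows_def x)
  qed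
  then obtain g where g: "\<And>i. good (g i)" "g 0 = (k0, n0, f0)" "\<And>i. follows (g i) (g (Suc i))"
    by blast
  define n where "n = (\<lambda>i. fst (snd (g i)))"
  define d where "d = (\<lambda>i. snd (snd (g i)))"
  have "fst (g i) = n (Suc i)" for i
    using g(3)[of i] by (auto simp: follows_def n_def split: prod.splits)
  then have gi: "g i = (n (Suc i), n i, d i)" for i
    by (simp add: n_def d_def prod_eq_iff)
  have "n 0 = n0" "n 1 = k0" "d 0 = f0"
    using gi[of 0] g(2) by auto
  then have "free_resolution R N n d \<epsilon>"
    using \<epsilon> 0 g(1,3) gi unfolding free_resolution_def good_def follows_def by simp
  then show ?thesis by blast
qed

section \<open>Ext of the residue field\<close>

locale local_noetherian_ring = cring R + noetherian_ring R for R (structure) +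
  fixes \<mm>
  assumes maximal: "maximalideal \<mm> R"
    and maximal_unique: "\<And>J. maximalideal J R \<Longrightarrow> J = \<mm>"

sublocale local_noetherian_ring \<subseteq> \<mm>: maximalideal \<mm> R
  by (rule maximal)

lemma noetherian_local_ring_iff: "noetherian_local_ring R m \<longleftrightarrow> local_noetherian_ring R m"
  unfolding noetherian_local_ring_def local_noetherian_ring_def local_noetherian_ring_axioms_def
  by auto

lemma (in local_noetherian_ring) max_ideal_eq: "max_ideal R = \<mm>"
  unfolding max_ideal_def using maximal maximal_unique by (rule the_equality)

lemma module_Hom:
  assumes "module R F" "module R M"
  shows "module R (Hom_module R F M)"
proof -
  interpret F: module R F by fact
  interpret M: module R M by fact
  let ?H = "Hom_module R F M"
  have carr: "carrier ?H = lin_maps R F M"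
    and add: "f \<oplus>\<^bsub>?H\<^esub> g = (\<lambda>x\<in>carrier F. f x \<oplus>\<^bsub>M\<^esub> g x)"
    and smult: "a \<odot>\<^bsub>?H\<^esub> f = (\<lambda>x\<in>carrier F. a \<odot>\<^bsub>M\<^esub> f x)"
    and zero: "\<zero>\<^bsub>?H\<^esub> = (\<lambda>x\<in>carrier F. \<zero>\<^bsub>M\<^esub>)" for f g a
    by (simp_all add: Hom_module_def)
  have add_closed: "f \<oplus>\<^bsub>?H\<^esub> g \<in> lin_maps R F M" if "f \<in> lin_maps R F M" "g \<in> lin_maps R F M" for f g
    unfolding add using that
    by (intro lin_mapsI)
       (simp_all add: lin_maps_closed lin_maps_add lin_maps_smult M.M.a_ac M.smult_r_distr)
  have smult_closed: "a \<odot>\<^bsub>?H\<^esub> f \<in> lin_maps R F M" if a: "a \<in> carrier R" and f: "f \<in> lin_maps R F M" for a f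
    unfolding smult
  proof (intro lin_mapsI)
    fix b x assume b: "b \<in> carrier R" and x: "x \<in> carrier F"
    have "f x \<in> carrier M" using f x by (rule lin_maps_closed)
    then have "a \<odot>\<^bsub>M\<^esub> (b \<odot>\<^bsub>M\<^esub> f x) = b \<odot>\<^bsub>M\<^esub> (a \<odot>\<^bsub>M\<^esub> f x)"
      using a b by (metis F.R.m_comm M.smult_assoc1)
    then show "a \<odot>\<^bsub>M\<^esub> f (b \<odot>\<^bsub>F\<^esub> x) = b \<odot>\<^bsub>M\<^esub> (a \<odot>\<^bsub>M\<^esub> f x)"
      using lin_maps_smult[OF f b x] by simp
  qed (use a f in \<open>simp_all add: lin_maps_closed lin_maps_add M.smult_r_distr\<close>)
  have zero_closed: "\<zero>\<^bsub>?H\<^esub> \<in> lin_maps R F M"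
    unfolding zero by (intro lin_mapsI) simp_all
  have eqI: "f = g" if "f \<in> lin_maps R F M" "g \<in> lin_maps R F M" "\<And>x. x \<in> carrier F \<Longrightarrow> f x = g x" for f g
    using that by (rule lin_maps_ext)
  show ?thesis
  proof (rule moduleI)
    show "abelian_group ?H"
    proof (rule abelian_groupI)
      fix f assume f: "f \<in> carrier ?H"
      then have f': "f \<in> lin_maps R F M" by (simp add: carr)
      have c: "(\<ominus>\<^bsub>R\<^esub> \<one>\<^bsub>R\<^esub>) \<odot>\<^bsub>?H\<^esub> f \<in> lin_maps R F M"
        by (rule smult_closed[OF _ f']) simp
      have "(\<ominus>\<^bsub>R\<^esub> \<one>\<^bsub>R\<^esub>) \<odot>\<^bsub>?H\<^esub> f \<oplus>\<^bsub>?H\<^esub> f = \<zero>\<^bsub>?H\<^esub>"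
        by (rule eqI[OF add_closed[OF c f'] zero_closed])
           (simp add: add smult zero M.smult_l_minus M.M.l_neg lin_maps_closed[OF f'])
      with c show "\<exists>g\<in>carrier ?H. g \<oplus>\<^bsub>?H\<^esub> f = \<zero>\<^bsub>?H\<^esub>"
        unfolding carr by blast
      show "\<zero>\<^bsub>?H\<^esub> \<oplus>\<^bsub>?H\<^esub> f = f"
        by (rule eqI[OF add_closed[OF zero_closed f'] f']) (simp add: add zero lin_maps_closed[OF f'])
    next
      fix f g h assume "f \<in> carrier ?H" "g \<in> carrier ?H" "h \<in> carrier ?H"
      then have f: "f \<in> lin_maps R F M" "g \<in> lin_maps R F M" "h \<in> lin_maps R F M" by (simp_all add: carr)
      show "f \<oplus>\<^bsub>?H\<^esub> g \<oplus>\<^bsub>?H\<^esub> h = f \<oplus>\<^bsub>?H\<^esub> (g \<oplus>\<^bsub>?H\<^esub> h)"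
        by (rule eqI[OF add_closed[OF add_closed[OF f(1,2)] f(3)] add_closed[OF f(1) add_closed[OF f(2,3)]]])
           (simp add: add M.M.a_assoc f[THEN lin_maps_closed])
    next
      fix f g assume "f \<in> carrier ?H" "g \<in> carrier ?H"
      then have f: "f \<in> lin_maps R F M" "g \<in> lin_maps R F M" by (simp_all add: carr)
      show "f \<oplus>\<^bsub>?H\<^esub> g = g \<oplus>\<^bsub>?H\<^esub> f"
        by (rule eqI[OF add_closed[OF f] add_closed[OF f(2,1)]])
           (simp add: add M.M.a_comm f[THEN lin_maps_closed])
    qed (simp_all add: carr add_closed zero_closed)
  next
    fix a b f assume ab: "a \<in> carrier R" "b \<in> carrier R" and "f \<in> carrier ?H"
    then have f: "f \<in> lin_maps R F M" by (simp add: carr)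
    have ab': "a \<oplus>\<^bsub>R\<^esub> b \<in> carrier R" "a \<otimes>\<^bsub>R\<^esub> b \<in> carrier R" using ab by auto
    show "(a \<oplus>\<^bsub>R\<^esub> b) \<odot>\<^bsub>?H\<^esub> f = a \<odot>\<^bsub>?H\<^esub> f \<oplus>\<^bsub>?H\<^esub> b \<odot>\<^bsub>?H\<^esub> f"
      by (rule eqI[OF smult_closed[OF ab'(1) f] add_closed[OF smult_closed[OF ab(1) f] smult_closed[OF ab(2) f]]])
         (simp add: add smult ab M.smult_l_distr lin_maps_closed[OF f])
    show "(a \<otimes>\<^bsub>R\<^esub> b) \<odot>\<^bsub>?H\<^esub> f = a \<odot>\<^bsub>?H\<^esub> (b \<odot>\<^bsub>?H\<^esub> f)"
      by (rule eqI[OF smult_closed[OF ab'(2) f] smult_closed[OF ab(1) smult_closed[OF ab(2) f]]])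
         (simp add: smult ab M.smult_assoc1 lin_maps_closed[OF f])
  next
    fix a f g assume a: "a \<in> carrier R" and "f \<in> carrier ?H" "g \<in> carrier ?H"
    then have f: "f \<in> lin_maps R F M" "g \<in> lin_maps R F M" by (simp_all add: carr)
    show "a \<odot>\<^bsub>?H\<^esub> (f \<oplus>\<^bsub>?H\<^esub> g) = a \<odot>\<^bsub>?H\<^esub> f \<oplus>\<^bsub>?H\<^esub> a \<odot>\<^bsub>?H\<^esub> g"
      by (rule eqI[OF smult_closed[OF a add_closed[OF f]] add_closed[OF smult_closed[OF a f(1)] smult_closed[OF a f(2)]]])
         (simp add: add smult a M.smult_r_distr f[THEN lin_maps_closed])
  next
    fix f assume "f \<in> carrier ?H"
    then have f: "f \<in> lin_maps R F M" by (simp add: carr)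
    show "\<one>\<^bsub>R\<^esub> \<odot>\<^bsub>?H\<^esub> f = f"
      by (rule eqI[OF smult_closed[OF F.R.one_closed f] f]) (simp add: smult lin_maps_closed[OF f])
  qed (simp_all add: carr smult_closed F.R.is_cring)
qed

lemma cocycles_iff:
  "f \<in> cocycles R n d M i \<longleftrightarrow> f \<in> lin_maps R (free_module R (n i)) M \<and>
     (\<forall>w\<in>carrier (free_module R (n (Suc i))). f (d i w) = \<zero>\<^bsub>M\<^esub>)"
  unfolding cocycles_def compose_def Hom_module_def
  by (simp add: restrict_def fun_eq_iff del: free_module_carrier) metis

lemma module_cocycles:
  assumes "cring R" "module R M"
    and d: "d i \<in> lin_maps R (free_module R (n (Suc i))) (free_module R (n i))"
  shows "module R ((Hom_module R (free_module R (n i)) M)\<lparr>carrier := cocycles R n d M i\<rparr>)"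
proof -
  interpret cring R by fact
  interpret M: module R M by fact
  let ?F = "free_module R (n i)"
  interpret H: module R "Hom_module R ?F M" by (rule module_Hom[OF module_free assms(2)])
  have carr: "carrier (Hom_module R ?F M) = lin_maps R ?F M" by (simp add: Hom_module_def)
  have "submodule (cocycles R n d M i) R (Hom_module R ?F M)"
  proof (rule H.submoduleI')
    show "cocycles R n d M i \<subseteq> carrier (Hom_module R ?F M)" by (auto simp: carr cocycles_iff)
    show "\<zero>\<^bsub>Hom_module R ?F M\<^esub> \<in> cocycles R n d M i"
      using H.M.zero_closed lin_maps_closed[OF d]
      by (simp add: cocycles_iff carr del: free_module_carrier) (simp add: Hom_module_def del: free_module_carrier)
  next
    fix f g assume fg: "f \<in> cocycles R n d M i" "g \<in> cocycles R n d M i"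
    then have "f \<oplus>\<^bsub>Hom_module R ?F M\<^esub> g \<in> lin_maps R ?F M"
      using H.M.a_closed[of f g] by (simp add: carr cocycles_iff)
    then show "f \<oplus>\<^bsub>Hom_module R ?F M\<^esub> g \<in> cocycles R n d M i"
      using fg lin_maps_closed[OF d]
      by (simp add: cocycles_iff del: free_module_carrier) (simp add: Hom_module_def del: free_module_carrier)
  next
    fix a f assume af: "a \<in> carrier R" "f \<in> cocycles R n d M i"
    then have "a \<odot>\<^bsub>Hom_module R ?F M\<^esub> f \<in> lin_maps R ?F M"
      using H.smult_closed[of a f] by (simp add: carr cocycles_iff)
    then show "a \<odot>\<^bsub>Hom_module R ?F M\<^esub> f \<in> cocycles R n d M i"
      using af lin_maps_closed[OF d]
      by (simp add: cocycles_iff del: free_module_carrier) (simp add: Hom_module_def del: free_module_carrier)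
  qed
  then show ?thesis
    by (rule submodule.submodule_is_module[OF _ H.module_axioms])
qed

context local_noetherian_ring
begin

lemma module_with_submodule_residue: "module_with_submodule R (regular_module R) \<mm>"
  using module_regular \<mm>.is_ideal submodule_regular_iff
  by (intro module_with_submodule.intro module_with_submodule_axioms.intro) auto

lemma residue_module_eq: "residue_module R = quotient_module (regular_module R) \<mm>"
  by (simp add: residue_module_def max_ideal_eq)

lemma module_residue: "module R (residue_module R)"
  unfolding residue_module_eq by (rule module_with_submodule.module_quotient[OF module_with_submodule_residue])

lemma residue_module_resolution: "\<exists>n d \<epsilon>. free_resolution R (residue_module R) n d \<epsilon>"
proof -
  interpret k: module_with_submodule R "regular_module R" \<mm> by (rule module_with_submodule_residue)
  let ?F = "free_module R 1"
  interpret F: module R ?F by (rule module_free)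
  let ?\<epsilon> = "\<lambda>v\<in>carrier ?F. \<mm> +>\<^bsub>regular_module R\<^esub> v 0"
  have v0: "v 0 \<in> carrier R" if "v \<in> carrier ?F" for v
    using free_module_closed[OF that] by simp
  have lin: "?\<epsilon> \<in> lin_maps R ?F (residue_module R)"
    unfolding residue_module_eq
  proof (rule lin_mapsI)
    fix u v assume uv: "u \<in> carrier ?F" "v \<in> carrier ?F"
    then show "\<mm> +>\<^bsub>regular_module R\<^esub> (u \<oplus>\<^bsub>?F\<^esub> v) 0 =
      (\<mm> +>\<^bsub>regular_module R\<^esub> u 0) \<oplus>\<^bsub>quotient_module (regular_module R) \<mm>\<^esub> (\<mm> +>\<^bsub>regular_module R\<^esub> v 0)"
      using k.add_quotient_module[of "u 0" "v 0"] v0 by (simp add: free_module_ops del: free_module_carrier)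
  next
    fix a v assume "a \<in> carrier R" "v \<in> carrier ?F"
    then show "\<mm> +>\<^bsub>regular_module R\<^esub> (a \<odot>\<^bsub>?F\<^esub> v) 0 =
      a \<odot>\<^bsub>quotient_module (regular_module R) \<mm>\<^esub> (\<mm> +>\<^bsub>regular_module R\<^esub> v 0)"
      using k.smult_quotient_module[of a "v 0"] v0 by (simp add: free_module_ops del: free_module_carrier)
  qed (use v0 F.M.a_closed F.smult_closed in \<open>simp_all add: k.carrier_quotient_module del: free_module_carrier\<close>)
  have onto: "?\<epsilon> ` carrier ?F = carrier (residue_module R)"
  proof
    show "?\<epsilon> ` carrier ?F \<subseteq> carrier (residue_module R)"
      using lin_maps_closed[OF lin] by blast
    show "carrier (residue_module R) \<subseteq> ?\<epsilon> ` carrier ?F"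
    proof
      fix x assume "x \<in> carrier (residue_module R)"
      then obtain r where r: "r \<in> carrier R" "x = \<mm> +>\<^bsub>regular_module R\<^esub> r"
        by (auto simp: residue_module_eq k.carrier_quotient_module)
      have "(\<lambda>i\<in>{..<1::nat}. r) \<in> carrier ?F" using r by simp
      then show "x \<in> ?\<epsilon> ` carrier ?F"
        using r by (intro image_eqI[of _ _ "\<lambda>i\<in>{..<1::nat}. r"]) (simp_all del: free_module_carrier)
    qed
  qed
  show ?thesis
    using exists_free_resolution[OF is_cring module_residue lin onto] by blast
qed

lemma Ext_module_residue:
  "\<exists>n d \<epsilon>. free_resolution R (residue_module R) n d \<epsilon> \<and>
     Ext_module R i (residue_module R) M =
       quotient_module ((Hom_module R (free_module R (n i)) M)\<lparr>carrier := cocycles R n d M i\<rparr>)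
         (coboundaries R n d M i)"
proof -
  let ?P = "\<lambda>(n, d, \<epsilon>). free_resolution R (residue_module R) n d \<epsilon>"
  obtain n d \<epsilon> where nd: "(SOME x. ?P x) = (n, d, \<epsilon>)"
    by (cases "SOME x. ?P x") blast
  obtain n' d' \<epsilon>' where "free_resolution R (residue_module R) n' d' \<epsilon>'"
    using residue_module_resolution by blast
  then have "?P (n', d', \<epsilon>')" by simp
  then have "?P (SOME x. ?P x)" by (rule someI)
  then have "free_resolution R (residue_module R) n d \<epsilon>"
    unfolding nd by simp
  moreover have "Ext_module R i (residue_module R) M =
       quotient_module ((Hom_module R (free_module R (n i)) M)\<lparr>carrier := cocycles R n d M i\<rparr>)
         (coboundaries R n d M i)"
    unfolding Ext_module_def nd Let_def by simp
  ultimately show ?thesis by blast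
qed

text \<open>
  A linear form \<open>\<rho>\<close> that lifts \<open>\<epsilon>\<close> along \<open>R \<rightarrow> R/\<mm>\<close> exists because the source is free.  It replaces the
  cosets of the residue module by elements of \<open>R\<close> in all later computations.
\<close>

lemma residue_augmentation_lift:
  assumes \<epsilon>: "\<epsilon> \<in> lin_maps R (free_module R n) (residue_module R)"
    and onto: "\<epsilon> ` carrier (free_module R n) = carrier (residue_module R)"
  shows "\<exists>\<rho> e. \<rho> \<in> lin_maps R (free_module R n) (regular_module R) \<and> e \<in> carrier (free_module R n) \<and>
           \<rho> e \<ominus> \<one> \<in> \<mm> \<and>
           (\<forall>v\<in>carrier (free_module R n). v \<in> a_kernel (free_module R n) (residue_module R) \<epsilon> \<longleftrightarrow> \<rho> v \<in> \<mm>)"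
proof -
  interpret k: module_with_submodule R "regular_module R" \<mm> by (rule module_with_submodule_residue)
  let ?F = "free_module R n" and ?c = "\<lambda>r. \<mm> +>\<^bsub>regular_module R\<^esub> r"
  have k_carr: "carrier (residue_module R) = ?c ` carrier R"
    by (simp add: residue_module_eq k.carrier_quotient_module)
  have "\<exists>r. r \<in> carrier R \<and> \<epsilon> (unit_vector R n i) = ?c r" for i
    using lin_maps_closed[OF \<epsilon> unit_vector_closed[of n i]] k_carr by blast
  then obtain r where r: "\<And>i. r i \<in> carrier R" "\<And>i. \<epsilon> (unit_vector R n i) = ?c (r i)" by metis
  interpret \<rho>: module_family R "regular_module R" r n
    using r by unfold_locales auto
  have \<epsilon>_eq: "\<epsilon> v = ?c (\<rho>.lincomb_map v)" if v: "v \<in> carrier ?F" for v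
  proof -
    have "j \<le> n \<Longrightarrow> lincomb (residue_module R) (\<lambda>i. ?c (r i)) v j = ?c (lincomb (regular_module R) r v j)" for j
    proof (induction j)
      case 0
      then show ?case using k.zero_quotient_module_coset by (simp add: residue_module_eq)
    next
      case (Suc j)
      have "v j \<in> carrier R" using free_module_closed[OF v] Suc.prems by simp
      moreover have "lincomb (regular_module R) r v j \<in> carrier R"
        using \<rho>.lincomb_closed[OF v, of j] Suc.prems by simp
      ultimately show ?case
        using Suc r(1)[of j] k.add_quotient_module[of "lincomb (regular_module R) r v j" "v j \<otimes> r j"]
          k.smult_quotient_module[of "v j" "r j"]
        by (simp add: residue_module_eq)
    qed
    then have "lincomb (residue_module R) (\<lambda>i. ?c (r i)) v n = ?c (\<rho>.lincomb_map v)"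
      using v by (simp add: \<rho>.lincomb_map_def del: free_module_carrier)
    then show ?thesis
      using lin_maps_free_eq_lincomb[OF is_cring module_residue \<epsilon> v] r(2) by simp
  qed
  have \<rho>_closed: "\<rho>.lincomb_map v \<in> carrier R" if "v \<in> carrier ?F" for v
    using lin_maps_closed[OF \<rho>.lincomb_map_linear that] by simp
  have "?c \<one> \<in> \<epsilon> ` carrier ?F" unfolding onto k_carr by blast
  then obtain e where e: "e \<in> carrier ?F" "\<epsilon> e = ?c \<one>" by blast
  then obtain h where h: "h \<in> \<mm>" "\<rho>.lincomb_map e = h \<oplus> \<one>"
    using \<epsilon>_eq[OF e(1)] k.coset_eq_iff[of "\<rho>.lincomb_map e" \<one>] \<rho>_closed[OF e(1)] by auto
  then have "\<rho>.lincomb_map e \<ominus> \<one> = h"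
    using \<mm>.Icarr[OF h(1)] by (simp add: minus_eq a_assoc r_neg)
  moreover have "v \<in> a_kernel ?F (residue_module R) \<epsilon> \<longleftrightarrow> \<rho>.lincomb_map v \<in> \<mm>"
    if v: "v \<in> carrier ?F" for v
    using v \<epsilon>_eq[OF v] k.coset_eq_self_iff[of "\<rho>.lincomb_map v"] \<rho>_closed[OF v]
    by (simp add: a_kernel_def' residue_module_eq k.zero_quotient_module del: free_module_carrier)
  ultimately show ?thesis
    using \<rho>.lincomb_map_linear e(1) h(1) by (intro exI[of _ \<rho>.lincomb_map] exI[of _ e]) simp
qed

end

text \<open>
  Here \<open>\<rho>\<close> lifts the augmentation to \<open>R\<close>, and \<open>e\<close> maps to \<open>1\<close> in the residue field.
\<close>

locale residue_resolution = local_noetherian_ring R \<mm> + M: module R M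
  for R :: "('a, 'c) ring_scheme" (structure) and \<mm> and M :: "('a, 'b) module" +
  fixes n d \<epsilon> \<rho> e
  assumes resolution: "free_resolution R (residue_module R) n d \<epsilon>"
    and \<rho>: "\<rho> \<in> lin_maps R (free_module R (n 0)) (regular_module R)"
    and e: "e \<in> carrier (free_module R (n 0))"
    and \<rho>_e: "\<rho> e \<ominus> \<one> \<in> \<mm>"
    and kernel_\<epsilon>: "\<And>v. v \<in> carrier (free_module R (n 0)) \<Longrightarrow>
      v \<in> a_kernel (free_module R (n 0)) (residue_module R) \<epsilon> \<longleftrightarrow> \<rho> v \<in> \<mm>"
begin

abbreviation "F i \<equiv> free_module R (n i)"

lemma d_linear: "d i \<in> lin_maps R (F (Suc i)) (F i)"
  using resolution by (simp add: free_resolution_def)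

lemma image_d0: "v \<in> carrier (F 0) \<Longrightarrow> (\<exists>w\<in>carrier (F 1). v = d 0 w) \<longleftrightarrow> \<rho> v \<in> \<mm>"
  using resolution kernel_\<epsilon>[of v] unfolding free_resolution_def by blast

lemma \<rho>_d0: "w \<in> carrier (F 1) \<Longrightarrow> \<rho> (d 0 w) \<in> \<mm>"
  using image_d0[of "d 0 w"] lin_maps_closed[OF d_linear[of 0], of w] by (metis One_nat_def)

lemma d_comp_d: "u \<in> carrier (F (Suc (Suc i))) \<Longrightarrow> d i (d (Suc i) u) = \<zero>\<^bsub>F i\<^esub>"
  using resolution unfolding free_resolution_def a_kernel_def' by blast

lemma exact_1:
  assumes "w \<in> carrier (F 1)" "d 0 w = \<zero>\<^bsub>F 0\<^esub>"
  shows "\<exists>u\<in>carrier (F 2). w = d 1 u"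
proof -
  have "d (Suc 0) ` carrier (F (Suc (Suc 0))) = a_kernel (F (Suc 0)) (F 0) (d 0)"
    using resolution unfolding free_resolution_def by blast
  moreover have "w \<in> a_kernel (F (Suc 0)) (F 0) (d 0)"
    using assms by (simp add: a_kernel_def')
  ultimately show ?thesis
    unfolding One_nat_def numeral_2_eq_2 by blast
qed

lemma \<rho>_closed: "v \<in> carrier (F 0) \<Longrightarrow> \<rho> v \<in> carrier R"
  using lin_maps_closed[OF \<rho>] by simp

lemma \<rho>_add: "u \<in> carrier (F 0) \<Longrightarrow> v \<in> carrier (F 0) \<Longrightarrow> \<rho> (u \<oplus>\<^bsub>F 0\<^esub> v) = \<rho> u \<oplus> \<rho> v"
  using lin_maps_add[OF \<rho>] by simp

lemma \<rho>_smult: "a \<in> carrier R \<Longrightarrow> v \<in> carrier (F 0) \<Longrightarrow> \<rho> (a \<odot>\<^bsub>F 0\<^esub> v) = a \<otimes> \<rho> v"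
  using lin_maps_smult[OF \<rho>] by simp

lemma smult_e_in_image:
  assumes "b \<in> \<mm>" "v \<in> carrier (F 0)"
  shows "\<exists>w\<in>carrier (F 1). b \<odot>\<^bsub>F 0\<^esub> v = d 0 w"
proof -
  interpret F0: module R "F 0" by (rule module_free)
  have b: "b \<in> carrier R" using assms(1) by (rule \<mm>.Icarr)
  show ?thesis
    using image_d0[of "b \<odot>\<^bsub>F 0\<^esub> v"] assms b \<rho>_smult[of b v] \<rho>_closed[of v] \<mm>.I_r_closed
    by (simp del: free_module_carrier)
qed

text \<open>
  \<open>\<rho>(v - \<rho>(v) e) = - \<rho>(v) (\<rho>(e) - 1)\<close> lies in \<open>\<mm>\<close>.
\<close>

lemma decompose:
  assumes v: "v \<in> carrier (F 0)"
  shows "\<exists>w\<in>carrier (F 1). v = \<rho> v \<odot>\<^bsub>F 0\<^esub> e \<oplus>\<^bsub>F 0\<^esub> d 0 w"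
proof -
  interpret F0: module R "F 0" by (rule module_free)
  let ?u = "(\<ominus> \<rho> v) \<odot>\<^bsub>F 0\<^esub> e"
  have r: "\<rho> v \<in> carrier R" "\<rho> e \<in> carrier R" using v e \<rho>_closed by auto
  have u: "?u \<in> carrier (F 0)" using r e by blast
  have "\<rho> (?u \<oplus>\<^bsub>F 0\<^esub> v) = (\<ominus> \<rho> v) \<otimes> (\<rho> e \<ominus> \<one>)"
    using r \<rho>_add[OF u v] \<rho>_smult[OF _ e, of "\<ominus> \<rho> v"] by simp algebra
  also have "\<dots> \<in> \<mm>"
    using \<mm>.I_l_closed[OF \<rho>_e, of "\<ominus> \<rho> v"] r by simp
  finally obtain w where w: "w \<in> carrier (F 1)" "?u \<oplus>\<^bsub>F 0\<^esub> v = d 0 w"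
    using image_d0[of "?u \<oplus>\<^bsub>F 0\<^esub> v"] u v by blast
  have "\<rho> v \<odot>\<^bsub>F 0\<^esub> e \<oplus>\<^bsub>F 0\<^esub> d 0 w = v"
    unfolding w(2)[symmetric] F0.smult_l_minus[OF r(1) e]
    using F0.smult_closed[OF r(1) e] v by (simp add: F0.M.r_neg1 F0.M.r_neg2 del: free_module_carrier)
  then show ?thesis using w(1) by (intro bexI[of _ w]) simp_all
qed

abbreviation "X i \<equiv> (Hom_module R (F i) M)\<lparr>carrier := cocycles R n d M i\<rparr>"

lemma module_X: "module R (X i)"
  using is_cring M.module_axioms d_linear by (rule module_cocycles)

lemma add_X: "f \<oplus>\<^bsub>X i\<^esub> g = (\<lambda>x\<in>carrier (F i). f x \<oplus>\<^bsub>M\<^esub> g x)"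
  and smult_X: "a \<odot>\<^bsub>X i\<^esub> f = (\<lambda>x\<in>carrier (F i). a \<odot>\<^bsub>M\<^esub> f x)"
  by (simp_all add: Hom_module_def)

lemma add_smult_residue:
  assumes x: "x \<in> carrier M" "\<And>b. b \<in> \<mm> \<Longrightarrow> b \<odot>\<^bsub>M\<^esub> x \<in> K"
  shows "\<exists>k\<in>K. \<rho> e \<odot>\<^bsub>M\<^esub> x = x \<oplus>\<^bsub>M\<^esub> k"
proof -
  have r: "\<rho> e \<in> carrier R" by (rule \<rho>_closed[OF e])
  then have "\<rho> e = \<one> \<oplus> (\<rho> e \<ominus> \<one>)" by algebra
  then have "\<rho> e \<odot>\<^bsub>M\<^esub> x = x \<oplus>\<^bsub>M\<^esub> (\<rho> e \<ominus> \<one>) \<odot>\<^bsub>M\<^esub> x"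
    using M.smult_l_distr[of \<one> "\<rho> e \<ominus> \<one>" x] x r by simp
  then show ?thesis using x(2)[OF \<rho>_e] by blast
qed

text \<open>
  A cocycle vanishes on the image of \<open>d 0\<close>, hence is determined by its value at \<open>e\<close>, which is killed
  by \<open>\<mm>\<close>.  Conversely \<open>x\<close> in the socle of \<open>M\<close> comes from \<open>v \<mapsto> \<rho>(v) x\<close>.
\<close>

lemma length_Ext_0:
  "module_length R (quotient_module (X 0) (coboundaries R n d M 0)) =
     chain_length (\<lambda>H. submodule H R M \<and> H \<subseteq> {x \<in> carrier M. \<forall>b\<in>\<mm>. b \<odot>\<^bsub>M\<^esub> x = \<zero>\<^bsub>M\<^esub>})"
proof -
  interpret F0: module R "F 0" by (rule module_free)
  interpret F1: module R "F (Suc 0)" by (rule module_free)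
  let ?L = "{x \<in> carrier M. \<forall>b\<in>\<mm>. b \<odot>\<^bsub>M\<^esub> x = \<zero>\<^bsub>M\<^esub>}"
  have cocycle: "f \<in> lin_maps R (F 0) M" "\<And>w. w \<in> carrier (F 1) \<Longrightarrow> f (d 0 w) = \<zero>\<^bsub>M\<^esub>"
    if "f \<in> carrier (X 0)" for f
    using that cocycles_iff[of f R n d M 0] by (simp_all del: free_module_carrier)
  have K: "submodule {\<zero>\<^bsub>M\<^esub>} R M"
    by (rule M.submoduleI') simp_all
  have L: "submodule ?L R M"
  proof (rule M.submoduleI')
    fix a x assume a: "a \<in> carrier R" and x: "x \<in> ?L"
    have "b \<odot>\<^bsub>M\<^esub> (a \<odot>\<^bsub>M\<^esub> x) = \<zero>\<^bsub>M\<^esub>" if b: "b \<in> \<mm>" for b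
    proof -
      have "b \<odot>\<^bsub>M\<^esub> (a \<odot>\<^bsub>M\<^esub> x) = a \<odot>\<^bsub>M\<^esub> (b \<odot>\<^bsub>M\<^esub> x)"
        using a x \<mm>.Icarr[OF b] by (simp add: M.smult_assoc1[symmetric] m_comm)
      then show ?thesis using x b a by simp
    qed
    then show "a \<odot>\<^bsub>M\<^esub> x \<in> ?L" using a x by simp
  qed (auto simp: M.smult_r_distr \<mm>.Icarr)
  have "module_length R (quotient_module (X 0) (coboundaries R n d M 0)) =
    chain_length (\<lambda>H. submodule H R M \<and> {\<zero>\<^bsub>M\<^esub>} \<subseteq> H \<and> H \<subseteq> ?L)"
  proof (rule module_length_quotient_eq[OF module_X M.module_axioms K L, where \<Phi> = "\<lambda>f. f e"])
    fix f assume f: "f \<in> carrier (X 0)"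
    have "b \<odot>\<^bsub>M\<^esub> f e = \<zero>\<^bsub>M\<^esub>" if b: "b \<in> \<mm>" for b
    proof -
      obtain w where w: "w \<in> carrier (F 1)" "b \<odot>\<^bsub>F 0\<^esub> e = d 0 w"
        using smult_e_in_image[OF b e] by blast
      then show ?thesis
        using lin_maps_smult[OF cocycle(1)[OF f] \<mm>.Icarr[OF b] e] cocycle(2)[OF f w(1)] by simp
    qed
    then show "f e \<in> ?L"
      using lin_maps_closed[OF cocycle(1)[OF f] e] by simp
  next
    fix f g assume "f \<in> carrier (X 0)" "g \<in> carrier (X 0)"
    show "(f \<oplus>\<^bsub>X 0\<^esub> g) e = f e \<oplus>\<^bsub>M\<^esub> g e" using e unfolding add_X by (simp del: free_module_carrier)
  next
    fix a f assume "a \<in> carrier R" "f \<in> carrier (X 0)"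
    show "(a \<odot>\<^bsub>X 0\<^esub> f) e = a \<odot>\<^bsub>M\<^esub> f e" using e unfolding smult_X by (simp del: free_module_carrier)
  next
    let ?z = "\<lambda>x\<in>carrier (F 0). \<zero>\<^bsub>M\<^esub>"
    have cob0: "coboundaries R n d M 0 = {?z}" by (simp add: Hom_module_def)
    have "?z \<in> lin_maps R (F 0) M"
      by (intro lin_mapsI F0.M.a_closed F0.smult_closed) simp_all
    then have "?z \<in> carrier (X 0)"
      using lin_maps_closed[OF d_linear[of 0]]
      by (simp add: cocycles_iff del: free_module_carrier)
    moreover have "?z e = \<zero>\<^bsub>M\<^esub>" using e by simp
    moreover have "f = ?z" if f: "f \<in> carrier (X 0)" "f e = \<zero>\<^bsub>M\<^esub>" for f
    proof (rule lin_maps_ext[OF cocycle(1)[OF f(1)] \<open>?z \<in> lin_maps R (F 0) M\<close>])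
      fix v assume v: "v \<in> carrier (F 0)"
      obtain w where w: "w \<in> carrier (F 1)" "v = \<rho> v \<odot>\<^bsub>F 0\<^esub> e \<oplus>\<^bsub>F 0\<^esub> d 0 w"
        using decompose[OF v] by blast
      have dw: "d 0 w \<in> carrier (F 0)" using lin_maps_closed[OF d_linear[of 0]] w(1) by simp
      have re: "\<rho> v \<odot>\<^bsub>F 0\<^esub> e \<in> carrier (F 0)" using \<rho>_closed[OF v] e by blast
      have "f v = \<rho> v \<odot>\<^bsub>M\<^esub> f e \<oplus>\<^bsub>M\<^esub> f (d 0 w)"
        by (subst w(2)) (simp add: lin_maps_add[OF cocycle(1)[OF f(1)] re dw]
            lin_maps_smult[OF cocycle(1)[OF f(1)] \<rho>_closed[OF v] e] del: free_module_carrier)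
      then show "f v = ?z v"
        using f(2) cocycle(2)[OF f(1) w(1)] \<rho>_closed[OF v] v by (simp del: free_module_carrier)
    qed
    ultimately show "coboundaries R n d M 0 = {f \<in> carrier (X 0). f e \<in> {\<zero>\<^bsub>M\<^esub>}}"
      unfolding cob0 by blast
  next
    fix x assume x: "x \<in> ?L"
    let ?f = "\<lambda>v\<in>carrier (F 0). \<rho> v \<odot>\<^bsub>M\<^esub> x"
    have "?f \<in> lin_maps R (F 0) M"
      by (intro lin_mapsI F0.M.a_closed F0.smult_closed)
         (use x \<rho>_closed in \<open>simp_all add: \<rho>_add \<rho>_smult M.smult_l_distr M.smult_assoc1 del: free_module_carrier\<close>)
    moreover have "?f (d 0 w) = \<zero>\<^bsub>M\<^esub>" if w: "w \<in> carrier (F 1)" for w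
      using \<rho>_d0[OF w] x lin_maps_closed[OF d_linear[of 0]] w by (simp del: free_module_carrier)
    ultimately have "?f \<in> carrier (X 0)"
      by (simp add: cocycles_iff del: free_module_carrier)
    moreover obtain k where "k \<in> {\<zero>\<^bsub>M\<^esub>}" "\<rho> e \<odot>\<^bsub>M\<^esub> x = x \<oplus>\<^bsub>M\<^esub> k"
      using add_smult_residue[of x "{\<zero>\<^bsub>M\<^esub>}"] x by auto
    then have "x = ?f e \<oplus>\<^bsub>M\<^esub> \<zero>\<^bsub>M\<^esub>" using e x by (simp del: free_module_carrier)
    ultimately show "\<exists>f\<in>carrier (X 0). \<exists>k\<in>{\<zero>\<^bsub>M\<^esub>}. x = f e \<oplus>\<^bsub>M\<^esub> k" by blast
  qed simp
  also have "\<dots> = chain_length (\<lambda>H. submodule H R M \<and> H \<subseteq> ?L)"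
    using M.submodule_zero by (intro arg_cong[where f = chain_length]) auto
  finally show ?thesis .
qed

text \<open>
  A cocycle \<open>f\<close> amounts to a linear map on the image \<open>Z\<close> of \<open>d 0\<close>, and \<open>Z\<close> contains \<open>a F 0\<close>.  So \<open>f\<close> defines
  \<open>g : F 0 \<rightarrow> M\<close>, \<open>g(v) = f(av)\<close>, and \<open>f\<close> is a coboundary iff \<open>g\<close> is divisible by \<open>a\<close>.  As \<open>g\<close> maps \<open>Z\<close> into
  \<open>aM\<close>, this only depends on \<open>g(e) = f(w)\<close>, where \<open>d 0 w = a e\<close>.  For the same reason \<open>\<mm> g(e) \<subseteq> aM\<close>, and
  every \<open>x\<close> with \<open>\<mm> x \<subseteq> aM\<close> arises from \<open>g(v) = \<rho>(v) x\<close>.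
\<close>

lemma length_Ext_1:
  assumes a: "a \<in> \<mm>" and regular: "\<And>x. x \<in> carrier M \<Longrightarrow> a \<odot>\<^bsub>M\<^esub> x = \<zero>\<^bsub>M\<^esub> \<Longrightarrow> x = \<zero>\<^bsub>M\<^esub>"
  shows "module_length R (quotient_module (X 1) (coboundaries R n d M 1)) =
     chain_length (\<lambda>H. submodule H R M \<and> (\<lambda>x. a \<odot>\<^bsub>M\<^esub> x) ` carrier M \<subseteq> H \<and>
       H \<subseteq> {x \<in> carrier M. \<forall>b\<in>\<mm>. b \<odot>\<^bsub>M\<^esub> x \<in> (\<lambda>x. a \<odot>\<^bsub>M\<^esub> x) ` carrier M})"
proof -
  interpret F0: module R "F 0" by (rule module_free)
  interpret F1: module R "F 1" by (rule module_free)
  interpret F2: module R "F 2" by (rule module_free)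
  let ?K = "(\<lambda>x. a \<odot>\<^bsub>M\<^esub> x) ` carrier M"
  let ?L = "{x \<in> carrier M. \<forall>b\<in>\<mm>. b \<odot>\<^bsub>M\<^esub> x \<in> ?K}"
  have aR: "a \<in> carrier R" using a by (rule \<mm>.Icarr)
  have swap: "b \<odot>\<^bsub>M\<^esub> (c \<odot>\<^bsub>M\<^esub> x) = c \<odot>\<^bsub>M\<^esub> (b \<odot>\<^bsub>M\<^esub> x)"
    if "b \<in> carrier R" "c \<in> carrier R" "x \<in> carrier M" for b c x
    using that by (simp add: M.smult_assoc1[symmetric] m_comm)
  have cancel: "x = y" if xy: "x \<in> carrier M" "y \<in> carrier M" "a \<odot>\<^bsub>M\<^esub> x = a \<odot>\<^bsub>M\<^esub> y" for x y
  proof -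
    have "a \<odot>\<^bsub>M\<^esub> (x \<ominus>\<^bsub>M\<^esub> y) = \<zero>\<^bsub>M\<^esub>"
      using xy aR by (simp add: M.M.minus_eq M.smult_r_distr M.smult_r_minus M.M.r_neg)
    then have "x \<ominus>\<^bsub>M\<^esub> y = \<zero>\<^bsub>M\<^esub>" using regular xy by simp
    then show "x = y" using xy M.M.add.inv_equality M.M.minus_eq
      by (metis M.M.a_inv_closed M.M.minus_minus M.M.minus_equality)
  qed
  have d0: "d 0 \<in> lin_maps R (F 1) (F 0)" and d1: "d 1 \<in> lin_maps R (F 2) (F 1)"
    using d_linear[of 0] d_linear[of 1] by (simp_all add: numeral_2_eq_2)
  note d0_closed = lin_maps_closed[OF d0]
  have cocycle: "f \<in> carrier (X 1) \<longleftrightarrow> f \<in> lin_maps R (F 1) M \<and> (\<forall>u\<in>carrier (F 2). f (d 1 u) = \<zero>\<^bsub>M\<^esub>)" for f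
    using cocycles_iff[of f R n d M 1] by (simp add: numeral_2_eq_2 del: free_module_carrier)
  have cocycle_lin: "f \<in> lin_maps R (F 1) M" if "f \<in> carrier (X 1)" for f
    using that cocycle by blast
  have cocycle_eq: "f u = f u'"
    if f: "f \<in> carrier (X 1)" and u: "u \<in> carrier (F 1)" "u' \<in> carrier (F 1)" "d 0 u = d 0 u'" for f u u'
  proof -
    have "d 0 (u \<ominus>\<^bsub>F 1\<^esub> u') = \<zero>\<^bsub>F 0\<^esub>"
      using lin_maps_minus[OF F1.module_axioms F0.module_axioms d0 u(1,2)] u d0_closed
      by (simp add: F0.M.minus_eq F0.M.r_neg del: free_module_carrier One_nat_def)
    moreover have uu: "u \<ominus>\<^bsub>F 1\<^esub> u' \<in> carrier (F 1)" using u by blast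
    ultimately obtain t where "t \<in> carrier (F 2)" "u \<ominus>\<^bsub>F 1\<^esub> u' = d 1 t"
      using exact_1 by blast
    then have "f (u \<ominus>\<^bsub>F 1\<^esub> u') = \<zero>\<^bsub>M\<^esub>" using f cocycle by simp
    moreover have "u = (u \<ominus>\<^bsub>F 1\<^esub> u') \<oplus>\<^bsub>F 1\<^esub> u'"
      using F1.minus_add_cancel[OF u(1,2)] by (rule sym)
    ultimately show ?thesis
      using lin_maps_add[OF cocycle_lin[OF f] uu u(2)] lin_maps_closed[OF cocycle_lin[OF f] u(2)] by simp
  qed
  \<comment> \<open>The isomorphism with \<open>(aM : \<mm>)/aM\<close> will be \<open>f \<mapsto> f w\<close>.\<close>
  obtain w where w: "w \<in> carrier (F 1)" "a \<odot>\<^bsub>F 0\<^esub> e = d 0 w"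
    using smult_e_in_image[OF a e] by blast
  have K: "submodule ?K R M"
  proof (rule M.submoduleI')
    show "\<zero>\<^bsub>M\<^esub> \<in> ?K" using aR by (auto intro!: image_eqI[of _ _ "\<zero>\<^bsub>M\<^esub>"])
  next
    fix x y assume "x \<in> ?K" "y \<in> ?K"
    then obtain x' y' where "x' \<in> carrier M" "y' \<in> carrier M" "x = a \<odot>\<^bsub>M\<^esub> x'" "y = a \<odot>\<^bsub>M\<^esub> y'" by blast
    then show "x \<oplus>\<^bsub>M\<^esub> y \<in> ?K" using aR by (intro image_eqI[of _ _ "x' \<oplus>\<^bsub>M\<^esub> y'"]) (simp_all add: M.smult_r_distr)
  next
    fix b x assume "b \<in> carrier R" "x \<in> ?K"
    then obtain x' where "b \<in> carrier R" "x' \<in> carrier M" "x = a \<odot>\<^bsub>M\<^esub> x'" by blast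
    then show "b \<odot>\<^bsub>M\<^esub> x \<in> ?K" using aR by (intro image_eqI[of _ _ "b \<odot>\<^bsub>M\<^esub> x'"]) (simp_all add: swap)
  qed (use aR in auto)
  note KE = M.submoduleE[OF K]
  have L: "submodule ?L R M"
  proof (rule M.submoduleI')
    show "\<zero>\<^bsub>M\<^esub> \<in> ?L" using M.submodule_zero[OF K] \<mm>.Icarr by simp
  next
    fix x y assume "x \<in> ?L" "y \<in> ?L"
    then show "x \<oplus>\<^bsub>M\<^esub> y \<in> ?L" using KE(5) \<mm>.Icarr by (simp add: M.smult_r_distr)
  next
    fix b x assume b: "b \<in> carrier R" "x \<in> ?L"
    then have "c \<odot>\<^bsub>M\<^esub> (b \<odot>\<^bsub>M\<^esub> x) \<in> ?K" if "c \<in> \<mm>" for c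
      using that KE(4)[of b "c \<odot>\<^bsub>M\<^esub> x"] \<mm>.Icarr[OF that] by (simp add: swap[of c b x])
    then show "b \<odot>\<^bsub>M\<^esub> x \<in> ?L" using b by simp
  qed auto
  have KL: "?K \<subseteq> ?L"
  proof
    fix x assume x: "x \<in> ?K"
    then show "x \<in> ?L" using KE(1) KE(4)[OF _ x] \<mm>.Icarr by blast
  qed
  show ?thesis
  proof (rule module_length_quotient_eq[OF module_X M.module_axioms K L KL, where \<Phi> = "\<lambda>f. f w"])
    fix f assume f: "f \<in> carrier (X 1)"
    note lin = cocycle_lin[OF f]
    have "b \<odot>\<^bsub>M\<^esub> f w \<in> ?K" if b: "b \<in> \<mm>" for b
    proof -
      have bR: "b \<in> carrier R" using b by (rule \<mm>.Icarr)
      obtain u where u: "u \<in> carrier (F 1)" "b \<odot>\<^bsub>F 0\<^esub> e = d 0 u"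
        using smult_e_in_image[OF b e] by blast
      have "d 0 (b \<odot>\<^bsub>F 1\<^esub> w) = (b \<otimes> a) \<odot>\<^bsub>F 0\<^esub> e"
        using lin_maps_smult[OF d0 bR w(1)] w(2) F0.smult_assoc1[OF bR aR e] by simp
      also have "\<dots> = (a \<otimes> b) \<odot>\<^bsub>F 0\<^esub> e"
        using m_comm[OF aR bR] by simp
      also have "\<dots> = d 0 (a \<odot>\<^bsub>F 1\<^esub> u)"
        using lin_maps_smult[OF d0 aR u(1)] u(2) F0.smult_assoc1[OF aR bR e] by simp
      finally have "f (b \<odot>\<^bsub>F 1\<^esub> w) = f (a \<odot>\<^bsub>F 1\<^esub> u)"
        using cocycle_eq[OF f] F1.smult_closed[OF bR w(1)] F1.smult_closed[OF aR u(1)] by blast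
      then have "b \<odot>\<^bsub>M\<^esub> f w = a \<odot>\<^bsub>M\<^esub> f u"
        using lin_maps_smult[OF lin bR w(1)] lin_maps_smult[OF lin aR u(1)] by simp
      then show ?thesis using lin_maps_closed[OF lin u(1)] by blast
    qed
    then show "f w \<in> ?L" using lin_maps_closed[OF lin w(1)] by blast
  next
    fix f g assume "f \<in> carrier (X 1)" "g \<in> carrier (X 1)"
    show "(f \<oplus>\<^bsub>X 1\<^esub> g) w = f w \<oplus>\<^bsub>M\<^esub> g w" using w(1) unfolding add_X by (simp del: free_module_carrier One_nat_def)
  next
    fix b f assume "b \<in> carrier R" "f \<in> carrier (X 1)"
    show "(b \<odot>\<^bsub>X 1\<^esub> f) w = b \<odot>\<^bsub>M\<^esub> f w" using w(1) unfolding smult_X by (simp del: free_module_carrier One_nat_def)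
  next
    have cob: "coboundaries R n d M 1 = (\<lambda>f. compose (carrier (F 1)) f (d 0)) ` lin_maps R (F 0) M"
      by (simp add: One_nat_def del: free_module_carrier)
    show "coboundaries R n d M 1 = {f \<in> carrier (X 1). f w \<in> ?K}"
    proof (intro equalityI subsetI CollectI conjI)
      fix f assume "f \<in> coboundaries R n d M 1"
      \<comment> \<open>\<open>h\<close> is \<open>g\<close> divided by \<open>a\<close>.\<close>
      then obtain h where h: "h \<in> lin_maps R (F 0) M" "f = compose (carrier (F 1)) h (d 0)"
        unfolding cob by blast
      have f_eq: "f u = h (d 0 u)" if "u \<in> carrier (F 1)" for u
        using that h(2) by (simp add: compose_eq del: free_module_carrier One_nat_def)
      have "(\<lambda>u\<in>carrier (F 1). h (d 0 u)) \<in> lin_maps R (F 1) M"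
        by (intro lin_mapsI F1.M.a_closed F1.smult_closed)
           (simp_all add: lin_maps_closed[OF h(1)] d0_closed lin_maps_add[OF d0] lin_maps_smult[OF d0]
              lin_maps_add[OF h(1)] lin_maps_smult[OF h(1)] del: free_module_carrier One_nat_def)
      then have "f \<in> lin_maps R (F 1) M" using h(2) by (simp add: compose_def)
      moreover have "f (d 1 u) = \<zero>\<^bsub>M\<^esub>" if u: "u \<in> carrier (F 2)" for u
      proof -
        have "d 0 (d 1 u) = \<zero>\<^bsub>F 0\<^esub>"
          using d_comp_d[of u 0] u by (simp add: numeral_2_eq_2 del: free_module_carrier)
        then show ?thesis
          using f_eq[OF lin_maps_closed[OF d1 u]] lin_maps_zero[OF F0.module_axioms M.module_axioms h(1)] by simp
      qed
      ultimately show "f \<in> carrier (X 1)" using cocycle by blast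
      have "f w = a \<odot>\<^bsub>M\<^esub> h e"
        using f_eq[OF w(1)] w(2) lin_maps_smult[OF h(1) aR e] by simp
      then show "f w \<in> ?K" using lin_maps_closed[OF h(1) e] by blast
    next
      fix f assume "f \<in> {f \<in> carrier (X 1). f w \<in> ?K}"
      then have f: "f \<in> carrier (X 1)" and fw: "f w \<in> ?K" by auto
      note lin = cocycle_lin[OF f]
      have "\<exists>x. x \<in> carrier M \<and> (\<forall>u\<in>carrier (F 1). d 0 u = a \<odot>\<^bsub>F 0\<^esub> v \<longrightarrow> a \<odot>\<^bsub>M\<^esub> x = f u)"
        if v: "v \<in> carrier (F 0)" for v
      proof -
        obtain y where y: "y \<in> carrier (F 1)" "v = \<rho> v \<odot>\<^bsub>F 0\<^esub> e \<oplus>\<^bsub>F 0\<^esub> d 0 y"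
          using decompose[OF v] by blast
        obtain x0 where x0: "x0 \<in> carrier M" "f w = a \<odot>\<^bsub>M\<^esub> x0" using fw by blast
        have r: "\<rho> v \<in> carrier R" by (rule \<rho>_closed[OF v])
        let ?s = "\<rho> v \<odot>\<^bsub>F 1\<^esub> w" and ?t = "a \<odot>\<^bsub>F 1\<^esub> y"
        have st: "?s \<in> carrier (F 1)" "?t \<in> carrier (F 1)"
          using F1.smult_closed r w(1) aR y(1) by blast+
        have "d 0 (?s \<oplus>\<^bsub>F 1\<^esub> ?t) = \<rho> v \<odot>\<^bsub>F 0\<^esub> (a \<odot>\<^bsub>F 0\<^esub> e) \<oplus>\<^bsub>F 0\<^esub> a \<odot>\<^bsub>F 0\<^esub> d 0 y"
          using lin_maps_add[OF d0 st] lin_maps_smult[OF d0 r w(1)] lin_maps_smult[OF d0 aR y(1)] w(2) by simp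
        also have "\<rho> v \<odot>\<^bsub>F 0\<^esub> (a \<odot>\<^bsub>F 0\<^esub> e) = a \<odot>\<^bsub>F 0\<^esub> (\<rho> v \<odot>\<^bsub>F 0\<^esub> e)"
          using F0.smult_assoc1[OF r aR e] F0.smult_assoc1[OF aR r e] m_comm[OF r aR] by simp
        also have "a \<odot>\<^bsub>F 0\<^esub> (\<rho> v \<odot>\<^bsub>F 0\<^esub> e) \<oplus>\<^bsub>F 0\<^esub> a \<odot>\<^bsub>F 0\<^esub> d 0 y = a \<odot>\<^bsub>F 0\<^esub> v"
          using F0.smult_r_distr[OF aR F0.smult_closed[OF r e] d0_closed[OF y(1)]] y(2) by simp
        finally have d_st: "d 0 (?s \<oplus>\<^bsub>F 1\<^esub> ?t) = a \<odot>\<^bsub>F 0\<^esub> v" .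
        have fy: "f y \<in> carrier M" using lin_maps_closed[OF lin y(1)] .
        let ?x = "\<rho> v \<odot>\<^bsub>M\<^esub> x0 \<oplus>\<^bsub>M\<^esub> f y"
        have "f (?s \<oplus>\<^bsub>F 1\<^esub> ?t) = \<rho> v \<odot>\<^bsub>M\<^esub> (a \<odot>\<^bsub>M\<^esub> x0) \<oplus>\<^bsub>M\<^esub> a \<odot>\<^bsub>M\<^esub> f y"
          using lin_maps_add[OF lin st] lin_maps_smult[OF lin r w(1)] lin_maps_smult[OF lin aR y(1)] x0(2) by simp
        also have "\<dots> = a \<odot>\<^bsub>M\<^esub> ?x"
          using swap[OF r aR x0(1)] M.smult_r_distr[OF aR _ fy, of "\<rho> v \<odot>\<^bsub>M\<^esub> x0"] r x0(1) by simp
        finally have "f (?s \<oplus>\<^bsub>F 1\<^esub> ?t) = a \<odot>\<^bsub>M\<^esub> ?x" .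
        then have "a \<odot>\<^bsub>M\<^esub> ?x = f u" if "u \<in> carrier (F 1)" "d 0 u = a \<odot>\<^bsub>F 0\<^esub> v" for u
          using cocycle_eq[OF f that(1) F1.M.a_closed[OF st]] that(2) d_st by simp
        moreover have "?x \<in> carrier M" using r x0(1) fy by simp
        ultimately show ?thesis by blast
      qed
      then have "\<forall>v. \<exists>x. v \<in> carrier (F 0) \<longrightarrow>
        x \<in> carrier M \<and> (\<forall>u\<in>carrier (F 1). d 0 u = a \<odot>\<^bsub>F 0\<^esub> v \<longrightarrow> a \<odot>\<^bsub>M\<^esub> x = f u)" by blast
      then obtain h where h: "\<And>v. v \<in> carrier (F 0) \<Longrightarrow> h v \<in> carrier M"
        "\<And>v u. v \<in> carrier (F 0) \<Longrightarrow> u \<in> carrier (F 1) \<Longrightarrow> d 0 u = a \<odot>\<^bsub>F 0\<^esub> v \<Longrightarrow> a \<odot>\<^bsub>M\<^esub> h v = f u"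
        by metis
      have h_lin: "restrict h (carrier (F 0)) \<in> lin_maps R (F 0) M"
      proof (intro lin_mapsI F0.M.a_closed F0.smult_closed h(1))
        fix u v assume uv: "u \<in> carrier (F 0)" "v \<in> carrier (F 0)"
        obtain u' v' where *: "u' \<in> carrier (F 1)" "a \<odot>\<^bsub>F 0\<^esub> u = d 0 u'" "v' \<in> carrier (F 1)" "a \<odot>\<^bsub>F 0\<^esub> v = d 0 v'"
          using smult_e_in_image[OF a uv(1)] smult_e_in_image[OF a uv(2)] by blast
        have "d 0 (u' \<oplus>\<^bsub>F 1\<^esub> v') = a \<odot>\<^bsub>F 0\<^esub> (u \<oplus>\<^bsub>F 0\<^esub> v)"
          using lin_maps_add[OF d0 *(1,3)] F0.smult_r_distr[OF aR uv] *(2,4) by simp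
        then have "a \<odot>\<^bsub>M\<^esub> h (u \<oplus>\<^bsub>F 0\<^esub> v) = f (u' \<oplus>\<^bsub>F 1\<^esub> v')"
          using h(2)[OF F0.M.a_closed[OF uv] F1.M.a_closed[OF *(1,3)]] by blast
        also have "\<dots> = a \<odot>\<^bsub>M\<^esub> h u \<oplus>\<^bsub>M\<^esub> a \<odot>\<^bsub>M\<^esub> h v"
          using lin_maps_add[OF lin *(1,3)] h(2)[OF uv(1) *(1)] h(2)[OF uv(2) *(3)] *(2,4) by simp
        also have "\<dots> = a \<odot>\<^bsub>M\<^esub> (h u \<oplus>\<^bsub>M\<^esub> h v)"
          using M.smult_r_distr[OF aR h(1)[OF uv(1)] h(1)[OF uv(2)]] by simp
        finally show "h (u \<oplus>\<^bsub>F 0\<^esub> v) = h u \<oplus>\<^bsub>M\<^esub> h v"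
          by (rule cancel[OF h(1)[OF F0.M.a_closed[OF uv]] M.M.a_closed[OF h(1)[OF uv(1)] h(1)[OF uv(2)]]])
      next
        fix b u assume b: "b \<in> carrier R" and u: "u \<in> carrier (F 0)"
        obtain u' where *: "u' \<in> carrier (F 1)" "a \<odot>\<^bsub>F 0\<^esub> u = d 0 u'"
          using smult_e_in_image[OF a u] by blast
        have "d 0 (b \<odot>\<^bsub>F 1\<^esub> u') = a \<odot>\<^bsub>F 0\<^esub> (b \<odot>\<^bsub>F 0\<^esub> u)"
          using lin_maps_smult[OF d0 b *(1)] *(2) F0.smult_assoc1[OF b aR u] F0.smult_assoc1[OF aR b u] m_comm[OF b aR] by simp
        then have "a \<odot>\<^bsub>M\<^esub> h (b \<odot>\<^bsub>F 0\<^esub> u) = f (b \<odot>\<^bsub>F 1\<^esub> u')"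
          using h(2)[OF F0.smult_closed[OF b u] F1.smult_closed[OF b *(1)]] by blast
        also have "\<dots> = b \<odot>\<^bsub>M\<^esub> (a \<odot>\<^bsub>M\<^esub> h u)"
          using lin_maps_smult[OF lin b *(1)] h(2)[OF u *(1)] *(2) by simp
        also have "\<dots> = a \<odot>\<^bsub>M\<^esub> (b \<odot>\<^bsub>M\<^esub> h u)" by (rule swap[OF b aR h(1)[OF u]])
        finally show "h (b \<odot>\<^bsub>F 0\<^esub> u) = b \<odot>\<^bsub>M\<^esub> h u"
          by (rule cancel[OF h(1)[OF F0.smult_closed[OF b u]] M.smult_closed[OF b h(1)[OF u]]])
      qed
      have fh: "f u = h (d 0 u)" if u: "u \<in> carrier (F 1)" for u
      proof -
        have "a \<odot>\<^bsub>M\<^esub> h (d 0 u) = f (a \<odot>\<^bsub>F 1\<^esub> u)"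
          using h(2)[OF d0_closed[OF u] F1.smult_closed[OF aR u]] lin_maps_smult[OF d0 aR u] by blast
        also have "\<dots> = a \<odot>\<^bsub>M\<^esub> f u" using lin_maps_smult[OF lin aR u] by simp
        finally show ?thesis
          using cancel[of "h (d 0 u)" "f u"] h(1)[OF d0_closed[OF u]] lin_maps_closed[OF lin u] by simp
      qed
      have "f = compose (carrier (F 1)) (restrict h (carrier (F 0))) (d 0)"
      proof
        fix u
        show "f u = compose (carrier (F 1)) (restrict h (carrier (F 0))) (d 0) u"
        proof (cases "u \<in> carrier (F 1)")
          case True
          then show ?thesis
            using fh[OF True] d0_closed[OF True] by (simp add: compose_def del: free_module_carrier One_nat_def)
        next
          case False
          then have "f u = undefined"
            using lin by (intro PiE_arb[of f "carrier (F 1)" "\<lambda>_. carrier M"]) (simp_all add: lin_maps_def)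
          then show ?thesis using False by (simp add: compose_def del: free_module_carrier One_nat_def)
        qed
      qed
      then show "f \<in> coboundaries R n d M 1" unfolding cob using h_lin by blast
    qed
  next
    fix x assume x: "x \<in> ?L"
    have "\<exists>y. y \<in> carrier M \<and> a \<odot>\<^bsub>M\<^esub> y = \<rho> (d 0 u) \<odot>\<^bsub>M\<^esub> x" if u: "u \<in> carrier (F 1)" for u
      using \<rho>_d0[OF u] x by force
    then have "\<forall>u. \<exists>y. u \<in> carrier (F 1) \<longrightarrow> y \<in> carrier M \<and> a \<odot>\<^bsub>M\<^esub> y = \<rho> (d 0 u) \<odot>\<^bsub>M\<^esub> x" by blast
    then obtain g where g: "\<And>u. u \<in> carrier (F 1) \<Longrightarrow> g u \<in> carrier M"
      "\<And>u. u \<in> carrier (F 1) \<Longrightarrow> a \<odot>\<^bsub>M\<^esub> g u = \<rho> (d 0 u) \<odot>\<^bsub>M\<^esub> x" by metis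
    have xM: "x \<in> carrier M" using x by blast
    note r = \<rho>_closed[OF d0_closed]
    have g_lin: "restrict g (carrier (F 1)) \<in> lin_maps R (F 1) M"
    proof (intro lin_mapsI F1.M.a_closed F1.smult_closed g(1))
      fix u v assume uv: "u \<in> carrier (F 1)" "v \<in> carrier (F 1)"
      have "a \<odot>\<^bsub>M\<^esub> g (u \<oplus>\<^bsub>F 1\<^esub> v) = (\<rho> (d 0 u) \<oplus> \<rho> (d 0 v)) \<odot>\<^bsub>M\<^esub> x"
        using g(2)[OF F1.M.a_closed[OF uv]] lin_maps_add[OF d0 uv] \<rho>_add[OF d0_closed[OF uv(1)] d0_closed[OF uv(2)]] by simp
      also have "\<dots> = a \<odot>\<^bsub>M\<^esub> (g u \<oplus>\<^bsub>M\<^esub> g v)"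
        using M.smult_l_distr[OF r[OF uv(1)] r[OF uv(2)] xM] M.smult_r_distr[OF aR g(1)[OF uv(1)] g(1)[OF uv(2)]]
          g(2)[OF uv(1)] g(2)[OF uv(2)] by simp
      finally show "g (u \<oplus>\<^bsub>F 1\<^esub> v) = g u \<oplus>\<^bsub>M\<^esub> g v"
          by (rule cancel[OF g(1)[OF F1.M.a_closed[OF uv]] M.M.a_closed[OF g(1)[OF uv(1)] g(1)[OF uv(2)]]])
    next
      fix b u assume b: "b \<in> carrier R" and u: "u \<in> carrier (F 1)"
      have "a \<odot>\<^bsub>M\<^esub> g (b \<odot>\<^bsub>F 1\<^esub> u) = (b \<otimes> \<rho> (d 0 u)) \<odot>\<^bsub>M\<^esub> x"
        using g(2)[OF F1.smult_closed[OF b u]] lin_maps_smult[OF d0 b u] \<rho>_smult[OF b d0_closed[OF u]] by simp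
      also have "\<dots> = a \<odot>\<^bsub>M\<^esub> (b \<odot>\<^bsub>M\<^esub> g u)"
        using M.smult_assoc1[OF b r[OF u] xM] g(2)[OF u] swap[OF b aR g(1)[OF u]] by simp
      finally show "g (b \<odot>\<^bsub>F 1\<^esub> u) = b \<odot>\<^bsub>M\<^esub> g u"
        by (rule cancel[OF g(1)[OF F1.smult_closed[OF b u]] M.smult_closed[OF b g(1)[OF u]]])
    qed
    have "g (d 1 u) = \<zero>\<^bsub>M\<^esub>" if u: "u \<in> carrier (F 2)" for u
    proof -
      have "d 0 (d 1 u) = \<zero>\<^bsub>F 0\<^esub>"
        using d_comp_d[of u 0] u by (simp add: numeral_2_eq_2 del: free_module_carrier)
      then have "a \<odot>\<^bsub>M\<^esub> g (d 1 u) = \<zero>\<^bsub>M\<^esub>"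
        using g(2)[OF lin_maps_closed[OF d1 u]] lin_maps_zero[OF F0.module_axioms module_regular \<rho>] xM by simp
      then show ?thesis using regular g(1)[OF lin_maps_closed[OF d1 u]] by blast
    qed
    then have "restrict g (carrier (F 1)) \<in> carrier (X 1)"
      unfolding cocycle using g_lin lin_maps_closed[OF d1] by (simp del: free_module_carrier One_nat_def)
    moreover have "\<exists>k\<in>?K. x = restrict g (carrier (F 1)) w \<oplus>\<^bsub>M\<^esub> k"
    proof -
      obtain k where k: "k \<in> ?K" "\<rho> e \<odot>\<^bsub>M\<^esub> x = x \<oplus>\<^bsub>M\<^esub> k"
        using add_smult_residue[OF xM, of ?K] x by blast
      have re: "\<rho> e \<odot>\<^bsub>M\<^esub> x \<in> carrier M" using \<rho>_closed[OF e] xM by simp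
      have "a \<odot>\<^bsub>M\<^esub> g w = (a \<otimes> \<rho> e) \<odot>\<^bsub>M\<^esub> x"
        using g(2)[OF w(1)] w(2) \<rho>_smult[OF aR e] by simp
      then have "a \<odot>\<^bsub>M\<^esub> g w = a \<odot>\<^bsub>M\<^esub> (\<rho> e \<odot>\<^bsub>M\<^esub> x)"
        using M.smult_assoc1[OF aR \<rho>_closed[OF e] xM] by simp
      then have gw: "g w = x \<oplus>\<^bsub>M\<^esub> k" using cancel[OF g(1)[OF w(1)] re] k(2) by simp
      have kM: "k \<in> carrier M" using k(1) KE(1) by blast
      have "x = g w \<oplus>\<^bsub>M\<^esub> \<ominus>\<^bsub>M\<^esub> k"
        unfolding gw using xM kM by (simp add: M.M.a_assoc M.M.r_neg)
      then show ?thesis using w(1) KE(3)[OF k(1)] by (intro bexI[of _ "\<ominus>\<^bsub>M\<^esub> k"]) (simp_all del: free_module_carrier One_nat_def)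
    qed
    ultimately show "\<exists>f\<in>carrier (X 1). \<exists>k\<in>?K. x = f w \<oplus>\<^bsub>M\<^esub> k" by blast
  qed
qed

end

context local_noetherian_ring
begin

lemma residue_resolution_exists:
  assumes "module R M"
  shows "\<exists>n d \<epsilon> \<rho> e. residue_resolution R \<mm> M n d \<epsilon> \<rho> e \<and>
     Ext_module R i (residue_module R) M =
       quotient_module ((Hom_module R (free_module R (n i)) M)\<lparr>carrier := cocycles R n d M i\<rparr>)
         (coboundaries R n d M i)"
proof -
  obtain n d \<epsilon> where res: "free_resolution R (residue_module R) n d \<epsilon>"
    and ext: "Ext_module R i (residue_module R) M =
       quotient_module ((Hom_module R (free_module R (n i)) M)\<lparr>carrier := cocycles R n d M i\<rparr>)
         (coboundaries R n d M i)"
    using Ext_module_residue by blast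
  have "\<epsilon> \<in> lin_maps R (free_module R (n 0)) (residue_module R)"
    "\<epsilon> ` carrier (free_module R (n 0)) = carrier (residue_module R)"
    using res unfolding free_resolution_def by blast+
  from residue_augmentation_lift[OF this] obtain \<rho> e
    where "residue_resolution_axioms R \<mm> n d \<epsilon> \<rho> e"
    using res unfolding residue_resolution_axioms_def by blast
  then show ?thesis
    using ext assms local_noetherian_ring_axioms by (blast intro: residue_resolution.intro)
qed

theorem cm_type_dim_0:
  assumes "krull_dim R = 0" "module R M"
  shows "cm_type R M =
    chain_length (\<lambda>H. submodule H R M \<and> H \<subseteq> {x \<in> carrier M. \<forall>b\<in>\<mm>. b \<odot>\<^bsub>M\<^esub> x = \<zero>\<^bsub>M\<^esub>})"
proof -
  obtain n d \<epsilon> \<rho> e where *: "residue_resolution R \<mm> M n d \<epsilon> \<rho> e"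
    "Ext_module R 0 (residue_module R) M =
       quotient_module ((Hom_module R (free_module R (n 0)) M)\<lparr>carrier := cocycles R n d M 0\<rparr>)
         (coboundaries R n d M 0)"
    using residue_resolution_exists[OF assms(2)] by blast
  have 0: "the_enat (krull_dim R) = 0"
    unfolding assms(1) zero_enat_def by simp
  show ?thesis
    unfolding cm_type_def 0 *(2)
    by (rule residue_resolution.length_Ext_0[OF *(1)])
qed

theorem cm_type_dim_1:
  assumes "krull_dim R = 1" "module R M" "a \<in> \<mm>"
    and "\<And>x. x \<in> carrier M \<Longrightarrow> a \<odot>\<^bsub>M\<^esub> x = \<zero>\<^bsub>M\<^esub> \<Longrightarrow> x = \<zero>\<^bsub>M\<^esub>"
  shows "cm_type R M =
    chain_length (\<lambda>H. submodule H R M \<and> (\<lambda>x. a \<odot>\<^bsub>M\<^esub> x) ` carrier M \<subseteq> H \<and>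
      H \<subseteq> {x \<in> carrier M. \<forall>b\<in>\<mm>. b \<odot>\<^bsub>M\<^esub> x \<in> (\<lambda>x. a \<odot>\<^bsub>M\<^esub> x) ` carrier M})"
proof -
  obtain n d \<epsilon> \<rho> e where *: "residue_resolution R \<mm> M n d \<epsilon> \<rho> e"
    "Ext_module R 1 (residue_module R) M =
       quotient_module ((Hom_module R (free_module R (n 1)) M)\<lparr>carrier := cocycles R n d M 1\<rparr>)
         (coboundaries R n d M 1)"
    using residue_resolution_exists[OF assms(2)] by blast
  have 1: "the_enat (krull_dim R) = 1"
    unfolding assms(1) one_enat_def by simp
  show ?thesis
    unfolding cm_type_def 1 *(2)
    by (rule residue_resolution.length_Ext_1[OF *(1) assms(3,4)])
qed

end

section \<open>Colon ideals and associated primes\<close>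

definition colon :: "('a, 'c) ring_scheme \<Rightarrow> 'a set \<Rightarrow> 'a \<Rightarrow> 'a set" where
  "colon R J c = {r \<in> carrier R. r \<otimes>\<^bsub>R\<^esub> c \<in> J}"

lemma colon_iff: "r \<in> colon R J c \<longleftrightarrow> r \<in> carrier R \<and> r \<otimes>\<^bsub>R\<^esub> c \<in> J"
  by (simp add: colon_def)

lemma (in cring) colon_ideal:
  assumes J: "ideal J R" and c: "c \<in> carrier R"
  shows "ideal (colon R J c) R"
proof -
  interpret J: ideal J R by fact
  have "submodule (colon R J c) R (regular_module R)"
  proof (rule module.submoduleI'[OF module_regular])
    fix a x assume a: "a \<in> carrier R" and x: "x \<in> colon R J c"
    have "(a \<otimes> x) \<otimes> c = a \<otimes> (x \<otimes> c)" using a x c by (simp add: colon_def m_assoc)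
    then show "a \<odot>\<^bsub>regular_module R\<^esub> x \<in> colon R J c"
      using a x c J.I_l_closed by (simp add: colon_def)
  qed (use c in \<open>auto simp: colon_def l_distr\<close>)
  then show ?thesis by (simp add: submodule_regular_iff)
qed

lemma (in cring) colon_eq_carrier_iff:
  assumes J: "ideal J R" and c: "c \<in> carrier R"
  shows "colon R J c = carrier R \<longleftrightarrow> c \<in> J"
proof -
  interpret J: ideal J R by fact
  show ?thesis
  proof
    assume "colon R J c = carrier R"
    then have "\<one> \<in> colon R J c" by simp
    then show "c \<in> J" using c by (simp add: colon_def)
  qed (use J.I_l_closed in \<open>auto simp: colon_def\<close>)
qed

lemma (in cring) colon_mult:
  assumes "c \<in> carrier R" "s \<in> carrier R"
  shows "colon R J (s \<otimes> c) = colon R (colon R J c) s"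
  using assms by (auto simp: colon_def m_assoc)

lemma (in cring) prime_ideal_le:
  assumes "primeideal P R"
  shows "P \<subseteq> carrier R" "P \<noteq> carrier R" "\<one> \<notin> P"
proof -
  interpret P: primeideal P R by fact
  show "P \<subseteq> carrier R" "P \<noteq> carrier R" using P.a_subset P.I_notcarr by auto
  then show "\<one> \<notin> P" using P.one_imp_carrier by blast
qed

context cring
begin

lemma mem_add_cgenideal_iff:
  "x \<in> J <+>\<^bsub>R\<^esub> PIdl z \<longleftrightarrow> (\<exists>j\<in>J. \<exists>r\<in>carrier R. x = j \<oplus> r \<otimes> z)"
  unfolding set_add_def' cgenideal_def by blast

lemma add_cgenideal:
  assumes J: "ideal J R" and z: "z \<in> carrier R"
  shows "ideal (J <+>\<^bsub>R\<^esub> PIdl z) R" "J \<subseteq> J <+>\<^bsub>R\<^esub> PIdl z" "z \<in> J <+>\<^bsub>R\<^esub> PIdl z"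
proof -
  interpret J: ideal J R by fact
  show "ideal (J <+>\<^bsub>R\<^esub> PIdl z) R"
    by (rule add_ideals[OF J cgenideal_ideal[OF z]])
  have "j = j \<oplus> \<zero> \<otimes> z" if "j \<in> J" for j using J.Icarr[OF that] z by simp
  then show "J \<subseteq> J <+>\<^bsub>R\<^esub> PIdl z" unfolding subset_iff mem_add_cgenideal_iff by blast
  have "z = \<zero> \<oplus> \<one> \<otimes> z" using z by simp
  then show "z \<in> J <+>\<^bsub>R\<^esub> PIdl z"
    unfolding mem_add_cgenideal_iff using J.zero_closed by blast
qed

end

lemma (in cring) regular_power:
  assumes "a \<in> carrier R" "\<And>x. x \<in> carrier R \<Longrightarrow> a \<otimes> x = \<zero> \<Longrightarrow> x = \<zero>"
    and "x \<in> carrier R" "a [^] (n::nat) \<otimes> x = \<zero>"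
  shows "x = \<zero>"
  using assms(3,4)
proof (induction n arbitrary: x)
  case (Suc n)
  have "a [^] n \<otimes> (a \<otimes> x) = \<zero>" using Suc.prems assms(1) by (simp add: m_assoc)
  then have "a \<otimes> x = \<zero>" by (rule Suc.IH[OF m_closed[OF assms(1) Suc.prems(1)]])
  then show ?case by (rule assms(2)[OF Suc.prems(1)])
qed simp

lemma (in primeideal) power_mem_imp_mem:
  assumes "a \<in> carrier R" "a [^] (n::nat) \<in> I" shows "a \<in> I"
  using assms(2)
proof (induction n)
  case 0
  then have "\<one> \<in> I" by simp
  then have "I = carrier R" by (rule one_imp_carrier)
  from I_notcarr this[symmetric] show ?case by (rule notE)
next
  case (Suc n)
  have "a [^] n \<otimes> a \<in> I" using Suc.prems by simp
  then have "a [^] n \<in> I \<or> a \<in> I"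
    using assms(1) by (intro I_prime nat_pow_closed)
  then show ?case using Suc.IH by (elim disjE)
qed

locale noetherian_cring = cring R + noetherian_ring R for R (structure)

sublocale local_noetherian_ring \<subseteq> noetherian_cring R ..

context noetherian_cring
begin

text \<open>
  The ascending chain condition, in the form of a maximal member, by Zorn's lemma.
\<close>

lemma exists_maximal_member:
  assumes "S \<noteq> {}" "\<And>J. J \<in> S \<Longrightarrow> ideal J R"
  shows "\<exists>J\<in>S. \<forall>K\<in>S. J \<subseteq> K \<longrightarrow> K = J"
proof (rule subset_Zorn_nonempty[OF assms(1)])
  fix C assume C: "C \<noteq> {}" "subset.chain S C"
  have "S \<subseteq> {J. ideal J R}" using assms(2) by blast
  then have "subset.chain {J. ideal J R} C"
    using C(2) unfolding subset_chain_def by (metis order_trans)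
  then have "\<Union>C \<in> C" by (rule ideal_chain_is_trivial[OF C(1)])
  moreover have "C \<subseteq> S" using C(2) unfolding subset_chain_def by (rule conjunct1)
  ultimately show "\<Union>C \<in> S" by (rule rev_subsetD)
qed

lemma noetherian_induct [consumes 1, case_names step]:
  assumes J: "ideal J R"
    and step: "\<And>J. ideal J R \<Longrightarrow> (\<And>K. ideal K R \<Longrightarrow> J \<subset> K \<Longrightarrow> Q K) \<Longrightarrow> Q J"
  shows "Q J"
proof (rule ccontr)
  assume "\<not> Q J"
  then have "\<exists>K\<in>{J. ideal J R \<and> \<not> Q J}. \<forall>L\<in>{J. ideal J R \<and> \<not> Q J}. K \<subseteq> L \<longrightarrow> L = K"
    using J by (intro exists_maximal_member) blast+
  then obtain K where K: "ideal K R" "\<not> Q K"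
    and max: "\<forall>L\<in>{J. ideal J R \<and> \<not> Q J}. K \<subseteq> L \<longrightarrow> L = K" by blast
  have "Q L" if "ideal L R" "K \<subset> L" for L
    using max that by blast
  then show False using step[OF K(1)] K(2) by blast
qed

lemma exists_maximal_ideal:
  assumes J: "ideal J R" "J \<noteq> carrier R"
  shows "\<exists>M. maximalideal M R \<and> J \<subseteq> M"
proof -
  let ?S = "{K. ideal K R \<and> K \<noteq> carrier R \<and> J \<subseteq> K}"
  have "\<exists>M\<in>?S. \<forall>K\<in>?S. M \<subseteq> K \<longrightarrow> K = M"
    using J by (intro exists_maximal_member) blast+
  then obtain M where M: "ideal M R" "M \<noteq> carrier R" "J \<subseteq> M"
    and max: "\<forall>K\<in>?S. M \<subseteq> K \<longrightarrow> K = M" by blast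
  have "maximalideal M R"
    by (rule maximalidealI) (use M max in blast)+
  then show ?thesis using M(3) by blast
qed

text \<open>
  A colon ideal \<open>(J : c)\<close> that is maximal among those inside \<open>P\<close> is prime: if \<open>xy \<in> (J : c)\<close> and
  \<open>x \<notin> (J : c)\<close>, then \<open>(J : xc)\<close> is not inside \<open>P\<close>, so some \<open>s \<notin> P\<close> gives the larger \<open>(J : sc)\<close>,
  which is still inside \<open>P\<close>.
\<close>

lemma prime_colon_below:
  assumes J: "ideal J R" and P: "primeideal P R" and JP: "J \<subseteq> P"
  shows "\<exists>c\<in>carrier R. primeideal (colon R J c) R \<and> colon R J c \<subseteq> P"
proof -
  interpret P: primeideal P R by fact
  let ?S = "{K. \<exists>c\<in>carrier R. K = colon R J c \<and> K \<subseteq> P}"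
  have "colon R J \<one> = J"
    using ideal.Icarr[OF J] by (auto simp: colon_def)
  then have "J \<in> ?S" using JP by (auto intro!: bexI[of _ \<one>])
  then have "\<exists>M\<in>?S. \<forall>K\<in>?S. M \<subseteq> K \<longrightarrow> K = M"
    using colon_ideal[OF J] by (intro exists_maximal_member) blast+
  then obtain M where "M \<in> ?S" and M: "\<forall>K\<in>?S. M \<subseteq> K \<longrightarrow> K = M" by blast
  then obtain c where c: "c \<in> carrier R" "colon R J c \<subseteq> P" and Mc: "M = colon R J c" by blast
  have max: "colon R J d = colon R J c"
    if "d \<in> carrier R" "colon R J d \<subseteq> P" "colon R J c \<subseteq> colon R J d" for d
    using M that unfolding Mc by blast
  interpret Jc: ideal "colon R J c" R by (rule colon_ideal[OF J c(1)])
  have "primeideal (colon R J c) R"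
  proof (rule primeidealI)
    show "carrier R \<noteq> colon R J c" using c(2) prime_ideal_le[OF P] by auto
    fix x y assume xy: "x \<in> carrier R" "y \<in> carrier R" "x \<otimes> y \<in> colon R J c"
    show "x \<in> colon R J c \<or> y \<in> colon R J c"
    proof (rule ccontr)
      assume n: "\<not> (x \<in> colon R J c \<or> y \<in> colon R J c)"
      have sub: "colon R J c \<subseteq> colon R J (t \<otimes> c)" if "t \<in> carrier R" for t
        unfolding colon_mult[OF c(1) that]
        using Jc.I_r_closed that Jc.Icarr by (auto simp: colon_def[of R "colon R J c"])
      have "y \<in> colon R J (x \<otimes> c)"
        unfolding colon_mult[OF c(1) xy(1)] using xy by (simp add: colon_def[of R "colon R J c"] m_comm)
      then have "\<not> colon R J (x \<otimes> c) \<subseteq> P"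
        using max[of "x \<otimes> c"] sub[OF xy(1)] n c(1) xy(1) by auto
      then obtain s where s: "s \<in> carrier R" "s \<notin> P" "s \<otimes> x \<in> colon R J c"
        unfolding colon_mult[OF c(1) xy(1)] by (auto simp: colon_def[of R "colon R J c"])
      have "colon R J (s \<otimes> c) \<subseteq> P"
      proof
        fix t assume "t \<in> colon R J (s \<otimes> c)"
        then have t: "t \<in> carrier R" "t \<otimes> s \<in> P"
          unfolding colon_mult[OF c(1) s(1)] using c(2) by (auto simp: colon_def[of R "colon R J c"])
        then show "t \<in> P" using P.I_prime[OF t(1) s(1) t(2)] s(2) by blast
      qed
      then have "colon R J (s \<otimes> c) = colon R J c"
        using max[of "s \<otimes> c"] sub[OF s(1)] c(1) s(1) by auto
      moreover have "x \<in> colon R J (s \<otimes> c)"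
        unfolding colon_mult[OF c(1) s(1)] using xy(1) s by (simp add: colon_def[of R "colon R J c"] m_comm)
      ultimately show False using n by blast
    qed
  qed (use Jc.is_ideal is_cring in auto)
  then show ?thesis using c by blast
qed

lemma prime_colon:
  assumes J: "ideal J R" "J \<noteq> carrier R"
  shows "\<exists>c\<in>carrier R. primeideal (colon R J c) R"
  using exists_maximal_ideal[OF J] prime_colon_below[OF J(1)] maximalideal_prime by blast

text \<open>
  Noetherian induction, with \<open>J' = J + Rz\<close> for a prime \<open>(J : z)\<close>.  If \<open>(J : x)\<close> is prime and differs from
  \<open>(J' : x)\<close>, then some \<open>r \<notin> (J : x)\<close> has \<open>rx = j + tz\<close> with \<open>j \<in> J\<close>, and
  \<open>(J : x) = (J : rx) = (J : tz) = (J : z)\<close>.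
\<close>

lemma finitely_many_prime_colons:
  assumes "ideal J R"
  shows "finite {P. primeideal P R \<and> (\<exists>x\<in>carrier R. P = colon R J x)}"
  using assms
proof (induction J rule: noetherian_induct)
  case (step J)
  interpret J: ideal J R by fact
  let ?A = "\<lambda>J. {P. primeideal P R \<and> (\<exists>x\<in>carrier R. P = colon R J x)}"
  show ?case
  proof (cases "J = carrier R")
    case True
    have "\<not> primeideal (colon R J x) R" if "x \<in> carrier R" for x
    proof -
      have "colon R J x = carrier R" using True that by (auto simp: colon_def)
      then show ?thesis using prime_ideal_le(2) by blast
    qed
    then have empty: "?A J = {}" by blast
    show ?thesis unfolding empty by simp
  next
    case False
    then obtain z where z: "z \<in> carrier R" "primeideal (colon R J z) R"
      using prime_colon step.hyps by blast
    interpret Z: primeideal "colon R J z" R by fact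
    let ?K = "J <+>\<^bsub>R\<^esub> PIdl z"
    note K = add_cgenideal(1)[OF step.hyps z(1)] and JK = add_cgenideal(2)[OF step.hyps z(1)]
    have "z \<in> ?K" by (rule add_cgenideal(3)[OF step.hyps z(1)])
    moreover have "z \<notin> J"
      using colon_eq_carrier_iff[OF step.hyps z(1)] prime_ideal_le(2)[OF z(2)] by blast
    ultimately have "finite (?A ?K)"
      using step.IH[OF K] JK by blast
    moreover have "?A J \<subseteq> insert (colon R J z) (?A ?K)"
    proof
      fix P assume "P \<in> ?A J"
      then obtain x where x: "x \<in> carrier R" "P = colon R J x" "primeideal P R" by blast
      interpret P: primeideal P R by fact
      show "P \<in> insert (colon R J z) (?A ?K)"
      proof (cases "colon R ?K x \<subseteq> P")
        case True
        moreover have "P \<subseteq> colon R ?K x" unfolding x(2) colon_def using JK by blast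
        ultimately have "P = colon R ?K x" by (rule equalityI[rotated])
        with x(1,3) have "P \<in> ?A ?K" by blast
        then show ?thesis by (rule insertI2)
      next
        case False
        then obtain r where r: "r \<in> carrier R" "r \<otimes> x \<in> ?K" "r \<notin> P"
          unfolding colon_def[of R ?K] by blast
        then obtain j t where jt: "j \<in> J" "t \<in> carrier R" "r \<otimes> x = j \<oplus> t \<otimes> z"
          unfolding mem_add_cgenideal_iff by blast
        have jR: "j \<in> carrier R" using jt(1) J.Icarr by blast
        have rx: "r \<otimes> x \<notin> J" using r(1,3) unfolding x(2) colon_def by blast
        have "t \<notin> colon R J z"
        proof
          assume "t \<in> colon R J z"
          then have "t \<otimes> z \<in> J" unfolding colon_iff by (rule conjunct2)
          then have "j \<oplus> t \<otimes> z \<in> J" by (rule J.a_closed[OF jt(1)])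
          then show False using rx jt(3) by simp
        qed
        have eq: "s \<otimes> (r \<otimes> x) \<in> J \<longleftrightarrow> s \<otimes> (t \<otimes> z) \<in> J" if s: "s \<in> carrier R" for s
        proof -
          have sj: "s \<otimes> j \<in> J" using J.I_l_closed[OF jt(1) s] .
          have e: "s \<otimes> (r \<otimes> x) = s \<otimes> j \<oplus> s \<otimes> (t \<otimes> z)"
            unfolding jt(3) using s jt z jR by (simp add: r_distr)
          have "s \<otimes> (t \<otimes> z) = s \<otimes> (r \<otimes> x) \<oplus> \<ominus> (s \<otimes> j)"
            unfolding e using s jt z jR by algebra
          then show ?thesis
            using J.a_closed[OF sj, of "s \<otimes> (t \<otimes> z)"] J.a_closed[OF _ J.a_inv_closed[OF sj], of "s \<otimes> (r \<otimes> x)"] e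
            by auto
        qed
        have "P = colon R J z"
        proof (intro equalityI subsetI)
          fix s assume s: "s \<in> P"
          then have sR: "s \<in> carrier R" by (rule P.Icarr)
          have "s \<otimes> r \<in> P" using P.I_r_closed[OF s r(1)] .
          then have "s \<otimes> r \<otimes> x \<in> J" unfolding x(2) colon_iff by (rule conjunct2)
          then have "s \<otimes> t \<otimes> z \<in> J"
            using eq[OF sR] m_assoc[OF sR r(1) x(1)] m_assoc[OF sR jt(2) z(1)] by simp
          then have "s \<otimes> t \<in> colon R J z"
            unfolding colon_iff using sR jt(2) by blast
          then show "s \<in> colon R J z"
            using Z.I_prime[OF sR jt(2)] \<open>t \<notin> colon R J z\<close> by blast
        next
          fix s assume s: "s \<in> colon R J z"
          then have sR: "s \<in> carrier R" by (rule Z.Icarr)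
          have "s \<otimes> t \<in> colon R J z" using Z.I_r_closed[OF s jt(2)] .
          then have "s \<otimes> t \<otimes> z \<in> J" unfolding colon_iff by (rule conjunct2)
          then have "s \<otimes> r \<otimes> x \<in> J"
            using eq[OF sR] m_assoc[OF sR r(1) x(1)] m_assoc[OF sR jt(2) z(1)] by simp
          then have "s \<otimes> r \<in> P"
            unfolding x(2) colon_iff using sR r(1) by blast
          then show "s \<in> P" using P.I_prime[OF sR r(1)] r(3) by blast
        qed
        then show ?thesis by blast
      qed
    qed
    ultimately show ?thesis using finite_subset by blast
  qed
qed

end

section \<open>One-dimensional local rings\<close>

lemma (in local_noetherian_ring) proper_ideal_le:
  assumes "ideal J R" "J \<noteq> carrier R"
  shows "J \<subseteq> \<mm>"
  using exists_maximal_ideal[OF assms] maximal_unique by blast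

locale local_noetherian_ring_dim_1 = local_noetherian_ring +
  assumes krull_dim: "krull_dim R = 1"
begin

lemma prime_le:
  assumes "primeideal P R" shows "P \<subseteq> \<mm>"
  using proper_ideal_le prime_ideal_le(2)[OF assms] assms primeideal.axioms(1) by blast

lemma \<mm>_prime: "primeideal \<mm> R"
  by (rule maximalideal_prime[OF maximal])

lemma prime_le_nonmaximal_imp_eq:
  assumes P: "primeideal P R" "P \<noteq> \<mm>" and Q: "primeideal Q R" "Q \<subseteq> P"
  shows "Q = P"
proof (rule ccontr)
  assume "Q \<noteq> P"
  let ?C = "\<lambda>i::nat. if i = 0 then Q else if i = 1 then P else \<mm>"
  have "(\<forall>i\<le>2. primeideal (?C i) R) \<and> (\<forall>i<2. ?C i \<subset> ?C (Suc i))"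
    using P Q \<open>Q \<noteq> P\<close> \<mm>_prime prime_le[OF P(1)] by (auto simp: less_Suc_eq numeral_2_eq_2)
  then have "enat 2 \<le> krull_dim R"
    unfolding krull_dim_def by (intro Sup_upper CollectI exI[of _ "2::nat"] conjI exI[of _ ?C]) auto
  then show False
    unfolding krull_dim by (simp add: one_enat_def)
qed

lemma exists_nonmaximal_prime: "\<exists>P. primeideal P R \<and> P \<noteq> \<mm>"
proof (rule ccontr)
  assume n: "\<nexists>P. primeideal P R \<and> P \<noteq> \<mm>"
  have "krull_dim R \<le> 0"
    unfolding krull_dim_def
  proof (rule Sup_least, clarify)
    fix n P assume P: "\<forall>i\<le>n. primeideal (P i) R" "\<forall>i<n. P i \<subset> P (Suc i)"
    have "n = 0"
    proof (rule ccontr)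
      assume "n \<noteq> 0"
      then have "primeideal (P 0) R" "primeideal (P 1) R" "P 0 \<subset> P 1" using P by auto
      then show False using n by blast
    qed
    then show "enat n \<le> 0" by (simp add: zero_enat_def)
  qed
  then show False unfolding krull_dim by simp
qed

text \<open>
  In dimension one the primes other than \<open>\<mm>\<close> are minimal, and minimal primes are associated.
\<close>

lemma nonmaximal_prime_is_annihilator:
  assumes P: "primeideal P R" "P \<noteq> \<mm>"
  shows "\<exists>c\<in>carrier R. P = colon R {\<zero>} c"
proof -
  interpret P: primeideal P R by fact
  have "{\<zero>} \<subseteq> P" by simp
  then show ?thesis
    using prime_colon_below[OF zeroideal P(1)] prime_le_nonmaximal_imp_eq[OF P] by blast
qed

text \<open>
  If \<open>a\<close> avoids \<open>S\<close> but lies in \<open>P\<close>, then \<open>a + b\<close> works, where \<open>b\<close> is a product of elements of the members of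
  \<open>S\<close> outside \<open>P\<close>.  These exist since there are no inclusions between distinct primes other than \<open>\<mm>\<close>.
\<close>

lemma prime_avoidance:
  assumes "finite S" "\<And>P. P \<in> S \<Longrightarrow> primeideal P R \<and> P \<noteq> \<mm>"
  shows "\<exists>a\<in>\<mm>. \<forall>P\<in>S. a \<notin> P"
  using assms
proof (induction S rule: finite_induct)
  case empty
  then show ?case using \<mm>.zero_closed by blast
next
  case (insert P S)
  then obtain a where a: "a \<in> \<mm>" "\<forall>Q\<in>S. a \<notin> Q" by auto
  have P: "primeideal P R" "P \<noteq> \<mm>" using insert.prems by auto
  interpret P: primeideal P R by fact
  show ?case
  proof (cases "a \<in> P")
    case False
    then show ?thesis using a by auto
  next
    case True
    note S = insert.prems insert.hyps(2)
    have "\<exists>b\<in>\<mm>. b \<notin> P \<and> (\<forall>Q\<in>T. b \<in> Q)" if "T \<subseteq> S" for T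
      using finite_subset[OF that insert.hyps(1)] that
    proof (induction T rule: finite_induct)
      case empty
      then show ?case using prime_le[OF P(1)] P(2) by blast
    next
      case (insert Q T)
      then obtain b where b: "b \<in> \<mm>" "b \<notin> P" "\<forall>Q\<in>T. b \<in> Q" by auto
      have "Q \<in> S" using insert.prems by blast
      then have Q: "primeideal Q R" "Q \<noteq> \<mm>" using S(1)[of Q] by auto
      interpret Q: primeideal Q R by fact
      have "Q \<noteq> P" using S(2) \<open>Q \<in> S\<close> by blast
      then obtain q where q: "q \<in> Q" "q \<notin> P"
        using prime_le_nonmaximal_imp_eq[OF P Q(1)] by blast
      have qR: "q \<in> carrier R" and bR: "b \<in> carrier R" using q b Q.Icarr \<mm>.Icarr by auto
      have "q \<otimes> b \<in> \<mm>" using \<mm>.I_l_closed[OF b(1) qR] .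
      moreover have "q \<otimes> b \<notin> P" using P.I_prime[OF qR bR] q b by blast
      moreover have "q \<otimes> b \<in> Q" using Q.I_r_closed[OF q(1) bR] .
      moreover have "q \<otimes> b \<in> Q'" if "Q' \<in> T" for Q'
      proof -
        have "ideal Q' R"
          using that insert.prems S(1)[of Q'] primeideal.axioms(1) by blast
        then show ?thesis using ideal.I_l_closed b(3) that qR by metis
      qed
      ultimately show ?case by blast
    qed
    from this[OF order_refl] obtain b where b: "b \<in> \<mm>" "b \<notin> P" "\<forall>Q\<in>S. b \<in> Q" by blast
    have aR: "a \<in> carrier R" and bR: "b \<in> carrier R" using a b \<mm>.Icarr by auto
    have "a \<oplus> b \<in> \<mm>" using a(1) b(1) by simp
    moreover have "a \<oplus> b \<notin> P"
    proof
      assume "a \<oplus> b \<in> P"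
      then have "\<ominus> a \<oplus> (a \<oplus> b) \<in> P" using True P.a_closed P.a_inv_closed by blast
      then show False using b(2) aR bR by (simp add: r_neg1)
    qed
    moreover have "a \<oplus> b \<notin> Q" if Q: "Q \<in> S" for Q
    proof
      assume ab: "a \<oplus> b \<in> Q"
      interpret Q: ideal Q R using insert.prems Q primeideal.axioms(1) by blast
      have "(a \<oplus> b) \<oplus> \<ominus> b \<in> Q" using ab b(3) Q Q.a_closed Q.a_inv_closed by blast
      moreover have "(a \<oplus> b) \<oplus> \<ominus> b = a" using aR bR by algebra
      ultimately show False using a(2) Q by simp
    qed
    ultimately show ?thesis by blast
  qed
qed

text \<open>
  The zero divisors of \<open>R\<close> lie in the union of the finitely many associated primes, and \<open>\<mm>\<close> is not one
  of them.
\<close>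

lemma exists_regular_element:
  assumes depth: "\<And>c. c \<in> carrier R \<Longrightarrow> colon R {\<zero>} c \<noteq> \<mm>"
  shows "\<exists>a\<in>\<mm>. \<forall>x\<in>carrier R. a \<otimes> x = \<zero> \<longrightarrow> x = \<zero>"
proof -
  let ?S = "{P. primeideal P R \<and> (\<exists>x\<in>carrier R. P = colon R {\<zero>} x)}"
  obtain a where a: "a \<in> \<mm>" "\<forall>P\<in>?S. a \<notin> P"
    using prime_avoidance[OF finitely_many_prime_colons[OF zeroideal]] depth by auto
  have "x = \<zero>" if x: "x \<in> carrier R" "a \<otimes> x = \<zero>" for x
  proof (rule ccontr)
    assume "x \<noteq> \<zero>"
    then have "colon R {\<zero>} x \<noteq> carrier R"
      using colon_eq_carrier_iff[OF zeroideal x(1)] by simp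
    then obtain c where c: "c \<in> carrier R" "primeideal (colon R (colon R {\<zero>} x) c) R"
      using prime_colon[OF colon_ideal[OF zeroideal x(1)]] by blast
    then have "colon R {\<zero>} (c \<otimes> x) \<in> ?S"
      using x(1) colon_mult[OF x(1) c(1), of "{\<zero>}"] by auto
    moreover have aR: "a \<in> carrier R" using a(1) by (rule \<mm>.Icarr)
    have "a \<otimes> (c \<otimes> x) = c \<otimes> (a \<otimes> x)" using aR c(1) x(1) by algebra
    then have "a \<in> colon R {\<zero>} (c \<otimes> x)"
      using x c(1) aR by (simp add: colon_def)
    ultimately show False using a(2) by blast
  qed
  then show ?thesis using a(1) by blast
qed

end

section \<open>Injectivity tested on ideals\<close>

text \<open>
  The target is a subset \<open>C\<close> of \<open>E\<close>, so that kernels of maps between the terms of a resolution can be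
  treated without forming new modules.
\<close>

definition ideal_hom ::
    "('a, 'c) ring_scheme \<Rightarrow> ('a, 'e, 'd) module_scheme \<Rightarrow> 'a set \<Rightarrow> 'e set \<Rightarrow> ('a \<Rightarrow> 'e) \<Rightarrow> bool" where
  "ideal_hom R E J C f \<longleftrightarrow> f \<in> J \<rightarrow> C \<and>
     (\<forall>i\<in>J. \<forall>j\<in>J. f (i \<oplus>\<^bsub>R\<^esub> j) = f i \<oplus>\<^bsub>E\<^esub> f j) \<and>
     (\<forall>r\<in>carrier R. \<forall>j\<in>J. f (r \<otimes>\<^bsub>R\<^esub> j) = r \<odot>\<^bsub>E\<^esub> f j)"

text \<open>
  Baer's criterion for the submodule \<open>C\<close> of \<open>E\<close>: a map from \<open>J\<close> extends to \<open>R\<close> iff it is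
  multiplication by an element of \<open>C\<close>.
\<close>

definition baer_injective :: "('a, 'c) ring_scheme \<Rightarrow> ('a, 'e) module \<Rightarrow> 'e set \<Rightarrow> bool" where
  "baer_injective R E C \<longleftrightarrow>
     (\<forall>J f. ideal J R \<and> ideal_hom R E J C f \<longrightarrow> (\<exists>c\<in>C. \<forall>j\<in>J. f j = j \<odot>\<^bsub>E\<^esub> c))"

lemma ideal_homD:
  assumes "ideal_hom R E J C f"
  shows "j \<in> J \<Longrightarrow> f j \<in> C"
    and "i \<in> J \<Longrightarrow> j \<in> J \<Longrightarrow> f (i \<oplus>\<^bsub>R\<^esub> j) = f i \<oplus>\<^bsub>E\<^esub> f j"
    and "r \<in> carrier R \<Longrightarrow> j \<in> J \<Longrightarrow> f (r \<otimes>\<^bsub>R\<^esub> j) = r \<odot>\<^bsub>E\<^esub> f j"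
  using assms unfolding ideal_hom_def by auto

lemma baer_injectiveD:
  assumes "baer_injective R E C" "ideal J R" "ideal_hom R E J C f"
  shows "\<exists>c\<in>C. \<forall>j\<in>J. f j = j \<odot>\<^bsub>E\<^esub> c"
  using assms unfolding baer_injective_def by blast

lemma (in cring) injective_module_imp_baer:
  assumes "injective_module R E"
  shows "baer_injective R E (carrier E)"
  unfolding baer_injective_def
proof (intro allI impI, elim conjE)
  fix J f assume J: "ideal J R" and f: "ideal_hom R E J (carrier E) f"
  let ?N = "regular_module R"
  interpret J: ideal J R by fact
  have JN: "submodule J R ?N" using J by (simp add: submodule_regular_iff)
  have "restrict f (carrier (?N\<lparr>carrier := J\<rparr>)) \<in> lin_maps R (?N\<lparr>carrier := J\<rparr>) E"
    using ideal_homD[OF f] J.I_l_closed J.a_closed by (intro lin_mapsI) simp_all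
  then obtain g where g: "g \<in> lin_maps R ?N E" "\<forall>x\<in>J. g x = restrict f J x"
    using assms module_regular JN unfolding injective_module_def by fastforce
  have "f j = j \<odot>\<^bsub>E\<^esub> g \<one>" if j: "j \<in> J" for j
    using lin_maps_smult[OF g(1), of j \<one>] g(2) j J.Icarr[OF j] by auto
  moreover have "g \<one> \<in> carrier E" using lin_maps_closed[OF g(1), of \<one>] by simp
  ultimately show "\<exists>c\<in>carrier E. \<forall>j\<in>J. f j = j \<odot>\<^bsub>E\<^esub> c" by blast
qed

text \<open>
  The compatibility condition makes \<open>j + rz \<mapsto> f(j) + ry\<close> independent of the representation.
\<close>

lemma (in module) extend_ideal_hom:
  assumes C: "submodule C R M" and J: "ideal J R" and f: "ideal_hom R M J C f"
    and z: "z \<in> carrier R" and y: "y \<in> C"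
    and compat: "\<And>r. r \<in> carrier R \<Longrightarrow> r \<otimes>\<^bsub>R\<^esub> z \<in> J \<Longrightarrow> f (r \<otimes>\<^bsub>R\<^esub> z) = r \<odot>\<^bsub>M\<^esub> y"
  shows "\<exists>g. ideal_hom R M (J <+>\<^bsub>R\<^esub> PIdl\<^bsub>R\<^esub> z) C g \<and> (\<forall>j\<in>J. g j = f j) \<and> g z = y"
proof -
  interpret J: ideal J R by fact
  let ?K = "J <+>\<^bsub>R\<^esub> PIdl\<^bsub>R\<^esub> z"
  note E = submoduleE[OF C]
  have CM: "x \<in> C \<Longrightarrow> x \<in> carrier M" for x using E(1) by blast
  have yM: "y \<in> carrier M" and fM: "j \<in> J \<Longrightarrow> f j \<in> carrier M" for j
    using CM y ideal_homD(1)[OF f] by auto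
  have wd: "f j \<oplus>\<^bsub>M\<^esub> r \<odot>\<^bsub>M\<^esub> y = f j' \<oplus>\<^bsub>M\<^esub> r' \<odot>\<^bsub>M\<^esub> y"
    if *: "j \<in> J" "j' \<in> J" "r \<in> carrier R" "r' \<in> carrier R" "j \<oplus>\<^bsub>R\<^esub> r \<otimes>\<^bsub>R\<^esub> z = j' \<oplus>\<^bsub>R\<^esub> r' \<otimes>\<^bsub>R\<^esub> z" for j j' r r'
  proof -
    have c: "j \<in> carrier R" "j' \<in> carrier R" using * J.Icarr by auto
    let ?s = "r' \<ominus>\<^bsub>R\<^esub> r"
    have s: "?s \<in> carrier R" using * by simp
    have "?s \<otimes>\<^bsub>R\<^esub> z = (j' \<oplus>\<^bsub>R\<^esub> r' \<otimes>\<^bsub>R\<^esub> z) \<ominus>\<^bsub>R\<^esub> j' \<ominus>\<^bsub>R\<^esub> r \<otimes>\<^bsub>R\<^esub> z"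
      using c *(3,4) z by algebra
    also have "\<dots> = j \<ominus>\<^bsub>R\<^esub> j'"
      unfolding *(5)[symmetric] using c *(3,4) z by algebra
    finally have sz: "?s \<otimes>\<^bsub>R\<^esub> z = j \<ominus>\<^bsub>R\<^esub> j'" .
    have szJ: "?s \<otimes>\<^bsub>R\<^esub> z \<in> J"
      unfolding sz using J.a_closed[OF *(1) J.a_inv_closed[OF *(2)]] by (simp add: R.minus_eq)
    have "j = ?s \<otimes>\<^bsub>R\<^esub> z \<oplus>\<^bsub>R\<^esub> j'" unfolding sz using c by algebra
    then have "f j = ?s \<odot>\<^bsub>M\<^esub> y \<oplus>\<^bsub>M\<^esub> f j'"
      using ideal_homD(2)[OF f szJ *(2)] compat[OF s szJ] by simp
    then have "f j \<oplus>\<^bsub>M\<^esub> r \<odot>\<^bsub>M\<^esub> y = f j' \<oplus>\<^bsub>M\<^esub> (?s \<odot>\<^bsub>M\<^esub> y \<oplus>\<^bsub>M\<^esub> r \<odot>\<^bsub>M\<^esub> y)"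
      using s yM fM[OF *(2)] *(3) by (simp add: M.a_ac)
    also have "?s \<odot>\<^bsub>M\<^esub> y \<oplus>\<^bsub>M\<^esub> r \<odot>\<^bsub>M\<^esub> y = (?s \<oplus>\<^bsub>R\<^esub> r) \<odot>\<^bsub>M\<^esub> y"
      using smult_l_distr[OF s *(3) yM] by simp
    also have "?s \<oplus>\<^bsub>R\<^esub> r = r'" using *(3,4) by algebra
    finally show ?thesis .
  qed
  have "\<forall>x. \<exists>v. x \<in> ?K \<longrightarrow> (\<forall>j\<in>J. \<forall>r\<in>carrier R. x = j \<oplus>\<^bsub>R\<^esub> r \<otimes>\<^bsub>R\<^esub> z \<longrightarrow> v = f j \<oplus>\<^bsub>M\<^esub> r \<odot>\<^bsub>M\<^esub> y)"
    using wd unfolding R.mem_add_cgenideal_iff by blast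
  then obtain g where g': "\<And>x j r. x \<in> ?K \<Longrightarrow> j \<in> J \<Longrightarrow> r \<in> carrier R \<Longrightarrow> x = j \<oplus>\<^bsub>R\<^esub> r \<otimes>\<^bsub>R\<^esub> z \<Longrightarrow> g x = f j \<oplus>\<^bsub>M\<^esub> r \<odot>\<^bsub>M\<^esub> y"
    by metis
  have g: "g (j \<oplus>\<^bsub>R\<^esub> r \<otimes>\<^bsub>R\<^esub> z) = f j \<oplus>\<^bsub>M\<^esub> r \<odot>\<^bsub>M\<^esub> y" if "j \<in> J" "r \<in> carrier R" for j r
    by (rule g'[OF _ that refl]) (use that R.mem_add_cgenideal_iff in blast)
  have f0: "f \<zero>\<^bsub>R\<^esub> = \<zero>\<^bsub>M\<^esub>"
    using ideal_homD(3)[OF f R.zero_closed J.zero_closed] fM[OF J.zero_closed] by simp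
  have "ideal_hom R M ?K C g"
    unfolding ideal_hom_def
  proof (intro conjI ballI Pi_I)
    fix x assume "x \<in> ?K"
    then obtain j r where x: "j \<in> J" "r \<in> carrier R" "x = j \<oplus>\<^bsub>R\<^esub> r \<otimes>\<^bsub>R\<^esub> z"
      unfolding R.mem_add_cgenideal_iff by blast
    show "g x \<in> C" unfolding x(3) g[OF x(1,2)]
      using E(5)[OF ideal_homD(1)[OF f x(1)] E(4)[OF x(2) y]] .
    fix s assume s: "s \<in> carrier R"
    have jR: "j \<in> carrier R" using J.Icarr[OF x(1)] .
    have "s \<otimes>\<^bsub>R\<^esub> x = s \<otimes>\<^bsub>R\<^esub> j \<oplus>\<^bsub>R\<^esub> (s \<otimes>\<^bsub>R\<^esub> r) \<otimes>\<^bsub>R\<^esub> z"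
      unfolding x(3) using s jR x(2) z by algebra
    then show "g (s \<otimes>\<^bsub>R\<^esub> x) = s \<odot>\<^bsub>M\<^esub> g x"
      using g[OF J.I_l_closed[OF x(1) s], of "s \<otimes>\<^bsub>R\<^esub> r"] g[OF x(1,2)] x s
        ideal_homD(3)[OF f s x(1)] smult_r_distr[OF s fM[OF x(1)], of "r \<odot>\<^bsub>M\<^esub> y"] yM smult_assoc1[OF s x(2) yM]
      by simp
  next
    fix x x' assume "x \<in> ?K" "x' \<in> ?K"
    then obtain j r j' r' where x: "j \<in> J" "r \<in> carrier R" "x = j \<oplus>\<^bsub>R\<^esub> r \<otimes>\<^bsub>R\<^esub> z"
      "j' \<in> J" "r' \<in> carrier R" "x' = j' \<oplus>\<^bsub>R\<^esub> r' \<otimes>\<^bsub>R\<^esub> z"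
      unfolding R.mem_add_cgenideal_iff by blast
    have jR: "j \<in> carrier R" "j' \<in> carrier R" using J.Icarr x by auto
    have "x \<oplus>\<^bsub>R\<^esub> x' = (j \<oplus>\<^bsub>R\<^esub> j') \<oplus>\<^bsub>R\<^esub> (r \<oplus>\<^bsub>R\<^esub> r') \<otimes>\<^bsub>R\<^esub> z"
      unfolding x(3,6) using jR x(2,5) z by algebra
    then have "g (x \<oplus>\<^bsub>R\<^esub> x') = (f j \<oplus>\<^bsub>M\<^esub> f j') \<oplus>\<^bsub>M\<^esub> (r \<odot>\<^bsub>M\<^esub> y \<oplus>\<^bsub>M\<^esub> r' \<odot>\<^bsub>M\<^esub> y)"
      using g[OF J.a_closed[OF x(1,4)] R.a_closed[OF x(2,5)]] ideal_homD(2)[OF f x(1,4)]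
        smult_l_distr[OF x(2,5) yM] by simp
    then show "g (x \<oplus>\<^bsub>R\<^esub> x') = g x \<oplus>\<^bsub>M\<^esub> g x'"
      unfolding x(3,6) g[OF x(1,2)] g[OF x(4,5)]
      using fM[OF x(1)] fM[OF x(4)] smult_closed[OF x(2) yM] smult_closed[OF x(5) yM] by (simp add: M.a_ac)
  qed
  moreover have "g j = f j" if j: "j \<in> J" for j
    using g[OF j R.zero_closed] J.Icarr[OF j] z fM[OF j] yM by simp
  moreover have "g z = y"
    using g[OF J.zero_closed R.one_closed] z f0 yM by simp
  ultimately show ?thesis by blast
qed

lemma baer_injective_extend:
  assumes M: "module R E" and baer: "baer_injective R E C" and C: "submodule C R E" and J: "ideal J R"
    and f: "ideal_hom R E J C f" and z: "z \<in> carrier R" and y: "y \<in> C"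
    and compat: "\<And>r. r \<in> carrier R \<Longrightarrow> r \<otimes>\<^bsub>R\<^esub> z \<in> J \<Longrightarrow> f (r \<otimes>\<^bsub>R\<^esub> z) = r \<odot>\<^bsub>E\<^esub> y"
  shows "\<exists>c\<in>C. (\<forall>j\<in>J. f j = j \<odot>\<^bsub>E\<^esub> c) \<and> y = z \<odot>\<^bsub>E\<^esub> c"
proof -
  interpret E: module R E by fact
  obtain g where g: "ideal_hom R E (J <+>\<^bsub>R\<^esub> PIdl\<^bsub>R\<^esub> z) C g" "\<forall>j\<in>J. g j = f j" "g z = y"
    using E.extend_ideal_hom[OF C J f z y compat] by blast
  note K = E.R.add_cgenideal[OF J z]
  obtain c where c: "c \<in> C" "\<forall>j\<in>J <+>\<^bsub>R\<^esub> PIdl\<^bsub>R\<^esub> z. g j = j \<odot>\<^bsub>E\<^esub> c"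
    using baer_injectiveD[OF baer K(1) g(1)] by blast
  have "f j = j \<odot>\<^bsub>E\<^esub> c" if "j \<in> J" for j
    using bspec[OF c(2) subsetD[OF K(2) that]] bspec[OF g(2) that] by (rule trans[OF sym, rotated])
  moreover have "y = z \<odot>\<^bsub>E\<^esub> c" using bspec[OF c(2) K(3)] g(3) by simp
  ultimately show ?thesis using c(1) by blast
qed

lemma ideal_hom_zero:
  assumes "module R E" "submodule C R E" "ideal J R"
  shows "ideal_hom R E J C (\<lambda>_. \<zero>\<^bsub>E\<^esub>)"
proof -
  interpret E: module R E by fact
  show ?thesis unfolding ideal_hom_def using E.submodule_zero[OF assms(2)] by simp
qed

text \<open>
  The case \<open>f = 0\<close>: division of \<open>y\<close> by \<open>z\<close> with a quotient that is killed by \<open>J\<close>.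
\<close>

lemma baer_injective_divide:
  assumes M: "module R E" and baer: "baer_injective R E C" and C: "submodule C R E" and J: "ideal J R"
    and z: "z \<in> carrier R" and y: "y \<in> C"
    and compat: "\<And>r. r \<in> carrier R \<Longrightarrow> r \<otimes>\<^bsub>R\<^esub> z \<in> J \<Longrightarrow> r \<odot>\<^bsub>E\<^esub> y = \<zero>\<^bsub>E\<^esub>"
  shows "\<exists>c\<in>C. (\<forall>j\<in>J. j \<odot>\<^bsub>E\<^esub> c = \<zero>\<^bsub>E\<^esub>) \<and> y = z \<odot>\<^bsub>E\<^esub> c"
  using baer_injective_extend[OF M baer C J ideal_hom_zero[OF M C J] z y] compat by metis

text \<open>
  This is the vanishing of \<open>Ext\<^sup>1(R/P, C)\<close> for \<open>P = (aR : u)\<close>, when \<open>0 \<rightarrow> C \<rightarrow> E \<rightarrow> D \<rightarrow> 0\<close> is exact, \<open>D\<close> is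
  injective and \<open>aE \<inter> C = aC\<close>: an element of \<open>D\<close> killed by \<open>P\<close> is \<open>u\<close> times an element killed by \<open>a\<close>, and
  the latter lifts to an element killed by \<open>a\<close>.
\<close>

lemma lift_annihilated_element:
  assumes E: "module R E" and E': "module R E'" and \<pi>: "\<pi> \<in> lin_maps R E E'"
    and baer: "baer_injective R E' (\<pi> ` carrier E)"
    and a: "a \<in> carrier R" and u: "u \<in> carrier R"
    and pure: "\<And>x. x \<in> carrier E \<Longrightarrow> a \<odot>\<^bsub>E\<^esub> x \<in> a_kernel E E' \<pi> \<Longrightarrow>
      \<exists>c\<in>a_kernel E E' \<pi>. a \<odot>\<^bsub>E\<^esub> x = a \<odot>\<^bsub>E\<^esub> c"
    and y: "y \<in> \<pi> ` carrier E" "\<And>p. p \<in> colon R (PIdl\<^bsub>R\<^esub> a) u \<Longrightarrow> p \<odot>\<^bsub>E'\<^esub> y = \<zero>\<^bsub>E'\<^esub>"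
  shows "\<exists>x\<in>carrier E. \<pi> x = y \<and> (\<forall>p\<in>colon R (PIdl\<^bsub>R\<^esub> a) u. p \<odot>\<^bsub>E\<^esub> x = \<zero>\<^bsub>E\<^esub>)"
proof -
  interpret E: module R E by fact
  interpret E': module R E' by fact
  let ?a = "PIdl\<^bsub>R\<^esub> a"
  have "ideal ?a R" by (rule E.R.cgenideal_ideal[OF a])
  then obtain y' where y': "y' \<in> \<pi> ` carrier E" "\<forall>j\<in>?a. j \<odot>\<^bsub>E'\<^esub> y' = \<zero>\<^bsub>E'\<^esub>" "y = u \<odot>\<^bsub>E'\<^esub> y'"
    using baer_injective_divide[OF E' baer submodule_image[OF E E' \<pi>] _ u y(1)] y(2)
    unfolding colon_iff by metis
  then obtain x' where x': "x' \<in> carrier E" "y' = \<pi> x'" by blast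
  have "\<pi> (a \<odot>\<^bsub>E\<^esub> x') = \<zero>\<^bsub>E'\<^esub>"
    using y'(2) E.R.cgenideal_self[OF a] x' lin_maps_smult[OF \<pi> a x'(1)] by simp
  then have "a \<odot>\<^bsub>E\<^esub> x' \<in> a_kernel E E' \<pi>" using a x'(1) by (simp add: a_kernel_def')
  then obtain c where c: "c \<in> carrier E" "\<pi> c = \<zero>\<^bsub>E'\<^esub>" "a \<odot>\<^bsub>E\<^esub> x' = a \<odot>\<^bsub>E\<^esub> c"
    using pure[OF x'(1)] by (auto simp: a_kernel_def')
  let ?d = "x' \<ominus>\<^bsub>E\<^esub> c"
  have d: "?d \<in> carrier E" using x' c by simp
  have ad: "a \<odot>\<^bsub>E\<^esub> ?d = \<zero>\<^bsub>E\<^esub>"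
    using a x'(1) c by (simp add: E.M.minus_eq E.smult_r_distr E.smult_r_minus E.M.r_neg)
  have "\<pi> ?d = y'"
    using lin_maps_minus[OF E E' \<pi> x'(1) c(1)] c(2) x' lin_maps_closed[OF \<pi> x'(1)] by (simp add: E'.M.minus_eq)
  then have "\<pi> (u \<odot>\<^bsub>E\<^esub> ?d) = y" using lin_maps_smult[OF \<pi> u d] y'(3) by simp
  moreover have "p \<odot>\<^bsub>E\<^esub> (u \<odot>\<^bsub>E\<^esub> ?d) = \<zero>\<^bsub>E\<^esub>" if p: "p \<in> colon R ?a u" for p
  proof -
    have pR: "p \<in> carrier R" and "p \<otimes>\<^bsub>R\<^esub> u \<in> ?a" using p unfolding colon_iff by blast+
    then obtain s where s: "s \<in> carrier R" "p \<otimes>\<^bsub>R\<^esub> u = s \<otimes>\<^bsub>R\<^esub> a" unfolding cgenideal_def by blast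
    then show ?thesis
      using E.smult_assoc1[OF pR u d] E.smult_assoc1[OF s(1) a d] ad by simp
  qed
  ultimately show ?thesis using E.smult_closed[OF u d] by blast
qed

text \<open>
  Baer's criterion combined with a prime filtration: a map from \<open>J\<close> extends one step further, to
  \<open>J + Rz\<close> with \<open>(J : z)\<close> prime.
\<close>

lemma (in noetherian_cring) baer_injective_kernel:
  assumes E: "module R E" and E': "module R E'" and \<pi>: "\<pi> \<in> lin_maps R E E'"
    and baer_E: "baer_injective R E (carrier E)"
    and lift: "\<And>P y. primeideal P R \<Longrightarrow> y \<in> \<pi> ` carrier E \<Longrightarrow> (\<And>p. p \<in> P \<Longrightarrow> p \<odot>\<^bsub>E'\<^esub> y = \<zero>\<^bsub>E'\<^esub>) \<Longrightarrow>
      \<exists>x\<in>carrier E. \<pi> x = y \<and> (\<forall>p\<in>P. p \<odot>\<^bsub>E\<^esub> x = \<zero>\<^bsub>E\<^esub>)"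
  shows "baer_injective R E (a_kernel E E' \<pi>)"
proof -
  interpret E: module R E by fact
  interpret E': module R E' by fact
  let ?C = "a_kernel E E' \<pi>"
  note C = submodule_kernel[OF E E' \<pi>]
  have CE: "?C \<subseteq> carrier E" using E.submoduleE(1)[OF C] .
  have "\<forall>f. ideal_hom R E J ?C f \<longrightarrow> (\<exists>c\<in>?C. \<forall>j\<in>J. f j = j \<odot>\<^bsub>E\<^esub> c)" if "ideal J R" for J
    using that
  proof (induction J rule: noetherian_induct)
    case (step J)
    interpret J: ideal J R by (rule step.hyps)
    show ?case
    proof (intro allI impI)
      fix f assume f: "ideal_hom R E J ?C f"
      show "\<exists>c\<in>?C. \<forall>j\<in>J. f j = j \<odot>\<^bsub>E\<^esub> c"
      proof (cases "J = carrier R")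
        case True
        have "f j = j \<odot>\<^bsub>E\<^esub> f \<one>" if j: "j \<in> J" for j
          using ideal_homD(3)[OF f J.Icarr[OF j], of \<one>] True J.Icarr[OF j] by simp
        moreover have "f \<one> \<in> ?C" using ideal_homD(1)[OF f] True by simp
        ultimately show ?thesis by blast
      next
        case False
        then obtain z where z: "z \<in> carrier R" "primeideal (colon R J z) R"
          using prime_colon step.hyps by blast
        have zJ: "z \<notin> J" using colon_eq_carrier_iff[OF step.hyps z(1)] prime_ideal_le(2)[OF z(2)] by blast
        have "ideal_hom R E J (carrier E) f" using f CE unfolding ideal_hom_def by blast
        then obtain x where x: "x \<in> carrier E" "\<forall>j\<in>J. f j = j \<odot>\<^bsub>E\<^esub> x"
          using baer_injectiveD[OF baer_E step.hyps] by blast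
        have zx: "z \<odot>\<^bsub>E\<^esub> x \<in> carrier E" using z x by simp
        have "p \<odot>\<^bsub>E'\<^esub> \<pi> (z \<odot>\<^bsub>E\<^esub> x) = \<zero>\<^bsub>E'\<^esub>" if p: "p \<in> colon R J z" for p
        proof -
          have pR: "p \<in> carrier R" and pz: "p \<otimes> z \<in> J" using p unfolding colon_iff by blast+
          have "p \<odot>\<^bsub>E'\<^esub> \<pi> (z \<odot>\<^bsub>E\<^esub> x) = \<pi> (f (p \<otimes> z))"
            using lin_maps_smult[OF \<pi> pR zx] E.smult_assoc1[OF pR z(1) x(1)] x(2) pz by simp
          also have "\<dots> = \<zero>\<^bsub>E'\<^esub>" using ideal_homD(1)[OF f pz] by (simp add: a_kernel_def')
          finally show ?thesis .
        qed
        then obtain x' where x': "x' \<in> carrier E" "\<pi> x' = \<pi> (z \<odot>\<^bsub>E\<^esub> x)"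
          "\<forall>p\<in>colon R J z. p \<odot>\<^bsub>E\<^esub> x' = \<zero>\<^bsub>E\<^esub>"
          using lift[OF z(2), of "\<pi> (z \<odot>\<^bsub>E\<^esub> x)"] zx by blast
        let ?y = "z \<odot>\<^bsub>E\<^esub> x \<ominus>\<^bsub>E\<^esub> x'"
        \<comment> \<open>Correcting \<open>zx\<close> by \<open>x'\<close> moves it into \<open>C\<close> without changing its multiples by \<open>(J : z)\<close>.\<close>
        have y: "?y \<in> ?C"
          using lin_maps_minus[OF E E' \<pi> zx x'(1)] x'(2) lin_maps_closed[OF \<pi> zx] zx x'(1)
          by (simp add: a_kernel_def' E'.M.minus_eq E'.M.r_neg)
        have compat: "f (r \<otimes> z) = r \<odot>\<^bsub>E\<^esub> ?y" if r: "r \<in> carrier R" "r \<otimes> z \<in> J" for r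
        proof -
          have "r \<in> colon R J z" unfolding colon_iff using r by blast
          then have "r \<odot>\<^bsub>E\<^esub> x' = \<zero>\<^bsub>E\<^esub>" using x'(3) by blast
          then have "r \<odot>\<^bsub>E\<^esub> ?y = r \<odot>\<^bsub>E\<^esub> (z \<odot>\<^bsub>E\<^esub> x)"
            using r(1) zx x'(1) by (simp add: E.M.minus_eq E.smult_r_distr E.smult_r_minus)
          then show ?thesis using x(2) r E.smult_assoc1[OF r(1) z(1) x(1)] by simp
        qed
        obtain g where g: "ideal_hom R E (J <+>\<^bsub>R\<^esub> PIdl z) ?C g" "\<forall>j\<in>J. g j = f j"
          using E.extend_ideal_hom[OF C step.hyps f z(1) y compat] by blast
        note K = add_cgenideal[OF step.hyps z(1)]
        have "J \<subset> J <+>\<^bsub>R\<^esub> PIdl z" using K(2,3) zJ by blast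
        then obtain c where "c \<in> ?C" "\<forall>j\<in>J <+>\<^bsub>R\<^esub> PIdl z. g j = j \<odot>\<^bsub>E\<^esub> c"
          using step.IH[OF K(1)] g(1) by blast
        then show ?thesis using g(2) K(2) by (metis subsetD)
      qed
    qed
  qed
  then show ?thesis unfolding baer_injective_def by blast
qed

section \<open>One-dimensional Gorenstein rings\<close>

text \<open>
  The cosyzygy \<open>C i\<close> below is the kernel of \<open>\<delta> i\<close>, with \<open>C 0\<close> a copy of \<open>R\<close>.
\<close>

locale gorenstein_dim_1 = local_noetherian_ring_dim_1 R \<mm>
  for R :: "('a, 'c) ring_scheme" (structure) and \<mm> +
  fixes E :: "nat \<Rightarrow> ('a, 'e) module" and \<delta> \<eta> N
  assumes resolution: "injective_resolution R (regular_module R) E \<delta> \<eta>"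
    and bounded: "\<And>i. i > N \<Longrightarrow> carrier (E i) = {\<zero>\<^bsub>E i\<^esub>}"
begin

abbreviation "C i \<equiv> a_kernel (E i) (E (Suc i)) (\<delta> i)"

lemma baer_E: "baer_injective R (E i) (carrier (E i))"
  using resolution unfolding injective_resolution_def by (intro injective_module_imp_baer) blast

lemma module_E: "module R (E i)"
  and \<delta>: "\<delta> i \<in> lin_maps R (E i) (E (Suc i))" and \<eta>: "\<eta> \<in> lin_maps R (regular_module R) (E 0)"
  and \<eta>_inj: "inj_on \<eta> (carrier R)" and C_0: "C 0 = \<eta> ` carrier R" and C_Suc: "C (Suc i) = \<delta> i ` carrier (E i)"
  using resolution unfolding injective_resolution_def injective_module_def by auto

lemma C_submodule: "submodule (C i) R (E i)"
  by (rule submodule_kernel[OF module_E module_E \<delta>])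

text \<open>
  Descending induction from the vanishing cosyzygies.  The condition on \<open>a\<close> says that \<open>aE \<inter> C = aC\<close>; it is
  void for \<open>a = 0\<close>, which covers the associated primes \<open>P = (0 : u)\<close>.
\<close>

lemma cosyzygy_injective:
  assumes "\<And>i P. k \<le> i \<Longrightarrow> primeideal P R \<Longrightarrow>
      \<exists>a\<in>carrier R. \<exists>u\<in>carrier R. P = colon R (PIdl a) u \<and>
        (\<forall>x\<in>carrier (E i). a \<odot>\<^bsub>E i\<^esub> x \<in> C i \<longrightarrow> (\<exists>c\<in>C i. a \<odot>\<^bsub>E i\<^esub> x = a \<odot>\<^bsub>E i\<^esub> c))"
  shows "baer_injective R (E k) (C k)"
proof -
  have triv: "baer_injective R (E i) (C i)" if i: "i > N" for i
  proof -
    interpret Ei: module R "E i" by (rule module_E)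
    have C: "C i \<subseteq> {\<zero>\<^bsub>E i\<^esub>}" using Ei.submoduleE(1)[OF C_submodule] bounded[OF i] by simp
    show ?thesis
      unfolding baer_injective_def
    proof (intro allI impI, elim conjE)
      fix J f assume J: "ideal J R" and f: "ideal_hom R (E i) J (C i) f"
      have "f j = j \<odot>\<^bsub>E i\<^esub> \<zero>\<^bsub>E i\<^esub>" if "j \<in> J" for j
        using ideal_homD(1)[OF f that] C ideal.Icarr[OF J that] by auto
      then show "\<exists>c\<in>C i. \<forall>j\<in>J. f j = j \<odot>\<^bsub>E i\<^esub> c"
        using Ei.submodule_zero[OF C_submodule] by blast
    qed
  qed
  show ?thesis
  proof (cases "k > N")
    case False
    then have "k \<le> Suc N" by simp
    then show ?thesis
    proof (induction k rule: inc_induct)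
      case base
      then show ?case using triv by simp
    next
      case (step i)
      show ?case
      proof (rule baer_injective_kernel[OF module_E module_E \<delta> baer_E])
        fix P y assume P: "primeideal P R" and y: "y \<in> \<delta> i ` carrier (E i)"
          "\<And>p. p \<in> P \<Longrightarrow> p \<odot>\<^bsub>E (Suc i)\<^esub> y = \<zero>\<^bsub>E (Suc i)\<^esub>"
        obtain a u where au: "a \<in> carrier R" "u \<in> carrier R" "P = colon R (PIdl a) u"
          "\<And>x. x \<in> carrier (E i) \<Longrightarrow> a \<odot>\<^bsub>E i\<^esub> x \<in> C i \<Longrightarrow> \<exists>c\<in>C i. a \<odot>\<^bsub>E i\<^esub> x = a \<odot>\<^bsub>E i\<^esub> c"
          using assms[OF step.hyps(1) P] by blast
        show "\<exists>x\<in>carrier (E i). \<delta> i x = y \<and> (\<forall>p\<in>P. p \<odot>\<^bsub>E i\<^esub> x = \<zero>\<^bsub>E i\<^esub>)"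
          unfolding au(3)
          using step.IH y(2) unfolding C_Suc au(3)
          by (intro lift_annihilated_element[OF module_E module_E \<delta> _ au(1,2,4) y(1)])
      qed
    qed
  qed (rule triv)
qed

lemma annihilator_pure:
  "\<forall>x\<in>carrier (E i). \<zero> \<odot>\<^bsub>E i\<^esub> x \<in> C i \<longrightarrow> (\<exists>c\<in>C i. \<zero> \<odot>\<^bsub>E i\<^esub> x = \<zero> \<odot>\<^bsub>E i\<^esub> c)"
proof -
  interpret Ei: module R "E i" by (rule module_E)
  show ?thesis
    using Ei.submodule_zero[OF C_submodule] by (metis Ei.M.zero_closed Ei.smult_l_null)
qed

lemma cgenideal_zero: "PIdl \<zero> = {\<zero>}"
  unfolding cgenideal_def by force

lemma \<eta>_smult: "r \<in> carrier R \<Longrightarrow> s \<in> carrier R \<Longrightarrow> \<eta> (r \<otimes> s) = r \<odot>\<^bsub>E 0\<^esub> \<eta> s"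
  using lin_maps_smult[OF \<eta>, of r s] by simp

lemma \<eta>_closed: "r \<in> carrier R \<Longrightarrow> \<eta> r \<in> carrier (E 0)"
  using lin_maps_closed[OF \<eta>, of r] by simp

lemma \<eta>_zero: "\<eta> \<zero> = \<zero>\<^bsub>E 0\<^esub>"
  using lin_maps_zero[OF module_regular module_E \<eta>] by simp

text \<open>
  Otherwise all primes are associated, so \<open>R\<close> itself is injective.  Then for \<open>P = (0 : d)\<close> and
  \<open>x \<in> \<mm> - P\<close> the map \<open>xd \<mapsto> d\<close> on \<open>Rxd\<close> is multiplication by some \<open>t\<close>, whence \<open>1 - xt \<in> P\<close>.
\<close>

lemma depth_positive:
  assumes c: "c \<in> carrier R"
  shows "colon R {\<zero>} c \<noteq> \<mm>"
proof
  assume \<mm>: "colon R {\<zero>} c = \<mm>"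
  interpret E0: module R "E 0" by (rule module_E)
  have "\<exists>a\<in>carrier R. \<exists>u\<in>carrier R. P = colon R (PIdl a) u \<and>
        (\<forall>x\<in>carrier (E i). a \<odot>\<^bsub>E i\<^esub> x \<in> C i \<longrightarrow> (\<exists>c\<in>C i. a \<odot>\<^bsub>E i\<^esub> x = a \<odot>\<^bsub>E i\<^esub> c))"
    if P: "primeideal P R" for i P
  proof -
    have "\<exists>u\<in>carrier R. P = colon R (PIdl \<zero>) u"
      unfolding cgenideal_zero
      using nonmaximal_prime_is_annihilator[OF P] \<mm> c by (cases "P = \<mm>") blast+
    then show ?thesis using annihilator_pure[of i] zero_closed by blast
  qed
  then have baer: "baer_injective R (E 0) (C 0)" by (rule cosyzygy_injective)
  obtain P where P: "primeideal P R" "P \<noteq> \<mm>" using exists_nonmaximal_prime by blast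
  interpret P: primeideal P R by (rule P)
  obtain d where d: "d \<in> carrier R" "P = colon R {\<zero>} d"
    using nonmaximal_prime_is_annihilator[OF P] by blast
  obtain x where x: "x \<in> \<mm>" "x \<notin> P" using P prime_le[OF P(1)] by blast
  have xR: "x \<in> carrier R" using x(1) by (rule \<mm>.Icarr)
  have "r \<odot>\<^bsub>E 0\<^esub> \<eta> d = \<zero>\<^bsub>E 0\<^esub>" if r: "r \<in> carrier R" "r \<otimes> (x \<otimes> d) \<in> {\<zero>}" for r
  proof -
    have "r \<otimes> x \<in> colon R {\<zero>} d"
      unfolding colon_iff using r xR d(1) m_assoc[OF r(1) xR d(1)] by simp
    then have "r \<in> P" using P.I_prime[OF r(1) xR] x(2) d(2) by blast
    then have "r \<otimes> d = \<zero>" unfolding d(2) colon_iff by blast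
    then show ?thesis using \<eta>_smult[OF r(1) d(1)] \<eta>_zero by simp
  qed
  then obtain e where e: "e \<in> C 0" "\<eta> d = (x \<otimes> d) \<odot>\<^bsub>E 0\<^esub> e"
    using baer_injective_divide[OF module_E baer C_submodule zeroideal m_closed[OF xR d(1)], of "\<eta> d"]
      C_0 d(1) by blast
  then obtain t where t: "t \<in> carrier R" "e = \<eta> t" using C_0 by blast
  have "\<eta> d = \<eta> (x \<otimes> d \<otimes> t)" using e(2) t \<eta>_smult[OF m_closed[OF xR d(1)] t(1)] by simp
  then have "d = x \<otimes> d \<otimes> t" using \<eta>_inj d(1) xR t(1) by (simp add: inj_on_eq_iff)
  moreover have "(\<one> \<ominus> x \<otimes> t) \<otimes> d = d \<ominus> x \<otimes> d \<otimes> t" using d(1) xR t(1) by algebra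
  ultimately have "(\<one> \<ominus> x \<otimes> t) \<otimes> d = \<zero>" using d(1) by (simp add: r_right_minus_eq)
  then have "\<one> \<ominus> x \<otimes> t \<in> P" unfolding d(2) colon_iff using xR t(1) by simp
  then have "\<one> \<ominus> x \<otimes> t \<in> \<mm>" using prime_le[OF P(1)] by blast
  then have "(\<one> \<ominus> x \<otimes> t) \<oplus> x \<otimes> t \<in> \<mm>" using \<mm>.I_r_closed[OF x(1) t(1)] by (rule \<mm>.a_closed)
  moreover have "(\<one> \<ominus> x \<otimes> t) \<oplus> x \<otimes> t = \<one>" using xR t(1) by algebra
  ultimately show False using prime_ideal_le(3)[OF \<mm>_prime] by simp
qed

lemma regular_element_exists: "\<exists>a\<in>\<mm>. \<forall>x\<in>carrier R. a \<otimes> x = \<zero> \<longrightarrow> x = \<zero>"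
  by (rule exists_regular_element[OF depth_positive])

context
  fixes a
  assumes a: "a \<in> \<mm>" and regular: "\<And>x. x \<in> carrier R \<Longrightarrow> a \<otimes> x = \<zero> \<Longrightarrow> x = \<zero>"
begin

lemma regular_element_closed: "a \<in> carrier R"
  using a by (rule \<mm>.Icarr)

lemma mem_cgenideal_iff: "x \<in> PIdl a \<longleftrightarrow> (\<exists>s\<in>carrier R. x = s \<otimes> a)"
  unfolding cgenideal_def by blast

lemma ideal_a: "ideal (PIdl a) R"
  by (rule cgenideal_ideal[OF regular_element_closed])

text \<open>
  Some \<open>(aR : u)\<close> is prime.  If it is not \<open>\<mm>\<close>, it is an annihilator, but it contains the regular element
  \<open>a\<close>.
\<close>

lemma maximal_is_colon: "\<exists>u\<in>carrier R. \<mm> = colon R (PIdl a) u"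
proof -
  have "PIdl a \<subseteq> \<mm>" using cgenideal_minimal[OF \<mm>.is_ideal a] .
  then obtain u where u: "u \<in> carrier R" "primeideal (colon R (PIdl a) u) R"
    using prime_colon_below[OF ideal_a \<mm>_prime] by blast
  have "colon R (PIdl a) u = \<mm>"
  proof (rule ccontr)
    assume "colon R (PIdl a) u \<noteq> \<mm>"
    then obtain c where c: "c \<in> carrier R" "colon R (PIdl a) u = colon R {\<zero>} c"
      using nonmaximal_prime_is_annihilator[OF u(2)] by blast
    have "a \<in> colon R (PIdl a) u"
      unfolding colon_iff mem_cgenideal_iff using regular_element_closed u(1) m_comm by blast
    then have "a \<otimes> c = \<zero>" unfolding c(2) colon_iff by blast
    then have "c = \<zero>" using regular c(1) by blast
    then have "colon R {\<zero>} c = carrier R" unfolding colon_def by auto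
    then show False using c(2) prime_ideal_le(2)[OF u(2)] by simp
  qed
  then show ?thesis using u(1) by blast
qed

lemma injective_divisible:
  assumes "x \<in> carrier (E i)"
  shows "\<exists>y\<in>carrier (E i). x = a \<odot>\<^bsub>E i\<^esub> y"
proof -
  interpret Ei: module R "E i" by (rule module_E)
  have "r \<odot>\<^bsub>E i\<^esub> x = \<zero>\<^bsub>E i\<^esub>" if "r \<in> carrier R" "r \<otimes> a \<in> {\<zero>}" for r
    using regular[OF that(1)] that regular_element_closed assms m_comm[of r a] by simp
  then show ?thesis
    using baer_injective_divide[OF module_E baer_E Ei.carrier_is_submodule zeroideal regular_element_closed assms] by blast
qed

text \<open>
  Beyond the first step the cosyzygies are divisible by \<open>a\<close>, which takes care of \<open>\<mm> = (aR : u)\<close>.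
\<close>

lemma first_cosyzygy_injective: "baer_injective R (E 1) (C 1)"
proof (rule cosyzygy_injective)
  fix i :: nat and P assume i: "1 \<le> i" and P: "primeideal P R"
  show "\<exists>b\<in>carrier R. \<exists>u\<in>carrier R. P = colon R (PIdl b) u \<and>
        (\<forall>x\<in>carrier (E i). b \<odot>\<^bsub>E i\<^esub> x \<in> C i \<longrightarrow> (\<exists>c\<in>C i. b \<odot>\<^bsub>E i\<^esub> x = b \<odot>\<^bsub>E i\<^esub> c))"
  proof (cases "P = \<mm>")
    case False
    then have "\<exists>u\<in>carrier R. P = colon R (PIdl \<zero>) u"
      unfolding cgenideal_zero by (rule nonmaximal_prime_is_annihilator[OF P])
    then show ?thesis using annihilator_pure[of i] zero_closed by blast
  next
    case True
    obtain j where j: "i = Suc j" using i by (cases i) auto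
    have "\<exists>c\<in>C i. y = a \<odot>\<^bsub>E i\<^esub> c" if y: "y \<in> C i" for y
    proof -
      obtain v where v: "v \<in> carrier (E j)" "y = \<delta> j v" using y unfolding j C_Suc by blast
      obtain v' where v': "v' \<in> carrier (E j)" "v = a \<odot>\<^bsub>E j\<^esub> v'" using injective_divisible[OF v(1)] by blast
      have "y = a \<odot>\<^bsub>E i\<^esub> \<delta> j v'"
        unfolding v(2) v'(2) j by (rule lin_maps_smult[OF \<delta> regular_element_closed v'(1)])
      then show ?thesis using v'(1) unfolding j C_Suc by blast
    qed
    then show ?thesis using maximal_is_colon regular_element_closed True by blast
  qed
qed

text \<open>
  The map \<open>I + Rv \<rightarrow> R/aR\<close> that kills \<open>I\<close> and sends \<open>v\<close> to \<open>u\<close> is multiplication by some \<open>w\<close>, because \<open>R/aR\<close> is a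
  direct summand of the part of \<open>C 1\<close> killed by \<open>a\<close>.  With \<open>ae = \<eta>(1)\<close>, the inclusion is \<open>1 \<mapsto> \<delta>(e)\<close>, and the
  retraction sends \<open>\<delta>(x)\<close> to the \<open>w\<close> with \<open>ax = \<eta>(w)\<close>.
\<close>

lemma quotient_self_injective:
  assumes I: "ideal I R" and aI: "a \<in> I" and v: "v \<in> carrier R" and u: "u \<in> carrier R"
    and compat: "\<And>r. r \<in> carrier R \<Longrightarrow> r \<otimes> v \<in> I \<Longrightarrow> r \<otimes> u \<in> PIdl a"
  shows "\<exists>w\<in>carrier R. (\<forall>i\<in>I. i \<otimes> w \<in> PIdl a) \<and> v \<otimes> w \<ominus> u \<in> PIdl a"
proof -
  interpret I: ideal I R by (rule I)
  interpret E0: module R "E 0" by (rule module_E)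
  interpret E1: module R "E (Suc 0)" by (rule module_E)
  note aR = regular_element_closed
  have \<delta>0: "\<delta> 0 \<in> lin_maps R (E 0) (E (Suc 0))" by (rule \<delta>)
  have C1: "C 1 = \<delta> 0 ` carrier (E 0)" using C_Suc[of 0] by simp
  have kernel: "\<exists>t\<in>carrier R. x = \<eta> t" if "x \<in> carrier (E 0)" "\<delta> 0 x = \<zero>\<^bsub>E (Suc 0)\<^esub>" for x
  proof -
    have "x \<in> C 0" using that by (simp add: a_kernel_def')
    then show ?thesis unfolding C_0 by blast
  qed
  have \<delta>_\<eta>: "\<delta> 0 (\<eta> t) = \<zero>\<^bsub>E (Suc 0)\<^esub>" if t: "t \<in> carrier R" for t
  proof -
    have "\<eta> t \<in> C 0" unfolding C_0 using t by blast
    then show ?thesis by (simp add: a_kernel_def')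
  qed
  obtain e where e: "e \<in> carrier (E 0)" "\<eta> \<one> = a \<odot>\<^bsub>E 0\<^esub> e"
    using injective_divisible[OF \<eta>_closed[OF one_closed]] by blast
  have \<eta>_eq: "\<eta> r = r \<odot>\<^bsub>E 0\<^esub> \<eta> \<one>" if "r \<in> carrier R" for r
    using \<eta>_smult[OF that one_closed] that by simp
  have ue: "u \<odot>\<^bsub>E 0\<^esub> e \<in> carrier (E 0)" using u e(1) by simp
  let ?y = "\<delta> 0 (u \<odot>\<^bsub>E 0\<^esub> e)"
  have y: "?y \<in> C 1" unfolding C1 using ue by blast
  have "r \<odot>\<^bsub>E (Suc 0)\<^esub> ?y = \<zero>\<^bsub>E (Suc 0)\<^esub>" if r: "r \<in> carrier R" "r \<otimes> v \<in> I" for r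
  proof -
    obtain s where s: "s \<in> carrier R" "r \<otimes> u = s \<otimes> a"
      using compat[OF r] mem_cgenideal_iff by blast
    have "r \<odot>\<^bsub>E 0\<^esub> (u \<odot>\<^bsub>E 0\<^esub> e) = s \<odot>\<^bsub>E 0\<^esub> \<eta> \<one>"
      unfolding e(2) using E0.smult_assoc1[OF r(1) u e(1)] E0.smult_assoc1[OF s(1) aR e(1)] s(2) by simp
    then have "r \<odot>\<^bsub>E 0\<^esub> (u \<odot>\<^bsub>E 0\<^esub> e) = \<eta> s" using \<eta>_eq[OF s(1)] by simp
    then show ?thesis using lin_maps_smult[OF \<delta>0 r(1) ue] \<delta>_\<eta>[OF s(1)] by simp
  qed
  then obtain c where c: "c \<in> C 1" "\<forall>j\<in>I. j \<odot>\<^bsub>E (Suc 0)\<^esub> c = \<zero>\<^bsub>E (Suc 0)\<^esub>" "?y = v \<odot>\<^bsub>E (Suc 0)\<^esub> c"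
    using baer_injective_divide[OF module_E first_cosyzygy_injective C_submodule I v y] by auto
  then obtain x where x: "x \<in> carrier (E 0)" "c = \<delta> 0 x" unfolding C1 by blast
  have killed: "\<exists>t\<in>carrier R. i \<odot>\<^bsub>E 0\<^esub> x = \<eta> t" if i: "i \<in> I" for i
  proof (rule kernel)
    show "i \<odot>\<^bsub>E 0\<^esub> x \<in> carrier (E 0)" using I.Icarr[OF i] x(1) by simp
    show "\<delta> 0 (i \<odot>\<^bsub>E 0\<^esub> x) = \<zero>\<^bsub>E (Suc 0)\<^esub>"
      using lin_maps_smult[OF \<delta>0 I.Icarr[OF i] x(1)] c(2) i x(2) by simp
  qed
  obtain w where w: "w \<in> carrier R" "a \<odot>\<^bsub>E 0\<^esub> x = \<eta> w" using killed[OF aI] by blast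
  \<comment> \<open>Multiplication by \<open>a\<close> turns relations in \<open>E 0\<close> into relations in \<open>\<eta>(R)\<close>, as \<open>ae = \<eta>(1)\<close> and \<open>ax = \<eta>(w)\<close>.\<close>
  have mult_a: "r \<otimes> w \<ominus> s = t \<otimes> a"
    if r: "r \<in> carrier R" and s: "s \<in> carrier R" and t: "t \<in> carrier R"
      and eq: "r \<odot>\<^bsub>E 0\<^esub> x = s \<odot>\<^bsub>E 0\<^esub> e \<oplus>\<^bsub>E 0\<^esub> \<eta> t" for r s t
  proof -
    have se: "s \<odot>\<^bsub>E 0\<^esub> e \<in> carrier (E 0)" using s e(1) by simp
    have "\<eta> (r \<otimes> w) = a \<odot>\<^bsub>E 0\<^esub> (r \<odot>\<^bsub>E 0\<^esub> x)"
      using \<eta>_smult[OF r w(1)] w(2) E0.smult_assoc1[OF r aR x(1)] E0.smult_assoc1[OF aR r x(1)] m_comm[OF r aR] by simp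
    also have "\<dots> = a \<odot>\<^bsub>E 0\<^esub> (s \<odot>\<^bsub>E 0\<^esub> e) \<oplus>\<^bsub>E 0\<^esub> a \<odot>\<^bsub>E 0\<^esub> \<eta> t"
      unfolding eq by (rule E0.smult_r_distr[OF aR se \<eta>_closed[OF t]])
    also have "a \<odot>\<^bsub>E 0\<^esub> (s \<odot>\<^bsub>E 0\<^esub> e) = \<eta> s"
      using E0.smult_assoc1[OF s aR e(1)] E0.smult_assoc1[OF aR s e(1)] m_comm[OF s aR] \<eta>_eq[OF s] e(2) by simp
    also have "a \<odot>\<^bsub>E 0\<^esub> \<eta> t = \<eta> (a \<otimes> t)" using \<eta>_smult[OF aR t] by simp
    also have "\<eta> s \<oplus>\<^bsub>E 0\<^esub> \<eta> (a \<otimes> t) = \<eta> (s \<oplus> a \<otimes> t)"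
      using lin_maps_add[OF \<eta>, of s "a \<otimes> t"] s aR t by simp
    finally have "r \<otimes> w = s \<oplus> a \<otimes> t"
      using \<eta>_inj r w(1) s aR t by (simp add: inj_on_eq_iff)
    then show ?thesis using r w(1) s aR t by simp algebra
  qed
  have wI: "i \<otimes> w \<in> PIdl a" if i: "i \<in> I" for i
  proof -
    obtain t where t: "t \<in> carrier R" "i \<odot>\<^bsub>E 0\<^esub> x = \<eta> t" using killed[OF i] by blast
    have "i \<odot>\<^bsub>E 0\<^esub> x = \<zero> \<odot>\<^bsub>E 0\<^esub> e \<oplus>\<^bsub>E 0\<^esub> \<eta> t" using t \<eta>_closed e(1) by simp
    then have "i \<otimes> w \<ominus> \<zero> = t \<otimes> a" by (rule mult_a[OF I.Icarr[OF i] zero_closed t(1)])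
    then have "i \<otimes> w = t \<otimes> a" using I.Icarr[OF i] w(1) by (simp add: minus_eq)
    then show ?thesis using mem_cgenideal_iff t(1) by blast
  qed
  have vx: "v \<odot>\<^bsub>E 0\<^esub> x \<in> carrier (E 0)" using v x(1) by simp
  have "\<delta> 0 (v \<odot>\<^bsub>E 0\<^esub> x \<ominus>\<^bsub>E 0\<^esub> u \<odot>\<^bsub>E 0\<^esub> e) = ?y \<ominus>\<^bsub>E (Suc 0)\<^esub> ?y"
    using lin_maps_minus[OF module_E module_E \<delta>0 vx ue] lin_maps_smult[OF \<delta>0 v x(1)] c(3) x(2) by simp
  also have "\<dots> = \<zero>\<^bsub>E (Suc 0)\<^esub>"
    using lin_maps_closed[OF \<delta>0 ue] by (simp add: E1.M.minus_eq E1.M.r_neg)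
  finally obtain t where t: "t \<in> carrier R" "v \<odot>\<^bsub>E 0\<^esub> x \<ominus>\<^bsub>E 0\<^esub> u \<odot>\<^bsub>E 0\<^esub> e = \<eta> t"
    using kernel[OF E0.M.minus_closed[OF vx ue]] by blast
  have "v \<odot>\<^bsub>E 0\<^esub> x = u \<odot>\<^bsub>E 0\<^esub> e \<oplus>\<^bsub>E 0\<^esub> \<eta> t"
    using E0.minus_add_cancel[OF vx ue] ue \<eta>_closed[OF t(1)] unfolding t(2) by (simp add: E0.M.a_comm)
  then have "v \<otimes> w \<ominus> u = t \<otimes> a" by (rule mult_a[OF v u t(1)])
  then have "v \<otimes> w \<ominus> u \<in> PIdl a" using mem_cgenideal_iff t(1) by blast
  then show ?thesis using w(1) wI by blast
qed

text \<open>
  Since \<open>(aR : v) \<subseteq> \<mm>\<close> kills \<open>u\<close> modulo \<open>aR\<close>, the map \<open>v \<mapsto> u\<close> is well defined on \<open>(aR + Rv)/aR\<close>; then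
  self-injectivity of \<open>R/aR\<close> applies.
\<close>

lemma socle_generated_by_one:
  assumes v: "v \<in> carrier R" "v \<notin> PIdl a"
    and u: "u \<in> carrier R" "\<And>b. b \<in> \<mm> \<Longrightarrow> b \<otimes> u \<in> PIdl a"
  shows "\<exists>w\<in>carrier R. v \<otimes> w \<ominus> u \<in> PIdl a"
proof -
  have "colon R (PIdl a) v \<subseteq> \<mm>"
    using proper_ideal_le[OF colon_ideal[OF ideal_a v(1)]] colon_eq_carrier_iff[OF ideal_a v(1)] v(2) by blast
  then have "r \<otimes> u \<in> PIdl a" if "r \<in> carrier R" "r \<otimes> v \<in> PIdl a" for r
    using that u(2) unfolding subset_iff colon_iff by blast
  then show ?thesis
    using quotient_self_injective[OF ideal_a cgenideal_self[OF regular_element_closed] v(1) u(1)] by blast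
qed

text \<open>
  Otherwise some multiple \<open>v\<close> of \<open>z\<close> generates a copy of the residue field in \<open>R/I\<close>, and a map
  \<open>R/I \<supseteq> Rv \<rightarrow> R/aR\<close> onto the socle is multiplication by some \<open>w \<in> (aR : I)\<close> with \<open>vw \<notin> aR\<close>.
\<close>

lemma double_annihilator:
  assumes I: "ideal I R" and aI: "a \<in> I" and primary: "\<And>P. primeideal P R \<Longrightarrow> I \<subseteq> P \<Longrightarrow> P = \<mm>"
    and z: "z \<in> carrier R" "\<And>w. w \<in> carrier R \<Longrightarrow> (\<And>i. i \<in> I \<Longrightarrow> i \<otimes> w \<in> PIdl a) \<Longrightarrow> z \<otimes> w \<in> PIdl a"
  shows "z \<in> I"
proof (rule ccontr)
  assume zI: "z \<notin> I"
  interpret I: ideal I R by (rule I)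
  interpret A: ideal "PIdl a" R by (rule ideal_a)
  have "colon R I z \<noteq> carrier R" using colon_eq_carrier_iff[OF I z(1)] zI by blast
  then obtain c where c: "c \<in> carrier R" "primeideal (colon R (colon R I z) c) R"
    using prime_colon[OF colon_ideal[OF I z(1)]] by blast
  let ?v = "c \<otimes> z"
  have v: "?v \<in> carrier R" using c(1) z(1) by simp
  have "I \<subseteq> colon R I ?v"
    using I.I_r_closed[OF _ v] I.Icarr unfolding subset_iff colon_iff by blast
  then have v\<mm>: "colon R I ?v = \<mm>"
    using primary c(2) unfolding colon_mult[OF z(1) c(1)] by blast
  obtain u where u: "u \<in> carrier R" "\<mm> = colon R (PIdl a) u" using maximal_is_colon by blast
  have ua: "u \<notin> PIdl a"
    using colon_eq_carrier_iff[OF ideal_a u(1)] u(2) \<mm>.I_notcarr by auto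
  have "r \<otimes> u \<in> PIdl a" if r: "r \<in> carrier R" "r \<otimes> ?v \<in> I" for r
  proof -
    have "r \<in> colon R I ?v" unfolding colon_iff using r by blast
    then have "r \<in> colon R (PIdl a) u" using v\<mm> u(2) by blast
    then show ?thesis unfolding colon_iff by blast
  qed
  then obtain w where w: "w \<in> carrier R" "\<forall>i\<in>I. i \<otimes> w \<in> PIdl a" "?v \<otimes> w \<ominus> u \<in> PIdl a"
    using quotient_self_injective[OF I aI v u(1)] by blast
  have "z \<otimes> w \<in> PIdl a" using z(2) w by blast
  then have "c \<otimes> (z \<otimes> w) \<in> PIdl a" by (rule A.I_l_closed[OF _ c(1)])
  then have "c \<otimes> (z \<otimes> w) \<oplus> \<ominus> (?v \<otimes> w \<ominus> u) \<in> PIdl a"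
    using A.a_closed A.a_inv_closed[OF w(3)] by blast
  moreover have "c \<otimes> (z \<otimes> w) \<oplus> \<ominus> (?v \<otimes> w \<ominus> u) = u"
    using c(1) z(1) w(1) u(1) by algebra
  ultimately show False using ua by simp
qed

end

end

section \<open>Quotients by primary ideals\<close>

lemma noetherian_ring_image:
  assumes "ring_hom_ring R S h" and onto: "h ` carrier R = carrier S" and noeth: "noetherian_ring R"
  shows "noetherian_ring S"
proof -
  interpret h: ring_hom_ring R S h by fact
  interpret R: noetherian_ring R by fact
  show ?thesis
  proof (rule h.S.noetherian_ringI)
    fix J assume J: "ideal J S"
    let ?pre = "\<lambda>K. {r \<in> carrier R. h r \<in> K}"
    have "J \<subseteq> h ` carrier R" unfolding onto using ideal.Icarr[OF J] by (rule subsetI)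
    then have J_eq: "J = h ` ?pre J" by blast
    obtain A where A: "A \<subseteq> carrier R" "finite A" "?pre J = Idl\<^bsub>R\<^esub> A"
      using R.finetely_gen[OF h.ideal_vimage[OF J]] by blast
    have hA: "h ` A \<subseteq> carrier S" using A(1) by auto
    have "A \<subseteq> ?pre J" unfolding A(3) by (rule h.R.genideal_self[OF A(1)])
    then have "h ` A \<subseteq> J" by blast
    then have "Idl\<^bsub>S\<^esub> (h ` A) \<subseteq> J" by (rule h.S.genideal_minimal[OF J])
    moreover have "J \<subseteq> Idl\<^bsub>S\<^esub> (h ` A)"
    proof -
      have K: "ideal (Idl\<^bsub>S\<^esub> (h ` A)) S" by (rule h.S.genideal_ideal[OF hA])
      have hA_self: "h ` A \<subseteq> Idl\<^bsub>S\<^esub> (h ` A)" by (rule h.S.genideal_self[OF hA])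
      have "A \<subseteq> ?pre (Idl\<^bsub>S\<^esub> (h ` A))"
        by (intro subsetI CollectI conjI subsetD[OF A(1)] subsetD[OF hA_self] imageI)
      then have "?pre J \<subseteq> ?pre (Idl\<^bsub>S\<^esub> (h ` A))"
        unfolding A(3) by (rule h.R.genideal_minimal[OF h.ideal_vimage[OF K]])
      then have "h ` ?pre J \<subseteq> Idl\<^bsub>S\<^esub> (h ` A)" by auto
      then show ?thesis unfolding J_eq[symmetric] .
    qed
    ultimately have "J = Idl\<^bsub>S\<^esub> (h ` A)" by (rule equalityI[rotated])
    then show "\<exists>A\<subseteq>carrier S. finite A \<and> J = Idl\<^bsub>S\<^esub> A"
      using hA A(2) by (intro exI[of _ "h ` A"] conjI finite_imageI)
  qed
qed

text \<open>
  A nonzero Noetherian ring has a maximal ideal, so uniqueness is all that has to be checked.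
\<close>

lemma local_noetherian_ringI:
  assumes S: "cring S" "noetherian_ring S" and ne: "\<one>\<^bsub>S\<^esub> \<noteq> \<zero>\<^bsub>S\<^esub>"
    and unique: "\<And>J. maximalideal J S \<Longrightarrow> J = \<nn>"
  shows "local_noetherian_ring S \<nn>"
proof -
  interpret noetherian_cring S using S by (rule noetherian_cring.intro)
  have "{\<zero>\<^bsub>S\<^esub>} \<noteq> carrier S" using ne one_closed by blast
  then obtain M where "maximalideal M S" using exists_maximal_ideal[OF zeroideal] by blast
  then have "maximalideal \<nn> S" using unique by blast
  then show ?thesis
    using S unique by (intro local_noetherian_ring.intro local_noetherian_ring_axioms.intro)
qed

lemma krull_dim_eq_chain_length: "krull_dim R = chain_length (\<lambda>P. primeideal P R)"
  by (simp add: krull_dim_def chain_length_def)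

text \<open>
  The last condition says that \<open>I\<close> is \<open>\<mm>\<close>-primary; in this form it gives the spectrum of \<open>R/I\<close> at once.
\<close>

locale local_ring_mod_primary = local_noetherian_ring +
  fixes I
  assumes I: "ideal I R" and I_proper: "I \<noteq> carrier R"
    and primary: "\<And>P. primeideal P R \<Longrightarrow> I \<subseteq> P \<Longrightarrow> P = \<mm>"
begin

sublocale I: ideal I R by (rule I)

lemma I_le: "I \<subseteq> \<mm>"
  by (rule proper_ideal_le[OF I I_proper])

abbreviation "Q \<equiv> R Quot I"
abbreviation "cl \<equiv> (\<lambda>x. I +> x)"

lemma cring_Q: "cring Q"
  by (rule I.quotient_is_cring[OF is_cring])

lemma cl_hom: "ring_hom_ring R Q cl"
  by (rule I.rcos_ring_hom_ring)

lemma carrier_Q: "carrier Q = cl ` carrier R"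
  by (auto simp: FactRing_def A_RCOSETS_def')

lemma cl_eq_zero_iff: "x \<in> carrier R \<Longrightarrow> cl x = \<zero>\<^bsub>Q\<^esub> \<longleftrightarrow> x \<in> I"
  using a_coset_join1[OF _ _ I.a_subgroup, of x] a_coset_join2[OF _ I.a_subgroup, of x]
  unfolding FactRing_def ring.simps by blast

lemma I_le_preimage:
  assumes "\<zero>\<^bsub>Q\<^esub> \<in> J" shows "I \<subseteq> {r \<in> carrier R. cl r \<in> J}"
proof (intro subsetI CollectI conjI I.Icarr)
  fix x assume x: "x \<in> I"
  then have "cl x = \<zero>\<^bsub>Q\<^esub>" using cl_eq_zero_iff[OF I.Icarr[OF x]] by (rule iffD2[rotated])
  then show "cl x \<in> J" using assms by simp
qed

lemma cl_mult: "x \<in> carrier R \<Longrightarrow> y \<in> carrier R \<Longrightarrow> cl x \<otimes>\<^bsub>Q\<^esub> cl y = cl (x \<otimes> y)"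
  by (simp add: FactRing_def I.rcoset_mult_add)

lemma preimage_image:
  assumes "ideal J R" "I \<subseteq> J"
  shows "{r \<in> carrier R. cl r \<in> cl ` J} = J"
proof -
  interpret J: ideal J R by fact
  show ?thesis
  proof (intro equalityI subsetI)
    fix r assume "r \<in> {r \<in> carrier R. cl r \<in> cl ` J}"
    then obtain j where r: "r \<in> carrier R" "j \<in> J" "cl r = cl j" by blast
    have "r \<in> cl j" using I.a_rcos_self[OF r(1)] unfolding r(3) .
    then have "\<exists>i\<in>I. r = i \<oplus> j" unfolding a_r_coset_def' by blast
    then obtain i where i: "i \<in> I" "r = i \<oplus> j" by (elim bexE)
    show "r \<in> J" unfolding i(2) using subsetD[OF assms(2) i(1)] r(2) by (rule J.a_closed)
  next
    fix r assume "r \<in> J"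
    then show "r \<in> {r \<in> carrier R. cl r \<in> cl ` J}" by (intro CollectI conjI J.Icarr imageI)
  qed
qed

lemma image_preimage:
  assumes "J \<subseteq> carrier Q"
  shows "cl ` {r \<in> carrier R. cl r \<in> J} = J"
proof (intro equalityI subsetI)
  fix x assume x: "x \<in> J"
  then have "x \<in> cl ` carrier R" using assms unfolding carrier_Q by (rule subsetD[rotated])
  then show "x \<in> cl ` {r \<in> carrier R. cl r \<in> J}" using x by (elim imageE) simp
qed auto

lemma prime_Q_eq:
  assumes "primeideal P Q" shows "P = cl ` \<mm>"
proof -
  interpret cl: ring_hom_ring R Q cl by (rule cl_hom)
  interpret P: primeideal P Q by fact
  have "{r \<in> carrier R. cl r \<in> P} = \<mm>"
  proof (rule primary)
    show "primeideal {r \<in> carrier R. cl r \<in> P} R"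
      by (rule cl.primeideal_vimage[OF is_cring assms])
    show "I \<subseteq> {r \<in> carrier R. cl r \<in> P}"
      by (rule I_le_preimage[OF P.zero_closed])
  qed
  then show ?thesis using image_preimage[OF P.a_subset] by simp
qed

lemma local_noetherian_Q: "local_noetherian_ring Q (cl ` \<mm>)"
proof (rule local_noetherian_ringI[OF cring_Q])
  show "noetherian_ring Q"
    by (rule noetherian_ring_image[OF cl_hom carrier_Q[symmetric] noetherian_ring_axioms])
  show "\<one>\<^bsub>Q\<^esub> \<noteq> \<zero>\<^bsub>Q\<^esub>"
  proof
    assume "\<one>\<^bsub>Q\<^esub> = \<zero>\<^bsub>Q\<^esub>"
    then have "cl \<one> = \<zero>\<^bsub>Q\<^esub>" by (simp add: FactRing_def)
    then have "\<one> \<in> I" using cl_eq_zero_iff[OF one_closed] by (rule iffD1[rotated])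
    then show False using I_proper I.one_imp_carrier by (elim notE)
  qed
  show "J = cl ` \<mm>" if "maximalideal J Q" for J
    by (rule prime_Q_eq[OF cring.maximalideal_prime[OF cring_Q that]])
qed

lemma krull_dim_Q: "krull_dim Q = 0"
  unfolding krull_dim_eq_chain_length using prime_Q_eq by (rule chain_length_le_zero)

lemma ring_type_Q:
  "ring_type Q = chain_length (\<lambda>H. ideal H R \<and> I \<subseteq> H \<and> H \<subseteq> {x \<in> carrier R. \<forall>b\<in>\<mm>. b \<otimes> x \<in> I})"
proof -
  interpret Q: local_noetherian_ring Q "cl ` \<mm>" by (rule local_noetherian_Q)
  interpret cl: ring_hom_ring R Q cl by (rule cl_hom)
  let ?S = "{x \<in> carrier R. \<forall>b\<in>\<mm>. b \<otimes> x \<in> I}"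
  let ?T = "{x \<in> carrier Q. \<forall>b\<in>cl ` \<mm>. b \<otimes>\<^bsub>Q\<^esub> x = \<zero>\<^bsub>Q\<^esub>}"
  have T_iff: "cl x \<in> ?T \<longleftrightarrow> x \<in> ?S" if x: "x \<in> carrier R" for x
  proof -
    have "cl b \<otimes>\<^bsub>Q\<^esub> cl x = \<zero>\<^bsub>Q\<^esub> \<longleftrightarrow> b \<otimes> x \<in> I" if b: "b \<in> \<mm>" for b
      using cl_mult[OF \<mm>.Icarr[OF b] x] cl_eq_zero_iff[OF m_closed[OF \<mm>.Icarr[OF b] x]] by simp
    moreover have "cl x \<in> carrier Q" unfolding carrier_Q using x by (rule imageI)
    ultimately show ?thesis using x by simp
  qed
  have "ring_type Q = chain_length (\<lambda>H. ideal H Q \<and> H \<subseteq> ?T)"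
    unfolding ring_type_def using Q.cm_type_dim_0[OF krull_dim_Q Q.module_regular]
    by (simp add: Q.submodule_regular_iff)
  also have "\<dots> = chain_length (\<lambda>H. ideal H R \<and> I \<subseteq> H \<and> H \<subseteq> ?S)"
  proof (rule chain_length_eqI[where g = "\<lambda>K. {r \<in> carrier R. cl r \<in> K}" and h = "\<lambda>H. cl ` H"])
    fix K assume K: "ideal K Q \<and> K \<subseteq> ?T"
    then have KI: "ideal K Q" and KT: "K \<subseteq> ?T" by auto
    have KQ: "K \<subseteq> carrier Q" and K0: "\<zero>\<^bsub>Q\<^esub> \<in> K"
      using additive_subgroup.a_subset[OF ideal.axioms(1)[OF KI]]
        additive_subgroup.zero_closed[OF ideal.axioms(1)[OF KI]] .
    have "{r \<in> carrier R. cl r \<in> K} \<subseteq> ?S"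
    proof
      fix x assume "x \<in> {r \<in> carrier R. cl r \<in> K}"
      then have x: "x \<in> carrier R" "cl x \<in> K" by simp_all
      show "x \<in> ?S" using T_iff[OF x(1)] subsetD[OF KT x(2)] by (rule iffD1)
    qed
    then show "ideal {r \<in> carrier R. cl r \<in> K} R \<and> I \<subseteq> {r \<in> carrier R. cl r \<in> K} \<and> {r \<in> carrier R. cl r \<in> K} \<subseteq> ?S"
      by (intro conjI cl.ideal_vimage[OF KI] I_le_preimage[OF K0])
    show "cl ` {r \<in> carrier R. cl r \<in> K} = K" by (rule image_preimage[OF KQ])
  next
    fix H assume H: "ideal H R \<and> I \<subseteq> H \<and> H \<subseteq> ?S"
    then have HI: "ideal H R" and IH: "I \<subseteq> H" and HS: "H \<subseteq> ?S" by auto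
    have "cl ` H \<subseteq> ?T"
    proof (rule image_subsetI)
      fix x assume "x \<in> H"
      then have x: "x \<in> ?S" by (rule subsetD[OF HS])
      then have "x \<in> carrier R" by simp
      from T_iff[OF this] x show "cl x \<in> ?T" by (rule iffD2)
    qed
    then show "ideal (cl ` H) Q \<and> cl ` H \<subseteq> ?T"
      by (intro conjI ring_ideal_imp_quot_ideal[OF I HI])
    show "{r \<in> carrier R. cl r \<in> cl ` H} = H" by (rule preimage_image[OF HI IH])
  qed auto
  finally show ?thesis .
qed

end

section \<open>Idealizations\<close>

locale module_idealization = module R M for R :: "('a, 'c) ring_scheme" (structure) and M :: "('a, 'b) module" (structure)
begin

abbreviation "A \<equiv> idealization R M"

lemma A_simps:
  "carrier A = carrier R \<times> carrier M"
  "(a, x) \<otimes>\<^bsub>A\<^esub> (b, y) = (a \<otimes>\<^bsub>R\<^esub> b, a \<odot>\<^bsub>M\<^esub> y \<oplus>\<^bsub>M\<^esub> b \<odot>\<^bsub>M\<^esub> x)"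
  "\<one>\<^bsub>A\<^esub> = (\<one>\<^bsub>R\<^esub>, \<zero>\<^bsub>M\<^esub>)" "\<zero>\<^bsub>A\<^esub> = (\<zero>\<^bsub>R\<^esub>, \<zero>\<^bsub>M\<^esub>)"
  "(a, x) \<oplus>\<^bsub>A\<^esub> (b, y) = (a \<oplus>\<^bsub>R\<^esub> b, x \<oplus>\<^bsub>M\<^esub> y)"
  by (simp_all add: idealization_def)

lemma cring_A: "cring A"
proof (rule cringI)
  show "abelian_group A"
  proof (rule abelian_groupI)
    fix z assume "z \<in> carrier A"
    then obtain r x where "z = (r, x)" "r \<in> carrier R" "x \<in> carrier M" by (auto simp: A_simps)
    then show "\<exists>w\<in>carrier A. w \<oplus>\<^bsub>A\<^esub> z = \<zero>\<^bsub>A\<^esub>"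
      by (intro bexI[of _ "(\<ominus>\<^bsub>R\<^esub> r, \<ominus>\<^bsub>M\<^esub> x)"]) (simp_all add: A_simps R.l_neg M.l_neg)
  qed (auto simp: A_simps R.a_ac M.a_ac)
  show "comm_monoid A"
  proof (rule comm_monoidI)
    fix u v w assume "u \<in> carrier A" "v \<in> carrier A" "w \<in> carrier A"
    then obtain a x b y c z where *: "u = (a, x)" "v = (b, y)" "w = (c, z)"
      "a \<in> carrier R" "b \<in> carrier R" "c \<in> carrier R" "x \<in> carrier M" "y \<in> carrier M" "z \<in> carrier M"
      by (auto simp: A_simps)
    have "(a \<otimes>\<^bsub>R\<^esub> b) \<odot>\<^bsub>M\<^esub> z \<oplus>\<^bsub>M\<^esub> c \<odot>\<^bsub>M\<^esub> (a \<odot>\<^bsub>M\<^esub> y \<oplus>\<^bsub>M\<^esub> b \<odot>\<^bsub>M\<^esub> x)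
      = a \<odot>\<^bsub>M\<^esub> (b \<odot>\<^bsub>M\<^esub> z \<oplus>\<^bsub>M\<^esub> c \<odot>\<^bsub>M\<^esub> y) \<oplus>\<^bsub>M\<^esub> (b \<otimes>\<^bsub>R\<^esub> c) \<odot>\<^bsub>M\<^esub> x"
      using *(4-9) by (simp add: smult_r_distr smult_assoc1[symmetric] R.m_comm M.a_assoc)
    then show "u \<otimes>\<^bsub>A\<^esub> v \<otimes>\<^bsub>A\<^esub> w = u \<otimes>\<^bsub>A\<^esub> (v \<otimes>\<^bsub>A\<^esub> w)"
      unfolding *(1-3) A_simps using *(4-9) by (simp add: R.m_assoc)
  qed (auto simp: A_simps R.m_comm M.a_comm)
  fix u v w assume "u \<in> carrier A" "v \<in> carrier A" "w \<in> carrier A"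
  then obtain a x b y c z where *: "u = (a, x)" "v = (b, y)" "w = (c, z)"
    "a \<in> carrier R" "b \<in> carrier R" "c \<in> carrier R" "x \<in> carrier M" "y \<in> carrier M" "z \<in> carrier M"
    by (auto simp: A_simps)
  then show "(u \<oplus>\<^bsub>A\<^esub> v) \<otimes>\<^bsub>A\<^esub> w = u \<otimes>\<^bsub>A\<^esub> w \<oplus>\<^bsub>A\<^esub> v \<otimes>\<^bsub>A\<^esub> w"
    by (simp add: A_simps R.l_distr smult_l_distr smult_r_distr M.a_ac)
qed

sublocale A: cring A
  rewrites "carrier A = carrier R \<times> carrier M"
  by (rule cring_A) (rule A_simps)

lemma fst_hom: "ring_hom_ring A R fst"
  using cring.axioms(1)[OF cring_A]
  by (intro ring_hom_ringI2 R.ring_axioms ring_hom_memI) (auto simp: A_simps)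

lemma incl_hom: "ring_hom_ring R A (\<lambda>r. (r, \<zero>\<^bsub>M\<^esub>))"
  using cring.axioms(1)[OF cring_A]
  by (intro ring_hom_ringI2 R.ring_axioms ring_hom_memI) (auto simp: A_simps)

lemma ideal_Times_carrier:
  assumes "ideal p R" shows "ideal (p \<times> carrier M) A"
proof -
  have "p \<times> carrier M = {z \<in> carrier A. fst z \<in> p}"
    using ideal.Icarr[OF assms] by (auto simp: A_simps)
  then show ?thesis using ring_hom_ring.ideal_vimage[OF fst_hom assms] by simp
qed

lemma prime_Times_carrier:
  assumes "primeideal p R" shows "primeideal (p \<times> carrier M) A"
proof -
  have "p \<times> carrier M = {z \<in> carrier A. fst z \<in> p}"
    using ideal.Icarr[OF primeideal.axioms(1)[OF assms]] by (auto simp: A_simps)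
  then show ?thesis using ring_hom_ring.primeideal_vimage[OF fst_hom cring_A assms] by simp
qed

text \<open>The ideal \<open>0 \<times> M\<close> has square zero, so it lies in every prime.\<close>

lemma prime_A_eq:
  assumes P: "primeideal P A"
  shows "P = {r \<in> carrier R. (r, \<zero>\<^bsub>M\<^esub>) \<in> P} \<times> carrier M"
    and "primeideal {r \<in> carrier R. (r, \<zero>\<^bsub>M\<^esub>) \<in> P} R"
proof -
  interpret P: primeideal P A by fact
  have nil: "(\<zero>\<^bsub>R\<^esub>, x) \<in> P" if x: "x \<in> carrier M" for x
  proof -
    have "(\<zero>\<^bsub>R\<^esub>, x) \<otimes>\<^bsub>A\<^esub> (\<zero>\<^bsub>R\<^esub>, x) = \<zero>\<^bsub>A\<^esub>" using x by (simp add: A_simps)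
    then have "(\<zero>\<^bsub>R\<^esub>, x) \<otimes>\<^bsub>A\<^esub> (\<zero>\<^bsub>R\<^esub>, x) \<in> P" using P.zero_closed by simp
    then show ?thesis using P.I_prime[of "(\<zero>\<^bsub>R\<^esub>, x)" "(\<zero>\<^bsub>R\<^esub>, x)"] x by (auto simp: A_simps)
  qed
  have add: "(r, x) = (r, y) \<oplus>\<^bsub>A\<^esub> (\<zero>\<^bsub>R\<^esub>, x \<ominus>\<^bsub>M\<^esub> y)" if "r \<in> carrier R" "x \<in> carrier M" "y \<in> carrier M" for r x y
    using minus_add_cancel[OF that(2,3)] that by (simp add: A_simps M.a_comm)
  have "(r, x) \<in> P \<longleftrightarrow> (r, \<zero>\<^bsub>M\<^esub>) \<in> P" if r: "r \<in> carrier R" "x \<in> carrier M" for r x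
    using add[OF r(1,2) M.zero_closed] add[OF r(1) M.zero_closed r(2)]
      P.a_closed[OF _ nil[of "x \<ominus>\<^bsub>M\<^esub> \<zero>\<^bsub>M\<^esub>"]] P.a_closed[OF _ nil[of "\<zero>\<^bsub>M\<^esub> \<ominus>\<^bsub>M\<^esub> x"]] r(2)
      M.minus_closed M.zero_closed by metis
  moreover have "P \<subseteq> carrier R \<times> carrier M" using P.a_subset by (simp add: A_simps)
  ultimately show "P = {r \<in> carrier R. (r, \<zero>\<^bsub>M\<^esub>) \<in> P} \<times> carrier M" by auto
  show "primeideal {r \<in> carrier R. (r, \<zero>\<^bsub>M\<^esub>) \<in> P} R"
    by (rule ring_hom_ring.primeideal_vimage[OF incl_hom R.is_cring P])
qed

lemma krull_dim_A: "krull_dim A = krull_dim R"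
  unfolding krull_dim_eq_chain_length
proof (rule chain_length_eqI[where g = "\<lambda>P. {r \<in> carrier R. (r, \<zero>\<^bsub>M\<^esub>) \<in> P}" and h = "\<lambda>p. p \<times> carrier M"])
  fix P assume P: "primeideal P A"
  show "primeideal {r \<in> carrier R. (r, \<zero>\<^bsub>M\<^esub>) \<in> P} R" by (rule prime_A_eq(2)[OF P])
  show "{r \<in> carrier R. (r, \<zero>\<^bsub>M\<^esub>) \<in> P} \<times> carrier M = P" using prime_A_eq(1)[OF P] by (rule sym)
next
  fix p assume p: "primeideal p R"
  show "primeideal (p \<times> carrier M) A" by (rule prime_Times_carrier[OF p])
  show "{r \<in> carrier R. (r, \<zero>\<^bsub>M\<^esub>) \<in> p \<times> carrier M} = p"
    using ideal.Icarr[OF primeideal.axioms(1)[OF p]] by auto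
qed auto

text \<open>
  If \<open>(r, x) \<in> L\<close> and \<open>(r, y) \<in> K\<close>, then the difference \<open>(0, x - y)\<close> lies in \<open>L\<close>, hence in \<open>K\<close>.
\<close>

lemma ideal_A_le:
  assumes K: "ideal K A" and L: "ideal L A" and KL: "K \<subseteq> L"
    and fst: "fst ` L \<subseteq> fst ` K" and snd: "\<And>x. (\<zero>\<^bsub>R\<^esub>, x) \<in> L \<Longrightarrow> (\<zero>\<^bsub>R\<^esub>, x) \<in> K"
  shows "L \<subseteq> K"
proof (rule subrelI)
  interpret K: ideal K A by fact
  interpret L: ideal L A by fact
  fix r x assume rx: "(r, x) \<in> L"
  then have "r \<in> fst ` K" using fst by force
  then obtain y where y: "(r, y) \<in> K" by force
  have c: "r \<in> carrier R" "x \<in> carrier M" "y \<in> carrier M"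
    using L.Icarr[OF rx] K.Icarr[OF y] by (simp_all add: A_simps)
  have neg: "(\<ominus>\<^bsub>R\<^esub> \<one>\<^bsub>R\<^esub>, \<zero>\<^bsub>M\<^esub>) \<otimes>\<^bsub>A\<^esub> (r, y) \<in> L"
    using L.I_l_closed[of "(r, y)" "(\<ominus>\<^bsub>R\<^esub> \<one>\<^bsub>R\<^esub>, \<zero>\<^bsub>M\<^esub>)"] y KL by (auto simp: A_simps)
  have "(r, x) \<oplus>\<^bsub>A\<^esub> (\<ominus>\<^bsub>R\<^esub> \<one>\<^bsub>R\<^esub>, \<zero>\<^bsub>M\<^esub>) \<otimes>\<^bsub>A\<^esub> (r, y) = (\<zero>\<^bsub>R\<^esub>, x \<ominus>\<^bsub>M\<^esub> y)"
    using c by (simp add: A_simps R.l_minus R.r_neg smult_l_minus M.minus_eq)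
  then have "(\<zero>\<^bsub>R\<^esub>, x \<ominus>\<^bsub>M\<^esub> y) \<in> L" using L.a_closed[OF rx neg] by simp
  then have "(\<zero>\<^bsub>R\<^esub>, x \<ominus>\<^bsub>M\<^esub> y) \<oplus>\<^bsub>A\<^esub> (r, y) \<in> K" using K.a_closed[OF snd y] by blast
  then show "(r, x) \<in> K" using minus_add_cancel[OF c(2,3)] c by (simp add: A_simps)
qed

lemma fst_ideal_A:
  assumes K: "ideal K A" shows "ideal (fst ` K) R"
proof -
  interpret K: ideal K A by fact
  have KA: "K \<subseteq> carrier R \<times> carrier M" using K.a_subset by (simp add: A_simps)
  have "submodule (fst ` K) R (regular_module R)"
  proof (rule module.submoduleI'[OF R.module_regular])
    show "fst ` K \<subseteq> carrier (regular_module R)" using KA by auto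
    show "\<zero>\<^bsub>regular_module R\<^esub> \<in> fst ` K"
      using K.zero_closed by (force simp: A_simps)
  next
    fix r s assume "r \<in> fst ` K" "s \<in> fst ` K"
    then obtain x y where "(r, x) \<in> K" "(s, y) \<in> K" by force
    then have "(r \<oplus>\<^bsub>R\<^esub> s, x \<oplus>\<^bsub>M\<^esub> y) \<in> K" using K.a_closed[of "(r, x)" "(s, y)"] by (simp add: A_simps)
    then show "r \<oplus>\<^bsub>regular_module R\<^esub> s \<in> fst ` K" by force
  next
    fix a r assume a: "a \<in> carrier R" and "r \<in> fst ` K"
    then obtain x where x: "(r, x) \<in> K" by force
    then have "(a, \<zero>\<^bsub>M\<^esub>) \<otimes>\<^bsub>A\<^esub> (r, x) \<in> K"
      using a K.I_l_closed[of "(r, x)" "(a, \<zero>\<^bsub>M\<^esub>)"] by (simp add: A_simps)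
    then show "a \<odot>\<^bsub>regular_module R\<^esub> r \<in> fst ` K" by (force simp: A_simps)
  qed
  then show ?thesis by (simp add: R.submodule_regular_iff)
qed

lemma submodule_of_ideal_A:
  assumes K: "ideal K A" shows "submodule {x \<in> carrier M. (\<zero>\<^bsub>R\<^esub>, x) \<in> K} R M"
proof -
  interpret K: ideal K A by fact
  show ?thesis
  proof (rule submoduleI')
    show "\<zero>\<^bsub>M\<^esub> \<in> {x \<in> carrier M. (\<zero>\<^bsub>R\<^esub>, x) \<in> K}"
      using K.zero_closed by (simp add: A_simps)
  next
    fix x y assume "x \<in> {x \<in> carrier M. (\<zero>\<^bsub>R\<^esub>, x) \<in> K}" "y \<in> {x \<in> carrier M. (\<zero>\<^bsub>R\<^esub>, x) \<in> K}"
    then show "x \<oplus>\<^bsub>M\<^esub> y \<in> {x \<in> carrier M. (\<zero>\<^bsub>R\<^esub>, x) \<in> K}"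
      using K.a_closed[of "(\<zero>\<^bsub>R\<^esub>, x)" "(\<zero>\<^bsub>R\<^esub>, y)"] by (simp add: A_simps)
  next
    fix a x assume "a \<in> carrier R" "x \<in> {x \<in> carrier M. (\<zero>\<^bsub>R\<^esub>, x) \<in> K}"
    then show "a \<odot>\<^bsub>M\<^esub> x \<in> {x \<in> carrier M. (\<zero>\<^bsub>R\<^esub>, x) \<in> K}"
      using K.I_l_closed[of "(\<zero>\<^bsub>R\<^esub>, x)" "(a, \<zero>\<^bsub>M\<^esub>)"] by (simp add: A_simps)
  qed auto
qed

lemma ideal_TimesI:
  assumes p: "ideal p R" and H: "submodule H R M" and pM: "\<And>r x. r \<in> p \<Longrightarrow> x \<in> carrier M \<Longrightarrow> r \<odot>\<^bsub>M\<^esub> x \<in> H"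
  shows "ideal (p \<times> H) A"
proof -
  interpret p: ideal p R by fact
  note E = submoduleE[OF H]
  have "submodule (p \<times> H) A (regular_module A)"
  proof (rule module.submoduleI'[OF A.module_regular])
    show "p \<times> H \<subseteq> carrier (regular_module A)" using E(1) p.a_subset by (auto simp: A_simps)
    show "\<zero>\<^bsub>regular_module A\<^esub> \<in> p \<times> H" using submodule_zero[OF H] by (simp add: A_simps)
  next
    fix u v assume "u \<in> p \<times> H" "v \<in> p \<times> H"
    then show "u \<oplus>\<^bsub>regular_module A\<^esub> v \<in> p \<times> H" using E(5) by (auto simp: A_simps)
  next
    fix u v assume "u \<in> carrier A" "v \<in> p \<times> H"
    then obtain s y r x where *: "u = (s, y)" "v = (r, x)" "s \<in> carrier R" "y \<in> carrier M" "r \<in> p" "x \<in> H"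
      by (auto simp: A_simps)
    have "s \<odot>\<^bsub>M\<^esub> x \<oplus>\<^bsub>M\<^esub> r \<odot>\<^bsub>M\<^esub> y \<in> H" using E(5)[OF E(4)[OF *(3,6)] pM[OF *(5,4)]] .
    then show "u \<odot>\<^bsub>regular_module A\<^esub> v \<in> p \<times> H"
      using p.I_l_closed[OF *(5,3)] unfolding *(1,2) by (simp add: A_simps)
  qed
  then show ?thesis by (simp add: A.submodule_regular_iff)
qed

text \<open>
  Generators of an ideal \<open>K\<close> of \<open>A\<close>: lifts of generators of its projection to \<open>R\<close>, and generators of
  \<open>K \<inter> (0 \<times> M)\<close>.  Finite generation in \<open>M\<close> is again stated by the universal property of the span.
\<close>

lemma noetherian_A:
  assumes R: "noetherian_ring R"
    and M: "\<And>H. submodule H R M \<Longrightarrow> \<exists>S. finite S \<and> S \<subseteq> H \<and> (\<forall>H'. submodule H' R M \<longrightarrow> S \<subseteq> H' \<longrightarrow> H \<subseteq> H')"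
  shows "noetherian_ring A"
proof -
  interpret R': noetherian_ring R by fact
  show ?thesis
  proof (rule A.noetherian_ringI)
    fix K assume K: "ideal K A"
    interpret K: ideal K A by fact
    let ?K0 = "\<lambda>K. {x \<in> carrier M. (\<zero>\<^bsub>R\<^esub>, x) \<in> K}"
    obtain B where B: "B \<subseteq> carrier R" "finite B" "fst ` K = Idl\<^bsub>R\<^esub> B"
      using R'.finetely_gen[OF fst_ideal_A[OF K]] by blast
    have "B \<subseteq> fst ` K" unfolding B(3) by (rule R.genideal_self[OF B(1)])
    then obtain B' where B': "B' \<subseteq> K" "finite B'" "B = fst ` B'"
      using finite_subset_image[OF B(2)] by blast
    from M[OF submodule_of_ideal_A[OF K]] obtain S where S: "finite S" "S \<subseteq> ?K0 K"
      and gen: "\<forall>H'. submodule H' R M \<longrightarrow> S \<subseteq> H' \<longrightarrow> ?K0 K \<subseteq> H'" by (elim exE conjE)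
    let ?G = "B' \<union> Pair \<zero>\<^bsub>R\<^esub> ` S"
    have GK: "?G \<subseteq> K" using B'(1) S(2) by auto
    then have G: "?G \<subseteq> carrier A" using K.a_subset by (rule order_trans)
    then have G': "?G \<subseteq> carrier R \<times> carrier M" by (simp add: A_simps)
    have L: "ideal (Idl\<^bsub>A\<^esub> ?G) A" using A.genideal_ideal[OF G'] .
    have GL: "?G \<subseteq> Idl\<^bsub>A\<^esub> ?G" using A.genideal_self[OF G'] .
    have LK: "Idl\<^bsub>A\<^esub> ?G \<subseteq> K" using A.genideal_minimal[OF K GK] .
    have "K \<subseteq> Idl\<^bsub>A\<^esub> ?G"
    proof (rule ideal_A_le[OF L K LK])
      have "B' \<subseteq> Idl\<^bsub>A\<^esub> ?G" using GL by (rule order_trans[rotated]) simp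
      then have "B \<subseteq> fst ` (Idl\<^bsub>A\<^esub> ?G)" unfolding B'(3) by (rule image_mono)
      then show "fst ` K \<subseteq> fst ` (Idl\<^bsub>A\<^esub> ?G)"
        unfolding B(3) by (rule R.genideal_minimal[OF fst_ideal_A[OF L]])
      fix x assume x: "(\<zero>\<^bsub>R\<^esub>, x) \<in> K"
      have "S \<subseteq> ?K0 (Idl\<^bsub>A\<^esub> ?G)"
      proof
        fix s assume s: "s \<in> S"
        then have "(\<zero>\<^bsub>R\<^esub>, s) \<in> ?G" by simp
        from subsetD[OF GL this] subsetD[OF S(2) s] show "s \<in> ?K0 (Idl\<^bsub>A\<^esub> ?G)" by simp
      qed
      then have "?K0 K \<subseteq> ?K0 (Idl\<^bsub>A\<^esub> ?G)" using gen submodule_of_ideal_A[OF L] by simp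
      moreover have "x \<in> ?K0 K" using x K.Icarr[OF x] by (simp add: A_simps)
      ultimately show "(\<zero>\<^bsub>R\<^esub>, x) \<in> Idl\<^bsub>A\<^esub> ?G" by blast
    qed
    then have "K = Idl\<^bsub>A\<^esub> ?G" using LK by (rule equalityI)
    moreover have "finite ?G" using B'(2) S(1) by simp
    ultimately show "\<exists>G\<subseteq>carrier R \<times> carrier M. finite G \<and> K = Idl\<^bsub>A\<^esub> G"
      using G' by (intro exI[of _ ?G] conjI)
  qed
qed

lemma local_noetherian_A:
  assumes R: "local_noetherian_ring R \<mm>"
    and M: "\<And>H. submodule H R M \<Longrightarrow> \<exists>S. finite S \<and> S \<subseteq> H \<and> (\<forall>H'. submodule H' R M \<longrightarrow> S \<subseteq> H' \<longrightarrow> H \<subseteq> H')"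
  shows "local_noetherian_ring A (\<mm> \<times> carrier M)"
proof -
  interpret R': local_noetherian_ring R \<mm> by fact
  show ?thesis
  proof (rule local_noetherian_ringI[OF cring_A noetherian_A[OF R'.noetherian_ring_axioms M]])
    show "\<one>\<^bsub>A\<^esub> \<noteq> \<zero>\<^bsub>A\<^esub>"
      using R.prime_ideal_le(3)[OF R.maximalideal_prime[OF R'.maximal]] R'.\<mm>.zero_closed
      by (auto simp: A_simps)
    fix J assume J: "maximalideal J A"
    interpret J: maximalideal J A by fact
    let ?p = "{r \<in> carrier R. (r, \<zero>\<^bsub>M\<^esub>) \<in> J}"
    have Jp: "J = ?p \<times> carrier M" "primeideal ?p R"
      using prime_A_eq[OF A.maximalideal_prime[OF J]] by blast+
    have "?p \<subseteq> \<mm>"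
      using R'.proper_ideal_le[OF primeideal.axioms(1)[OF Jp(2)] R.prime_ideal_le(2)[OF Jp(2)]] .
    then have "J \<subseteq> \<mm> \<times> carrier M" by (subst Jp(1)) blast
    moreover have m: "ideal (\<mm> \<times> carrier M) A" by (rule ideal_Times_carrier[OF R'.\<mm>.is_ideal])
    moreover have "\<mm> \<times> carrier M \<noteq> carrier A"
      using R.prime_ideal_le(3)[OF R.maximalideal_prime[OF R'.maximal]] by (auto simp: A_simps)
    moreover have "\<mm> \<times> carrier M \<subseteq> carrier A" using R'.\<mm>.a_subset by (auto simp: A_simps)
    ultimately show "J = \<mm> \<times> carrier M" using J.I_maximal[OF m] by blast
  qed
qed

end

section \<open>Ideals as modules\<close>

lemma ideal_module_simps [simp]:
  "carrier (ideal_module R I) = I" "zero (ideal_module R I) = \<zero>\<^bsub>R\<^esub>"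
  "add (ideal_module R I) = add R" "smult (ideal_module R I) = monoid.mult R"
  by (simp_all add: ideal_module_def)

lemma (in cring) module_ideal:
  assumes "ideal I R" shows "module R (ideal_module R I)"
  unfolding ideal_module_def
  using assms by (intro submodule.submodule_is_module module_regular) (simp add: submodule_regular_iff)

lemma (in cring) submodule_ideal_module_iff:
  assumes I: "ideal I R"
  shows "submodule H R (ideal_module R I) \<longleftrightarrow> ideal H R \<and> H \<subseteq> I"
proof
  interpret M: module R "ideal_module R I" by (rule module_ideal[OF I])
  have IR: "I \<subseteq> carrier R" using ideal.Icarr[OF I] by (rule subsetI)
  assume H: "submodule H R (ideal_module R I)"
  note E = M.submoduleE[OF H]
  have HI: "H \<subseteq> I" using E(1) by simp
  have "submodule H R (regular_module R)"
    using E(4,5) M.submodule_zero[OF H] order_trans[OF HI IR]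
    by (intro module.submoduleI'[OF module_regular]) simp_all
  then show "ideal H R \<and> H \<subseteq> I" using HI by (simp add: submodule_regular_iff)
next
  interpret M: module R "ideal_module R I" by (rule module_ideal[OF I])
  interpret R: module R "regular_module R" by (rule module_regular)
  assume H: "ideal H R \<and> H \<subseteq> I"
  then have H': "submodule H R (regular_module R)" by (simp add: submodule_regular_iff)
  show "submodule H R (ideal_module R I)"
    using R.submoduleE(4,5)[OF H'] R.submodule_zero[OF H'] H
    by (intro M.submoduleI') simp_all
qed

lemma (in cring) ideal_mult_image:
  assumes "ideal J R" and a: "a \<in> carrier R" shows "ideal ((\<lambda>x. a \<otimes> x) ` J) R"
proof -
  interpret J: ideal J R by fact
  have "submodule ((\<lambda>x. a \<otimes> x) ` J) R (regular_module R)"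
  proof (rule module.submoduleI'[OF module_regular])
    show "(\<lambda>x. a \<otimes> x) ` J \<subseteq> carrier (regular_module R)" using a J.Icarr by auto
    show "\<zero>\<^bsub>regular_module R\<^esub> \<in> (\<lambda>x. a \<otimes> x) ` J"
      using a J.zero_closed by (intro image_eqI[of _ _ \<zero>]) simp_all
  next
    fix x y assume "x \<in> (\<lambda>x. a \<otimes> x) ` J" "y \<in> (\<lambda>x. a \<otimes> x) ` J"
    then obtain x' y' where "x' \<in> J" "y' \<in> J" "x = a \<otimes> x'" "y = a \<otimes> y'" by (elim imageE)
    then show "x \<oplus>\<^bsub>regular_module R\<^esub> y \<in> (\<lambda>x. a \<otimes> x) ` J"
      using a J.Icarr by (intro image_eqI[of _ _ "x' \<oplus> y'"]) (simp_all add: r_distr)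
  next
    fix r x assume "r \<in> carrier R" "x \<in> (\<lambda>x. a \<otimes> x) ` J"
    then obtain x' where *: "r \<in> carrier R" "x' \<in> J" "x = a \<otimes> x'" by (elim imageE)
    then show "r \<odot>\<^bsub>regular_module R\<^esub> x \<in> (\<lambda>x. a \<otimes> x) ` J"
      using a J.Icarr[OF *(2)] J.I_l_closed[OF *(2,1)]
      by (intro image_eqI[of _ _ "r \<otimes> x'"]) (simp_all add: m_lcomm)
  qed
  then show ?thesis by (simp add: submodule_regular_iff)
qed

section \<open>Types over a one-dimensional Gorenstein ring\<close>

locale gorenstein_primary_ideal = gorenstein_dim_1 R \<mm> E \<delta> \<eta> N + local_ring_mod_primary R \<mm> I
  for R :: "('a, 'c) ring_scheme" (structure) and \<mm> and E :: "nat \<Rightarrow> ('a, 'e) module" and \<delta> \<eta> N and I +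
  fixes a
  assumes a: "a \<in> I" and regular: "\<And>x. x \<in> carrier R \<Longrightarrow> a \<otimes> x = \<zero> \<Longrightarrow> x = \<zero>"
begin

lemma a_max: "a \<in> \<mm>"
  by (rule subsetD[OF I_le a])

lemma aR: "a \<in> carrier R"
  by (rule \<mm>.Icarr[OF a_max])

lemma cancel: "x \<in> carrier R \<Longrightarrow> y \<in> carrier R \<Longrightarrow> a \<otimes> x = a \<otimes> y \<Longrightarrow> x = y"
proof -
  assume xy: "x \<in> carrier R" "y \<in> carrier R" "a \<otimes> x = a \<otimes> y"
  have "a \<otimes> (x \<ominus> y) = a \<otimes> x \<ominus> a \<otimes> y" using xy(1,2) aR by algebra
  also have "\<dots> = \<zero>" using xy aR by (simp add: r_right_minus_eq)
  finally have "x \<ominus> y = \<zero>" using regular xy(1,2) by simp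
  then show "x = y" using xy(1,2) by (simp add: r_right_minus_eq)
qed

abbreviation "aI \<equiv> (\<lambda>x. a \<otimes> x) ` I"
abbreviation "soc_I \<equiv> {x \<in> I. \<forall>b\<in>\<mm>. b \<otimes> x \<in> aI}"
abbreviation "soc_RI \<equiv> {x \<in> carrier R. \<forall>b\<in>\<mm>. b \<otimes> x \<in> I}"
abbreviation "soc_Ra \<equiv> {x \<in> carrier R. \<forall>b\<in>\<mm>. b \<otimes> x \<in> PIdl a}"
abbreviation "len J K \<equiv> chain_length (\<lambda>H. ideal H R \<and> J \<subseteq> H \<and> H \<subseteq> K)"

lemma PIdl_a: "PIdl a = (\<lambda>x. a \<otimes> x) ` carrier R"
  unfolding cgenideal_def using aR m_comm by auto

lemma cm_type_I: "cm_type R (ideal_module R I) = len aI soc_I"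
proof -
  have "cm_type R (ideal_module R I) = chain_length (\<lambda>H. submodule H R (ideal_module R I) \<and>
      (\<lambda>x. a \<odot>\<^bsub>ideal_module R I\<^esub> x) ` carrier (ideal_module R I) \<subseteq> H \<and>
      H \<subseteq> {x \<in> carrier (ideal_module R I). \<forall>b\<in>\<mm>. b \<odot>\<^bsub>ideal_module R I\<^esub> x \<in> (\<lambda>x. a \<odot>\<^bsub>ideal_module R I\<^esub> x) ` carrier (ideal_module R I)})"
    by (rule cm_type_dim_1[OF krull_dim module_ideal[OF I] a_max]) (simp add: regular I.Icarr)
  then show ?thesis
    by (simp add: submodule_ideal_module_iff[OF I] conj_assoc) (auto intro!: arg_cong[where f = chain_length])
qed

text \<open>
  Any element of \<open>(aR : \<mm>)\<close> outside \<open>aR\<close> generates \<open>(aR : \<mm>)\<close> modulo \<open>aR\<close>, so no ideal lies strictly in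
  between.
\<close>

lemma len_soc_Ra: "len (PIdl a) soc_Ra \<le> 1"
proof (rule chain_length_le_one)
  fix H assume H: "ideal H R \<and> PIdl a \<subseteq> H \<and> H \<subseteq> soc_Ra"
  then interpret H: ideal H R by simp
  show "H = PIdl a \<or> H = soc_Ra"
  proof (rule disjCI)
    assume "H \<noteq> soc_Ra"
    have "\<not> soc_Ra \<subseteq> H"
    proof
      assume "soc_Ra \<subseteq> H"
      then have "H = soc_Ra" using H by (intro equalityI) (elim conjE)
      with \<open>H \<noteq> soc_Ra\<close> show False by (rule notE)
    qed
    then obtain u where u: "u \<in> soc_Ra" "u \<notin> H" by (meson subsetI)
    have "v \<in> PIdl a" if v: "v \<in> H" for v
    proof (rule ccontr)
      assume va: "v \<notin> PIdl a"
      have vR: "v \<in> carrier R" using v by (rule H.Icarr)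
      have uR: "u \<in> carrier R" using u(1) by simp
      obtain w where w: "w \<in> carrier R" "v \<otimes> w \<ominus> u \<in> PIdl a"
        using socle_generated_by_one[OF a_max regular vR va uR] u(1) by auto
      have "v \<otimes> w \<ominus> u \<in> H" using w(2) H by auto
      then have "v \<otimes> w \<oplus> \<ominus> (v \<otimes> w \<ominus> u) \<in> H"
        using H.I_r_closed[OF v w(1)] by (intro H.a_closed H.a_inv_closed)
      moreover have "v \<otimes> w \<oplus> \<ominus> (v \<otimes> w \<ominus> u) = u" using vR w(1) uR by algebra
      ultimately show False using u(2) by simp
    qed
    then show "H = PIdl a" using H by (intro equalityI subsetI) auto
  qed
qed

lemma exists_socle_generator: "\<exists>u\<in>soc_Ra. u \<notin> PIdl a"
proof -
  obtain u where u: "u \<in> carrier R" "\<mm> = colon R (PIdl a) u"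
    using maximal_is_colon[OF a_max regular] by auto
  have "u \<notin> PIdl a"
    using colon_eq_carrier_iff[OF cgenideal_ideal[OF aR] u(1)] u(2) \<mm>.I_notcarr by auto
  moreover have "b \<otimes> u \<in> PIdl a" if "b \<in> \<mm>" for b
    using that unfolding u(2) colon_iff by (rule conjunct2)
  ultimately show ?thesis using u(1) by auto
qed

text \<open>
  Multiplication by \<open>a\<close> embeds \<open>(I : \<mm>)/I\<close> into \<open>(aI : \<mm>)/aI\<close>.
\<close>

lemma type_lower: "ring_type (R Quot I) \<le> cm_type R (ideal_module R I)"
  unfolding ring_type_Q cm_type_I
proof (rule chain_length_strict_mono_map[where g = "\<lambda>J. (\<lambda>x. a \<otimes> x) ` J"])
  fix J assume J: "ideal J R \<and> I \<subseteq> J \<and> J \<subseteq> soc_RI"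
  have "(\<lambda>x. a \<otimes> x) ` J \<subseteq> soc_I"
  proof (rule image_subsetI)
    fix x assume "x \<in> J"
    then have x: "x \<in> carrier R" "\<And>b. b \<in> \<mm> \<Longrightarrow> b \<otimes> x \<in> I" using J by auto
    have "b \<otimes> (a \<otimes> x) \<in> aI" if b: "b \<in> \<mm>" for b
      using x(2)[OF b] \<mm>.Icarr[OF b] aR x(1) by (intro image_eqI[of _ _ "b \<otimes> x"]) (simp_all add: m_lcomm)
    then show "a \<otimes> x \<in> soc_I" using x(2)[OF a_max] by simp
  qed
  then show "ideal ((\<lambda>x. a \<otimes> x) ` J) R \<and> aI \<subseteq> (\<lambda>x. a \<otimes> x) ` J \<and> (\<lambda>x. a \<otimes> x) ` J \<subseteq> soc_I"
    using J aR by (intro conjI ideal_mult_image image_mono) simp_all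
next
  fix H K assume H: "ideal H R \<and> I \<subseteq> H \<and> H \<subseteq> soc_RI" and K: "ideal K R \<and> I \<subseteq> K \<and> K \<subseteq> soc_RI" and HK: "H \<subset> K"
  have inj: "inj_on (\<lambda>x. a \<otimes> x) (carrier R)" using cancel by (rule inj_onI)
  have HR: "H \<subseteq> carrier R" and KR: "K \<subseteq> carrier R" using H K by auto
  show "(\<lambda>x. a \<otimes> x) ` H \<subset> (\<lambda>x. a \<otimes> x) ` K"
    using HK inj_on_image_eq_iff[OF inj HR KR] image_mono[of H K] by (simp add: psubset_eq)
qed

text \<open>
  An ideal \<open>H\<close> between \<open>aI\<close> and \<open>(aI : \<mm>)\<close> is controlled by \<open>(H : a)\<close>, between \<open>I\<close> and \<open>(I : \<mm>)\<close>, and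
  \<open>H + aR\<close>, between \<open>aR\<close> and \<open>(aR : \<mm>)\<close>.
\<close>

lemma type_upper: "cm_type R (ideal_module R I) \<le> 1 + ring_type (R Quot I)"
proof -
  have PIdl_ideal: "ideal (PIdl a) R" by (rule cgenideal_ideal[OF aR])
  have "len aI soc_I \<le> len I soc_RI + len (PIdl a) soc_Ra"
  proof (rule chain_length_subadditive[where f = "\<lambda>H. colon R H a" and g = "\<lambda>H. H <+>\<^bsub>R\<^esub> PIdl a"])
    fix H assume H: "ideal H R \<and> aI \<subseteq> H \<and> H \<subseteq> soc_I"
    then interpret H: ideal H R by simp
    have HS: "x \<in> I" "\<And>b. b \<in> \<mm> \<Longrightarrow> b \<otimes> x \<in> aI" if "x \<in> H" for x using H that by auto
    show "ideal (colon R H a) R \<and> I \<subseteq> colon R H a \<and> colon R H a \<subseteq> soc_RI"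
    proof (intro conjI subsetI colon_ideal H.is_ideal aR)
      fix x assume x: "x \<in> I"
      then have "a \<otimes> x \<in> H" using H by auto
      then show "x \<in> colon R H a" unfolding colon_iff using I.Icarr[OF x] aR by (simp add: m_comm)
    next
      fix x assume "x \<in> colon R H a"
      then have x: "x \<in> carrier R" "x \<otimes> a \<in> H" unfolding colon_iff by auto
      have "b \<otimes> x \<in> I" if b: "b \<in> \<mm>" for b
      proof -
        have bR: "b \<in> carrier R" using b by (rule \<mm>.Icarr)
        obtain i where i: "i \<in> I" "b \<otimes> (x \<otimes> a) = a \<otimes> i" using HS(2)[OF x(2) b] by (elim imageE)
        have "a \<otimes> (b \<otimes> x) = a \<otimes> i" unfolding i(2)[symmetric] using aR bR x(1) by algebra
        then have "b \<otimes> x = i" using cancel[of "b \<otimes> x" i] bR x(1) I.Icarr[OF i(1)] by simp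
        then show ?thesis using i(1) by simp
      qed
      then show "x \<in> soc_RI" using x(1) by simp
    qed
    show "ideal (H <+>\<^bsub>R\<^esub> PIdl a) R \<and> PIdl a \<subseteq> H <+>\<^bsub>R\<^esub> PIdl a \<and> H <+>\<^bsub>R\<^esub> PIdl a \<subseteq> soc_Ra"
    proof (intro conjI)
      note K = add_cgenideal[OF H.is_ideal aR]
      show KI: "ideal (H <+>\<^bsub>R\<^esub> PIdl a) R" by (rule K(1))
      show "PIdl a \<subseteq> H <+>\<^bsub>R\<^esub> PIdl a" by (rule cgenideal_minimal[OF K(1,3)])
      show "H <+>\<^bsub>R\<^esub> PIdl a \<subseteq> soc_Ra"
      proof
        fix x assume "x \<in> H <+>\<^bsub>R\<^esub> PIdl a"
        then obtain h r where h: "h \<in> H" "r \<in> carrier R" "x = h \<oplus> r \<otimes> a"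
          unfolding mem_add_cgenideal_iff by auto
        have hR: "h \<in> carrier R" using h(1) by (rule H.Icarr)
        have "b \<otimes> x \<in> PIdl a" if b: "b \<in> \<mm>" for b
        proof -
          have bR: "b \<in> carrier R" using b by (rule \<mm>.Icarr)
          obtain i where i: "i \<in> I" "b \<otimes> h = a \<otimes> i" using HS(2)[OF h(1) b] by (elim imageE)
          have "b \<otimes> x = b \<otimes> h \<oplus> b \<otimes> r \<otimes> a" unfolding h(3) using bR hR h(2) aR by algebra
          also have "\<dots> = a \<otimes> (i \<oplus> b \<otimes> r)" unfolding i(2) using bR I.Icarr[OF i(1)] h(2) aR by algebra
          finally show ?thesis
            unfolding PIdl_a using bR I.Icarr[OF i(1)] h(2) by (intro image_eqI[of _ _ "i \<oplus> b \<otimes> r"]) simp_all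
        qed
        then show "x \<in> soc_Ra" using hR h(2) aR unfolding h(3) by simp
      qed
    qed
  next
    fix H K :: "'a set" assume HK: "H \<subseteq> K"
    show "colon R H a \<subseteq> colon R K a" unfolding colon_def using HK by auto
    show "H <+>\<^bsub>R\<^esub> PIdl a \<subseteq> K <+>\<^bsub>R\<^esub> PIdl a" unfolding set_add_def' using HK by auto
  next
    fix H K assume H: "ideal H R \<and> aI \<subseteq> H \<and> H \<subseteq> soc_I" and K: "ideal K R \<and> aI \<subseteq> K \<and> K \<subseteq> soc_I"
      and HK: "H \<subseteq> K" and colon: "colon R H a = colon R K a" and sum: "H <+>\<^bsub>R\<^esub> PIdl a = K <+>\<^bsub>R\<^esub> PIdl a"
    interpret H: ideal H R using H by simp
    interpret K: ideal K R using K by simp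
    have "x \<in> H" if x: "x \<in> K" for x
    proof -
      have "x \<in> H <+>\<^bsub>R\<^esub> PIdl a" unfolding sum by (rule subsetD[OF add_cgenideal(2)[OF K.is_ideal aR] x])
      then obtain h r where h: "h \<in> H" "r \<in> carrier R" "x = h \<oplus> r \<otimes> a"
        unfolding mem_add_cgenideal_iff by auto
      have hR: "h \<in> carrier R" using h(1) by (rule H.Icarr)
      have "x \<oplus> \<ominus> h \<in> K" using x subsetD[OF HK h(1)] by (intro K.a_closed K.a_inv_closed)
      moreover have "x \<oplus> \<ominus> h = r \<otimes> a" unfolding h(3) using hR h(2) aR by algebra
      ultimately have "r \<in> colon R K a" unfolding colon_iff using h(2) by simp
      then have "r \<otimes> a \<in> H" unfolding colon[symmetric] colon_iff by (rule conjunct2)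
      then show ?thesis unfolding h(3) using h(1) by (rule H.a_closed[rotated])
    qed
    then show "H = K" using HK by (intro equalityI subsetI) auto
  qed
  also have "\<dots> \<le> len I soc_RI + 1" using len_soc_Ra by (rule add_left_mono)
  finally show ?thesis unfolding ring_type_Q cm_type_I by (simp add: add.commute)
qed

text \<open>
  Inside the total ring of fractions, \<open>I = (R : (R : I))\<close> by duality, so \<open>(R : \<mm>) I \<subseteq> I\<close> follows from
  \<open>(R : I) (R : \<mm>) I \<subseteq> R\<close>, and for this \<open>(R : I) I \<subseteq> \<mm>\<close> suffices.  That holds because \<open>(R : I) I = R\<close> would make \<open>I\<close>
  principal.  Here \<open>u/a\<close> is an element of \<open>(R : \<mm>)\<close> and \<open>w/a\<close> one of \<open>(R : I)\<close>.
\<close>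

lemma socle_times_ideal:
  assumes gens: "min_gens R I > 1" and u: "u \<in> soc_Ra" and y: "y \<in> I"
  shows "u \<otimes> y \<in> aI"
proof -
  have uR: "u \<in> carrier R" using u by simp
  have yR: "y \<in> carrier R" using y by (rule I.Icarr)
  have soc: "\<exists>s\<in>carrier R. b \<otimes> u = a \<otimes> s" if "b \<in> \<mm>" for b
    using u that unfolding PIdl_a by auto
  obtain z where z: "z \<in> carrier R" "y \<otimes> u = a \<otimes> z" using soc[OF subsetD[OF I_le y]] by auto
  have "z \<in> I"
  proof (rule double_annihilator[OF a_max regular I a primary z(1)])
    fix w assume w: "w \<in> carrier R" "\<And>i. i \<in> I \<Longrightarrow> i \<otimes> w \<in> PIdl a"
    obtain t where t: "t \<in> carrier R" "y \<otimes> w = a \<otimes> t" using w(2)[OF y] unfolding PIdl_a by (elim imageE)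
    \<comment> \<open>\<open>t = y (w/a)\<close> lies in \<open>(R : I) I\<close>.\<close>
    have "t \<in> \<mm>"
    proof (rule ccontr)
      assume "t \<notin> \<mm>"
      then have "\<not> PIdl t \<subseteq> \<mm>" using cgenideal_self[OF t(1)] by auto
      then have "PIdl t = carrier R" using proper_ideal_le[OF cgenideal_ideal[OF t(1)]] by auto
      then have "\<one> \<in> PIdl t" by simp
      then obtain s where s: "s \<in> carrier R" "\<one> = s \<otimes> t" unfolding cgenideal_def by auto
      have "I \<subseteq> PIdl y"
      proof
        fix i assume i: "i \<in> I"
        have iR: "i \<in> carrier R" using i by (rule I.Icarr)
        obtain t' where t': "t' \<in> carrier R" "i \<otimes> w = a \<otimes> t'" using w(2)[OF i] unfolding PIdl_a by (elim imageE)
        have "a \<otimes> (i \<otimes> t) = i \<otimes> (a \<otimes> t)" using aR iR t(1) by algebra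
        also have "\<dots> = y \<otimes> (i \<otimes> w)" unfolding t(2)[symmetric] using iR yR w(1) by algebra
        also have "\<dots> = a \<otimes> (y \<otimes> t')" unfolding t'(2) using aR yR t'(1) by algebra
        finally have it: "i \<otimes> t = y \<otimes> t'" using cancel iR yR t(1) t'(1) by simp
        have "i = i \<otimes> (s \<otimes> t)" unfolding s(2)[symmetric] using iR by simp
        also have "\<dots> = s \<otimes> (i \<otimes> t)" using iR s(1) t(1) by algebra
        also have "\<dots> = (s \<otimes> t') \<otimes> y" unfolding it using s(1) t'(1) yR by algebra
        finally show "i \<in> PIdl y" unfolding cgenideal_def using s(1) t'(1) by auto
      qed
      then have "PIdl y = I" using cgenideal_minimal[OF I y] by (rule equalityI[rotated])
      then have "Idl {y} = I" using cgenideal_eq_genideal[OF yR] by simp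
      then have "\<exists>A. A \<subseteq> carrier R \<and> finite A \<and> card A = 1 \<and> Idl A = I"
        using yR by (intro exI[of _ "{y}"]) simp
      then have "min_gens R I \<le> 1" unfolding min_gens_def by (rule Least_le)
      then show False using gens by simp
    qed
    then obtain s where s: "s \<in> carrier R" "t \<otimes> u = a \<otimes> s" using soc by auto
    have "a \<otimes> (z \<otimes> w) = (a \<otimes> z) \<otimes> w" using aR z(1) w(1) by algebra
    also have "\<dots> = u \<otimes> (y \<otimes> w)" unfolding z(2)[symmetric] using yR uR w(1) by algebra
    also have "\<dots> = a \<otimes> (t \<otimes> u)" unfolding t(2) using aR t(1) uR by algebra
    finally have "z \<otimes> w = t \<otimes> u" using cancel z(1) w(1) t(1) uR by simp
    then show "z \<otimes> w \<in> PIdl a" unfolding PIdl_a using s by auto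
  qed
  moreover have "u \<otimes> y = a \<otimes> z" using z(2) m_comm[OF uR yR] by simp
  ultimately show ?thesis by (intro image_eqI)
qed

sublocale IM: module_idealization R "ideal_module R I"
  by (intro module_idealization.intro module_ideal I)

lemma local_noetherian_ring_A: "local_noetherian_ring IM.A (\<mm> \<times> I)"
proof -
  have "local_noetherian_ring IM.A (\<mm> \<times> carrier (ideal_module R I))"
  proof (rule IM.local_noetherian_A[OF local_noetherian_ring_axioms])
    fix H assume "submodule H R (ideal_module R I)"
    then have H: "ideal H R" "H \<subseteq> I" by (simp_all add: submodule_ideal_module_iff[OF I])
    obtain S where S: "S \<subseteq> carrier R" "finite S" "H = Idl S" using finetely_gen[OF H(1)] by auto
    have "H \<subseteq> H'" if "submodule H' R (ideal_module R I)" "S \<subseteq> H'" for H'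
      unfolding S(3) using that by (intro genideal_minimal) (simp_all add: submodule_ideal_module_iff[OF I])
    moreover have "S \<subseteq> H" unfolding S(3) by (rule genideal_self[OF S(1)])
    ultimately show "\<exists>S. finite S \<and> S \<subseteq> H \<and> (\<forall>H'. submodule H' R (ideal_module R I) \<longrightarrow> S \<subseteq> H' \<longrightarrow> H \<subseteq> H')"
      using S(2) by (intro exI[of _ S]) simp
  qed
  then show ?thesis by simp
qed

text \<open>
  As \<open>(b, y)(r, x) = (br, bx + ry)\<close>, the pair \<open>(r, x)\<close> is in the socle modulo \<open>(a, 0) A = aR \<times> aI\<close> iff
  \<open>\<mm> r \<subseteq> aR\<close>, \<open>\<mm> x \<subseteq> aI\<close> and \<open>r I \<subseteq> aI\<close>, and the last condition follows from the first.
\<close>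

lemma ring_type_A:
  assumes gens: "min_gens R I > 1"
  shows "ring_type IM.A = chain_length (\<lambda>K. ideal K IM.A \<and> (PIdl a) \<times> aI \<subseteq> K \<and> K \<subseteq> soc_Ra \<times> soc_I)"
proof -
  interpret A: local_noetherian_ring IM.A "\<mm> \<times> I" by (rule local_noetherian_ring_A)
  let ?a = "(a, \<zero>)"
  have carr: "carrier IM.A = carrier R \<times> I" by (simp add: IM.A_simps)
  have a_mult: "?a \<otimes>\<^bsub>IM.A\<^esub> (r, x) = (a \<otimes> r, a \<otimes> x)" if "r \<in> carrier R" "x \<in> I" for r x
    using that aR I.Icarr by (simp add: IM.A_simps)
  have aA: "(\<lambda>z. ?a \<otimes>\<^bsub>IM.A\<^esub> z) ` (carrier R \<times> I) = (PIdl a) \<times> aI"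
  proof (intro equalityI subsetI)
    fix z assume "z \<in> (\<lambda>z. ?a \<otimes>\<^bsub>IM.A\<^esub> z) ` (carrier R \<times> I)"
    then obtain r x where "r \<in> carrier R" "x \<in> I" "z = ?a \<otimes>\<^bsub>IM.A\<^esub> (r, x)" by auto
    then show "z \<in> (PIdl a) \<times> aI" using a_mult unfolding PIdl_a by simp
  next
    fix z assume "z \<in> (PIdl a) \<times> aI"
    then obtain r x where "r \<in> carrier R" "x \<in> I" "z = (a \<otimes> r, a \<otimes> x)" unfolding PIdl_a by auto
    then show "z \<in> (\<lambda>z. ?a \<otimes>\<^bsub>IM.A\<^esub> z) ` (carrier R \<times> I)"
      using a_mult by (intro image_eqI[of _ _ "(r, x)"]) simp_all
  qed
  interpret PA: ideal "PIdl a" R by (rule cgenideal_ideal[OF aR])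
  interpret AI: ideal aI R by (rule ideal_mult_image[OF I aR])
  have soc: "{z \<in> carrier R \<times> I. \<forall>b\<in>\<mm> \<times> I. b \<otimes>\<^bsub>IM.A\<^esub> z \<in> (PIdl a) \<times> aI} = soc_Ra \<times> soc_I"
  proof (intro equalityI subsetI)
    fix z assume "z \<in> {z \<in> carrier R \<times> I. \<forall>b\<in>\<mm> \<times> I. b \<otimes>\<^bsub>IM.A\<^esub> z \<in> (PIdl a) \<times> aI}"
    then obtain r x where z: "z = (r, x)" "r \<in> carrier R" "x \<in> I"
      "\<And>b y. b \<in> \<mm> \<Longrightarrow> y \<in> I \<Longrightarrow> (b, y) \<otimes>\<^bsub>IM.A\<^esub> (r, x) \<in> (PIdl a) \<times> aI" by auto
    have "b \<otimes> r \<in> PIdl a" "b \<otimes> x \<in> aI" if b: "b \<in> \<mm>" for b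
      using z(4)[OF b I.zero_closed] z(2) I.Icarr[OF z(3)] \<mm>.Icarr[OF b] by (simp_all add: IM.A_simps)
    then show "z \<in> soc_Ra \<times> soc_I" using z(1-3) by simp
  next
    fix z assume "z \<in> soc_Ra \<times> soc_I"
    then obtain r x where z: "z = (r, x)" "r \<in> soc_Ra" "x \<in> soc_I" by auto
    have "(b, y) \<otimes>\<^bsub>IM.A\<^esub> (r, x) \<in> (PIdl a) \<times> aI" if b: "b \<in> \<mm>" and y: "y \<in> I" for b y
    proof -
      have "b \<otimes> x \<oplus> r \<otimes> y \<in> aI"
        using z(3) b socle_times_ideal[OF gens z(2) y] by (intro AI.a_closed) simp_all
      then show ?thesis using z(2) b by (simp add: IM.A_simps)
    qed
    then show "z \<in> {z \<in> carrier R \<times> I. \<forall>b\<in>\<mm> \<times> I. b \<otimes>\<^bsub>IM.A\<^esub> z \<in> (PIdl a) \<times> aI}"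
      using z by auto
  qed
  have reg: "z = \<zero>\<^bsub>IM.A\<^esub>" if z: "z \<in> carrier R \<times> I" "?a \<otimes>\<^bsub>IM.A\<^esub> z = \<zero>\<^bsub>IM.A\<^esub>" for z
  proof -
    obtain r x where rx: "z = (r, x)" "r \<in> carrier R" "x \<in> I" using z(1) by auto
    then show ?thesis using z(2) a_mult[OF rx(2,3)] regular[OF rx(2)] regular[OF I.Icarr[OF rx(3)]]
      by (simp add: IM.A_simps)
  qed
  have "ring_type IM.A = chain_length (\<lambda>K. submodule K IM.A (regular_module IM.A) \<and>
      (\<lambda>z. ?a \<odot>\<^bsub>regular_module IM.A\<^esub> z) ` carrier (regular_module IM.A) \<subseteq> K \<and>
      K \<subseteq> {z \<in> carrier (regular_module IM.A). \<forall>b\<in>\<mm> \<times> I. b \<odot>\<^bsub>regular_module IM.A\<^esub> z \<in>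
        (\<lambda>z. ?a \<odot>\<^bsub>regular_module IM.A\<^esub> z) ` carrier (regular_module IM.A)})"
    unfolding ring_type_def
  proof (rule A.cm_type_dim_1)
    show "krull_dim IM.A = 1" using IM.krull_dim_A krull_dim by simp
    show "module IM.A (regular_module IM.A)" by (rule cring.module_regular[OF IM.cring_A])
    show "?a \<in> \<mm> \<times> I" using a_max I.zero_closed by simp
    fix z assume "z \<in> carrier (regular_module IM.A)" "?a \<odot>\<^bsub>regular_module IM.A\<^esub> z = \<zero>\<^bsub>regular_module IM.A\<^esub>"
    then show "z = \<zero>\<^bsub>regular_module IM.A\<^esub>" using reg by (simp add: carr)
  qed
  also have "\<dots> = chain_length (\<lambda>K. ideal K IM.A \<and> (PIdl a) \<times> aI \<subseteq> K \<and> K \<subseteq> soc_Ra \<times> soc_I)"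
    unfolding cring.submodule_regular_iff[OF IM.cring_A] regular_module_simps carr aA soc ..
  finally show ?thesis .
qed

text \<open>
  The socle of \<open>A/aA\<close> is the product of \<open>(aR : \<mm>)/aR\<close>, of length one, and \<open>(aI : \<mm>)/aI\<close>.  For \<open>\<ge>\<close>, a chain of
  ideals \<open>H\<close> between \<open>aI\<close> and \<open>(aI : \<mm>)\<close> gives the chain of ideals \<open>aR \<times> H\<close> of \<open>A\<close>, which the whole socle
  prolongs by one step.  For \<open>\<le>\<close>, an ideal \<open>K\<close> is controlled by \<open>K \<inter> (0 \<times> I)\<close> and its projection to \<open>R\<close>.
\<close>

lemma type_idealization:
  assumes gens: "min_gens R I > 1"
  shows "ring_type IM.A = 1 + cm_type R (ideal_module R I)"
proof -
  let ?Q = "\<lambda>K. ideal K IM.A \<and> (PIdl a) \<times> aI \<subseteq> K \<and> K \<subseteq> soc_Ra \<times> soc_I"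
  let ?P = "\<lambda>H. ideal H R \<and> aI \<subseteq> H \<and> H \<subseteq> soc_I"
  have aI: "ideal aI R" by (rule ideal_mult_image[OF I aR])
  interpret AI: ideal aI R by (rule aI)
  interpret PA: ideal "PIdl a" R by (rule cgenideal_ideal[OF aR])
  have soc_Ra: "ideal soc_Ra R"
  proof -
    have "submodule soc_Ra R (regular_module R)"
    proof (rule module.submoduleI'[OF module_regular])
      fix r x assume r: "r \<in> carrier R" and x: "x \<in> soc_Ra"
      have "b \<otimes> (r \<otimes> x) \<in> PIdl a" if b: "b \<in> \<mm>" for b
        using PA.I_l_closed[OF _ r, of "b \<otimes> x"] x b \<mm>.Icarr[OF b] r by (simp add: m_lcomm)
      then show "r \<odot>\<^bsub>regular_module R\<^esub> x \<in> soc_Ra" using r x by simp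
    next
      fix x y assume "x \<in> soc_Ra" "y \<in> soc_Ra"
      then show "x \<oplus>\<^bsub>regular_module R\<^esub> y \<in> soc_Ra" using \<mm>.Icarr by (simp add: r_distr)
    qed (auto simp: \<mm>.Icarr)
    then show ?thesis by (simp add: submodule_regular_iff)
  qed
  have soc_I: "ideal soc_I R"
  proof -
    have "submodule soc_I R (regular_module R)"
    proof (rule module.submoduleI'[OF module_regular])
      fix r x assume r: "r \<in> carrier R" and x: "x \<in> soc_I"
      have xR: "x \<in> carrier R" using x I.Icarr by simp
      have "b \<otimes> (r \<otimes> x) \<in> aI" if b: "b \<in> \<mm>" for b
      proof -
        have "b \<otimes> x \<in> aI" using x b by simp
        then have "r \<otimes> (b \<otimes> x) \<in> aI" by (rule AI.I_l_closed[OF _ r])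
        then show ?thesis using m_lcomm[OF \<mm>.Icarr[OF b] r xR] by simp
      qed
      then show "r \<odot>\<^bsub>regular_module R\<^esub> x \<in> soc_I" using r x I.I_l_closed by simp
    next
      fix x y assume xy: "x \<in> soc_I" "y \<in> soc_I"
      have "b \<otimes> (x \<oplus> y) \<in> aI" if b: "b \<in> \<mm>" for b
      proof -
        have "b \<otimes> (x \<oplus> y) = b \<otimes> x \<oplus> b \<otimes> y" using xy I.Icarr \<mm>.Icarr[OF b] by (simp add: r_distr)
        moreover have "b \<otimes> x \<oplus> b \<otimes> y \<in> aI" using xy b by (intro AI.a_closed) simp_all
        ultimately show ?thesis by simp
      qed
      then show "x \<oplus>\<^bsub>regular_module R\<^esub> y \<in> soc_I" using xy by simp
    next
      show "soc_I \<subseteq> carrier (regular_module R)" using I.Icarr by auto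
      have "b \<otimes> \<zero> \<in> aI" if "b \<in> \<mm>" for b using \<mm>.Icarr[OF that] AI.zero_closed by simp
      then show "\<zero>\<^bsub>regular_module R\<^esub> \<in> soc_I" by simp
    qed
    then show ?thesis by (simp add: submodule_regular_iff)
  qed
  have aI_le: "aI \<subseteq> soc_I"
  proof
    fix x assume x: "x \<in> aI"
    then have "x \<in> I" using I.I_l_closed aR by auto
    then show "x \<in> soc_I" using AI.I_l_closed[OF x] \<mm>.Icarr by simp
  qed
  have product: "ideal (p \<times> H) IM.A"
    if "ideal p R" "p \<subseteq> soc_Ra" "ideal H R" "aI \<subseteq> H" "H \<subseteq> I" for p H
  proof (rule IM.ideal_TimesI)
    show "submodule H R (ideal_module R I)" using that by (simp add: submodule_ideal_module_iff[OF I])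
    fix r x assume "r \<in> p" "x \<in> carrier (ideal_module R I)"
    then have "r \<otimes> x \<in> aI" using that(2) by (intro socle_times_ideal[OF gens]) auto
    then show "r \<odot>\<^bsub>ideal_module R I\<^esub> x \<in> H" using that(4) by auto
  qed (rule that(1))
  have a_soc: "PIdl a \<subseteq> soc_Ra"
  proof
    fix x assume x: "x \<in> PIdl a"
    show "x \<in> soc_Ra" using PA.Icarr[OF x] PA.I_l_closed[OF x] \<mm>.Icarr by simp
  qed
  have lower: "1 + len aI soc_I \<le> chain_length ?Q"
  proof -
    let ?P' = "\<lambda>K. \<exists>H. ?P H \<and> K = (PIdl a) \<times> H"
    have "len aI soc_I \<le> chain_length ?P'"
    proof (rule chain_length_strict_mono_map[where g = "\<lambda>H. (PIdl a) \<times> H"])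
      fix H K :: "'a set" assume HK: "H \<subset> K"
      then show "(PIdl a) \<times> H \<subset> (PIdl a) \<times> K"
        using cgenideal_self[OF aR] by (auto simp: psubset_eq times_eq_iff)
    qed auto
    moreover have "1 + chain_length ?P' \<le> chain_length ?Q"
    proof (rule chain_length_Suc_le)
      show "?P' ((PIdl a) \<times> aI)" using aI aI_le by auto
      show "?Q (soc_Ra \<times> soc_I)"
        using product[OF soc_Ra _ soc_I aI_le] a_soc aI_le by auto
      fix K assume "?P' K"
      then obtain H where H: "ideal H R" "aI \<subseteq> H" "H \<subseteq> soc_I" "K = (PIdl a) \<times> H" by auto
      have HI: "H \<subseteq> I" using H(3) by auto
      obtain u where u: "u \<in> soc_Ra" "u \<notin> PIdl a" using exists_socle_generator by auto
      interpret H: ideal H R by (rule H(1))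
      have "u \<notin> PIdl a \<or> \<zero> \<notin> H" using u(2) by simp
      then have uK: "(u, \<zero>) \<notin> K" unfolding H(4) by simp
      have "\<zero> \<in> soc_I" by (rule subsetD[OF H(3) H.zero_closed])
      then have "(u, \<zero>) \<in> soc_Ra \<times> soc_I" using u(1) by (rule SigmaI[rotated])
      moreover have KS: "K \<subseteq> soc_Ra \<times> soc_I" unfolding H(4) using a_soc H(3) by (intro Sigma_mono)
      ultimately have "K \<subset> soc_Ra \<times> soc_I" using uK by (intro psubsetI notI) simp_all
      moreover have "ideal K IM.A" unfolding H(4) by (rule product[OF PA.is_ideal a_soc H(1,2) HI])
      moreover have "(PIdl a) \<times> aI \<subseteq> K" unfolding H(4) using H(2) by (intro Sigma_mono order_refl)
      ultimately show "?Q K \<and> K \<subset> soc_Ra \<times> soc_I" using KS by (intro conjI)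
    qed
    ultimately show ?thesis by (meson add_left_mono order_trans)
  qed
  have "chain_length ?Q \<le> len aI soc_I + len (PIdl a) soc_Ra"
  proof (rule chain_length_subadditive[where f = "\<lambda>K. {x \<in> I. (\<zero>, x) \<in> K}" and g = "\<lambda>K. fst ` K"])
    fix K assume K: "?Q K"
    then have KA: "ideal K IM.A" by simp
    have "submodule {x \<in> carrier (ideal_module R I). (\<zero>, x) \<in> K} R (ideal_module R I)"
      by (rule IM.submodule_of_ideal_A[OF KA])
    then have "ideal {x \<in> I. (\<zero>, x) \<in> K} R" by (simp add: submodule_ideal_module_iff[OF I])
    moreover have "aI \<subseteq> {x \<in> I. (\<zero>, x) \<in> K}"
    proof
      fix x assume x: "x \<in> aI"
      then have "(\<zero>, x) \<in> (PIdl a) \<times> aI" by (rule SigmaI[OF PA.zero_closed])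
      then have "(\<zero>, x) \<in> K" using K by (elim conjE) (rule subsetD)
      then show "x \<in> {x \<in> I. (\<zero>, x) \<in> K}" using subsetD[OF aI_le x] by simp
    qed
    moreover have "{x \<in> I. (\<zero>, x) \<in> K} \<subseteq> soc_I" using K by auto
    ultimately show "ideal {x \<in> I. (\<zero>, x) \<in> K} R \<and> aI \<subseteq> {x \<in> I. (\<zero>, x) \<in> K} \<and> {x \<in> I. (\<zero>, x) \<in> K} \<subseteq> soc_I"
      by simp
    have "PIdl a \<subseteq> fst ` K"
    proof
      fix r assume "r \<in> PIdl a"
      then have "(r, \<zero>) \<in> K" using K AI.zero_closed by auto
      then show "r \<in> fst ` K" by (rule image_eqI[rotated]) simp
    qed
    moreover have "fst ` K \<subseteq> soc_Ra" using K by auto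
    ultimately show "ideal (fst ` K) R \<and> PIdl a \<subseteq> fst ` K \<and> fst ` K \<subseteq> soc_Ra"
      using IM.fst_ideal_A[OF KA] by simp
  next
    fix K L assume K: "?Q K" and L: "?Q L" and KL: "K \<subseteq> L"
      and f: "{x \<in> I. (\<zero>, x) \<in> K} = {x \<in> I. (\<zero>, x) \<in> L}" and g: "fst ` K = fst ` L"
    have "L \<subseteq> K"
    proof (rule IM.ideal_A_le)
      fix x assume x: "(\<zero>, x) \<in> L"
      then have "x \<in> I" using L by auto
      then have "x \<in> {x \<in> I. (\<zero>, x) \<in> K}" unfolding f using x by simp
      then show "(\<zero>, x) \<in> K" by simp
    qed (use K L KL g in auto)
    then show "K = L" using KL by (intro equalityI)
  qed auto
  also have "\<dots> \<le> len aI soc_I + 1"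
    using len_soc_Ra by (rule add_left_mono)
  finally have "chain_length ?Q \<le> 1 + len aI soc_I"
    by (simp only: add.commute)
  then show ?thesis
    unfolding ring_type_A[OF gens] cm_type_I using lower by (rule antisym)
qed

end

theorem theorem6p3:
  fixes R :: "('a, 'c) ring_scheme" and m I :: "'a set"
  assumes "gorenstein_local_ring TYPE('e) R m"
    and "krull_dim R = 1"
    and "primary_ideal I R" and "radical R I = m"
  shows "(ring_type (R Quot I) \<le> cm_type R (ideal_module R I) \<and>
          cm_type R (ideal_module R I) \<le> 1 + ring_type (R Quot I)) \<and>
         (min_gens R I > 1 \<longrightarrow>
          ring_type (idealization R (ideal_module R I)) = 1 + cm_type R (ideal_module R I))"
proof -
  interpret R: local_noetherian_ring R m
    using assms(1) by (simp add: gorenstein_local_ring_def noetherian_local_ring_iff)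
  obtain E :: "nat \<Rightarrow> ('a, 'e) module" and \<delta> \<eta> N
    where "injective_resolution R (regular_module R) E \<delta> \<eta>" "\<forall>i>N. carrier (E i) = {\<zero>\<^bsub>E i\<^esub>}"
    using assms(1) unfolding gorenstein_local_ring_def finite_injective_dimension_def by blast
  then interpret G: gorenstein_dim_1 R m E \<delta> \<eta> N
    using assms(2) by unfold_locales auto
  have I: "ideal I R" "I \<noteq> carrier R" using assms(3) by (simp_all add: primary_ideal_def)
  obtain c where c: "c \<in> m" "\<And>x. x \<in> carrier R \<Longrightarrow> c \<otimes>\<^bsub>R\<^esub> x = \<zero>\<^bsub>R\<^esub> \<Longrightarrow> x = \<zero>\<^bsub>R\<^esub>"
    using G.regular_element_exists by blast
  obtain n :: nat where n: "c \<in> carrier R" "c [^]\<^bsub>R\<^esub> n \<in> I"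
    using c(1) assms(4) by (auto simp: radical_def)
  have primary: "P = m" if P: "primeideal P R" "I \<subseteq> P" for P
  proof (rule equalityI)
    show "P \<subseteq> m" by (rule G.prime_le[OF P(1)])
    show "m \<subseteq> P"
    proof
      fix x assume "x \<in> m"
      then obtain k :: nat where "x \<in> carrier R" "x [^]\<^bsub>R\<^esub> k \<in> P"
        using assms(4) P(2) by (auto simp: radical_def)
      then show "x \<in> P" by (rule primeideal.power_mem_imp_mem[OF P(1)])
    qed
  qed
  interpret L: local_ring_mod_primary R m I
    by (rule local_ring_mod_primary.intro[OF R.local_noetherian_ring_axioms
        local_ring_mod_primary_axioms.intro[OF I primary]])
  interpret gorenstein_primary_ideal R m E \<delta> \<eta> N I "c [^]\<^bsub>R\<^esub> n"
  proof (rule gorenstein_primary_ideal.intro[OF G.gorenstein_dim_1_axioms L.local_ring_mod_primary_axioms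
        gorenstein_primary_ideal_axioms.intro[OF n(2)]])
    fix x assume x: "x \<in> carrier R" "c [^]\<^bsub>R\<^esub> n \<otimes>\<^bsub>R\<^esub> x = \<zero>\<^bsub>R\<^esub>"
    show "x = \<zero>\<^bsub>R\<^esub>"
      by (rule R.regular_power[OF n(1) _ x]) (rule c(2))
  qed
  show ?thesis
    by (intro conjI impI type_lower type_upper type_idealization)
qed

end
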